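(* Let $\mathcal{M}$ be a $\sqrt[6]{1}$-matroid of rank $r$ on an $n$-element ground set which is uniquely representable over $\mathbb{H}$. Then: (1) The Jacobian of $\mathcal{M}$ is well-defined, i.e. for any two $\mathbb{H}$-representations $M_1,M_2$ of $\mathcal{M}$ we have $\mathrm{Jac}(M_1)\cong \mathrm{Jac}(M_2)$ as $\mathcal{E}$-modules. (2) If $M$ is an $r\times n$ $\mathbb{H}$-representation of $\mathcal{M}$ and the Smith normal form of $MM^{\mathrm H}$ over $\mathcal{E}$ has diagonal $(\alpha_1,\dots,\alpha_r)$, then $$\mathrm{Jac}(\mathcal{M})\cong_{\mathcal{E}}\bigoplus_{i=1}^r \mathcal{E}/(\alpha_i)$$ as $\mathcal{E}$-modules, and moreover $\alpha_i^6\in\mathbb{Z}\setminus\{0\}$ for every $i$.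
   Context: Let $\omega=e^{2\pi i/6}$ and $\mathcal{E}=\mathbb{Z}[\omega]$ (the Eisenstein integers, a Euclidean domain hence a PID). Let $\mathbb{H}=\{z\in\mathbb{C}: z^6=1\}\cup\{0\}$. A complex matrix is an $\mathbb{H}$-matrix if every square subdeterminant (in particular every entry) lies in $\mathbb{H}$. A matroid $\mathcal{M}$ on ground set $E$ with $|E|=n$ is represented by a complex matrix $M$ with columns indexed by $E$ if a set of elements is independent in $\mathcal{M}$ iff the corresponding columns are linearly independent over $\mathbb{C}$; if $M$ is an $\mathbb{H}$-matrix it is an $\mathbb{H}$-representation and $\mathcal{M}$ is a $\sqrt[6]{1}$-matroid. For a matrix $M$, $\overline{M}$ is its complex conjugate and $M^{\mathrm H}$ its conjugate transpose. For an $\mathbb{H}$-matrix $M$ with $n$ columns, set $\Lambda^*_{\mathcal{E}}(M)=\mathrm{row}_{\mathbb{C}}(M)\cap\mathcal{E}^n$ and $\Lambda_{\mathcal{E}}(M)=\mathrm{row}_{\mathbb{C}}(M)^{\perp}\cap\mathcal{E}^n$, where $\perp$ is the orthogonal complement for the Hermitian inner product (so $\mathrm{row}_{\mathbb{C}}(M)^\perp=\{v\in\mathbb{C}^n: vM^{\mathrm H}=0\}$, vectors written as rows), and define the $\mathcal{E}$-module $\mathrm{Jac}(M)=\mathcal{E}^n/(\Lambda_{\mathcal{E}}(M)\oplus\Lambda^*_{\mathcal{E}}(M))$. When $\mathrm{Jac}(M)$ is independent (up to $\mathcal{E}$-module isomorphism) of the choice of $\mathbb{H}$-representation $M$ of $\mathcal{M}$,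 it is denoted $\mathrm{Jac}(\mathcal{M})$. Two $\mathbb{H}$-representations are equivalent if one is obtained from the other by a sequence of: multiplying a row or column by a sixth root of unity; interchanging two rows; interchanging two columns (with their labels); pivoting on a nonzero entry. $\mathcal{M}$ (of rank $r$, $n$ elements) is uniquely representable over $\mathbb{H}$ if for any two $r\times n$ $\mathbb{H}$-representations $M_1,M_2$, $M_1$ is equivalent to $M_2$ or to $\overline{M_2}$. Smith normal form over a PID $R$: for a nonzero matrix $A$ of rank $r$ there are invertible $S,T$ over $R$ with $SAT$ diagonal with diagonal $(\alpha_1,\dots,\alpha_r,0,\dots,0)$, $\alpha_i\mid\alpha_{i+1}$, the $\alpha_i$ unique up to units. *)

theory Defs
  imports
    "HOL-Algebra.Divisibility"
    "HOL-Algebra.QuotRing"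
    "Jordan_Normal_Form.Schur_Decomposition"
    "Jordan_Normal_Form.DL_Submatrix"
    "Jordan_Normal_Form.VS_Connect"
begin

hide_const (open) Polynomial.smult

section \<open>Modules\<close>

definition module_isomorphic ::
  "('a, 'c) ring_scheme \<Rightarrow> ('a, 'b, 'd) module_scheme \<Rightarrow> ('a, 'e, 'f) module_scheme \<Rightarrow> bool" where
  "module_isomorphic R M N \<longleftrightarrow>
     (\<exists>f \<in> LinearCombinations.module_hom R M N. bij_betw f (carrier M) (carrier N))"

text \<open>As for \<^const>\<open>FactRing\<close>, operations on cosets are taken over all representatives: if N is a
  submodule, scalar multiplication sends the coset of x to the coset of the scaled x.\<close>

definition quotient_module :: "('a, 'b, 'c) module_scheme \<Rightarrow> 'b set \<Rightarrow> ('a, 'b set) module" where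
  "quotient_module M N =
     \<lparr>carrier = a_rcosets\<^bsub>M\<^esub> N, mult = undefined, one = undefined,
      zero = N, add = set_add M,
      smult = (\<lambda>c X. \<Union>x\<in>X. N +>\<^bsub>M\<^esub> (c \<odot>\<^bsub>M\<^esub> x))\<rparr>"

definition regular_module :: "('a, 'c) ring_scheme \<Rightarrow> ('a, 'a) module" where
  "regular_module R =
     \<lparr>carrier = carrier R, mult = mult R, one = one R, zero = zero R, add = add R,
      smult = mult R\<rparr>"

definition cyclic_module :: "('a, 'c) ring_scheme \<Rightarrow> 'a \<Rightarrow> ('a, 'a set) module" where
  "cyclic_module R a = quotient_module (regular_module R) (PIdl\<^bsub>R\<^esub> a)"

text \<open>The product over I, which is the direct sum when I is finite.\<close>

definition finite_direct_sum :: "'i set \<Rightarrow> ('i \<Rightarrow> ('a, 'b, 'c) module_scheme) \<Rightarrow> ('a, 'i \<Rightarrow> 'b) module" where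
  "finite_direct_sum I F =
     \<lparr>carrier = (\<Pi>\<^sub>E i\<in>I. carrier (F i)), mult = undefined, one = undefined,
      zero = (\<lambda>i\<in>I. \<zero>\<^bsub>F i\<^esub>),
      add = (\<lambda>x y. \<lambda>i\<in>I. x i \<oplus>\<^bsub>F i\<^esub> y i),
      smult = (\<lambda>c x. \<lambda>i\<in>I. c \<odot>\<^bsub>F i\<^esub> x i)\<rparr>"

section \<open>Eisenstein integers\<close>

definition eis_omega :: complex where
  "eis_omega = exp (2 * of_real pi * \<i> / 6)"

definition eis_ints :: "complex set" where
  "eis_ints = {of_int a + of_int b * eis_omega | a b. True}"

definition eis_ring :: "complex ring" where
  "eis_ring = class_ring\<lparr>carrier := eis_ints\<rparr>"

definition eis_vecs :: "nat \<Rightarrow> complex vec set" where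
  "eis_vecs n = {v \<in> carrier_vec n. \<forall>i<n. v $ i \<in> eis_ints}"

definition eis_module :: "nat \<Rightarrow> (complex, complex vec) module" where
  "eis_module n = (module_vec TYPE(complex) n)\<lparr>carrier := eis_vecs n\<rparr>"

definition eis_invertible :: "nat \<Rightarrow> complex mat \<Rightarrow> bool" where
  "eis_invertible k S \<longleftrightarrow>
     S \<in> carrier_mat k k \<and> elements_mat S \<subseteq> eis_ints \<and>
     (\<exists>S' \<in> carrier_mat k k. elements_mat S' \<subseteq> eis_ints \<and> S * S' = 1\<^sub>m k \<and> S' * S = 1\<^sub>m k)"

text \<open>The list is the whole main diagonal. Since 0 divides only 0, zeros can only occur as trailing
  entries, and there are as many nonzero entries as the rank of A.\<close>

definition eis_smith_diagonal :: "complex mat \<Rightarrow> complex list \<Rightarrow> bool" where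
  "eis_smith_diagonal A \<alpha>s \<longleftrightarrow>
     length \<alpha>s = min (dim_row A) (dim_col A) \<and> set \<alpha>s \<subseteq> eis_ints \<and>
     (\<forall>i. Suc i < length \<alpha>s \<longrightarrow> \<alpha>s ! i divides\<^bsub>eis_ring\<^esub> \<alpha>s ! Suc i) \<and>
     (\<exists>S T. eis_invertible (dim_row A) S \<and> eis_invertible (dim_col A) T \<and>
        S * A * T = mat (dim_row A) (dim_col A) (\<lambda>(i, j). if i = j then \<alpha>s ! i else 0))"

section \<open>Matrices all of whose subdeterminants are 0 or sixth roots of unity\<close>

definition sixth_roots_0 :: "complex set" where
  "sixth_roots_0 = {z. z ^ 6 = 1} \<union> {0}"

definition H_matrix :: "complex mat \<Rightarrow> bool" where
  "H_matrix M \<longleftrightarrow>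
     (\<forall>I J. I \<subseteq> {..<dim_row M} \<longrightarrow> J \<subseteq> {..<dim_col M} \<longrightarrow> card I = card J \<longrightarrow>
        det (submatrix M I J) \<in> sixth_roots_0)"

abbreviation complex_row_space :: "complex mat \<Rightarrow> complex vec set" where
  "complex_row_space M \<equiv> vec_space.row_space (dim_col M) M"

definition lattice_dual :: "complex mat \<Rightarrow> complex vec set" where
  "lattice_dual M = complex_row_space M \<inter> eis_vecs (dim_col M)"

definition lattice_orth :: "complex mat \<Rightarrow> complex vec set" where
  "lattice_orth M =
     {v \<in> carrier_vec (dim_col M). \<forall>w \<in> complex_row_space M. v \<bullet>c w = 0} \<inter> eis_vecs (dim_col M)"

definition Jac :: "complex mat \<Rightarrow> (complex, complex vec set) module" where
  "Jac M = (let V = eis_module (dim_col M)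
            in quotient_module V (lattice_orth M <+>\<^bsub>V\<^esub> lattice_dual M))"

section \<open>Matroids and their representations\<close>

locale matroid =
  fixes E :: "'a set" and indep :: "'a set \<Rightarrow> bool"
  assumes finite_ground: "finite E"
    and indep_subset_ground: "indep X \<Longrightarrow> X \<subseteq> E"
    and indep_empty: "indep {}"
    and indep_subset: "indep X \<Longrightarrow> Y \<subseteq> X \<Longrightarrow> indep Y"
    and exchange: "indep X \<Longrightarrow> indep Y \<Longrightarrow> card X < card Y \<Longrightarrow> \<exists>e \<in> Y - X. indep (insert e X)"

definition matroid_rank :: "('a set \<Rightarrow> bool) \<Rightarrow> nat" where
  "matroid_rank indep = Max (card ` {X. indep X})"

text \<open>Linear independence of the family of columns indexed by J; equal columns with different
  indices are dependent, whence the injectivity.\<close>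

definition columns_lin_indpt :: "complex mat \<Rightarrow> nat set \<Rightarrow> bool" where
  "columns_lin_indpt M J \<longleftrightarrow>
     inj_on (col M) J \<and>
     \<not> LinearCombinations.module.lin_dep class_ring (module_vec TYPE(complex) (dim_row M)) (col M ` J)"

text \<open>A matrix with columns indexed by E is a matrix together with the list of the labels of its
  columns.\<close>

type_synonym 'a labelled_mat = "complex mat \<times> 'a list"

definition represents :: "'a labelled_mat \<Rightarrow> 'a set \<Rightarrow> ('a set \<Rightarrow> bool) \<Rightarrow> bool" where
  "represents X E indep \<longleftrightarrow> (case X of (M, es) \<Rightarrow>
     distinct es \<and> set es = E \<and> length es = dim_col M \<and>
     (\<forall>J \<subseteq> {..<dim_col M}. indep ((!) es ` J) \<longleftrightarrow> columns_lin_indpt M J))"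

definition H_representation :: "'a labelled_mat \<Rightarrow> 'a set \<Rightarrow> ('a set \<Rightarrow> bool) \<Rightarrow> bool" where
  "H_representation X E indep \<longleftrightarrow> H_matrix (fst X) \<and> represents X E indep"

definition sixth_root_matroid :: "'a set \<Rightarrow> ('a set \<Rightarrow> bool) \<Rightarrow> bool" where
  "sixth_root_matroid E indep \<longleftrightarrow> matroid E indep \<and> (\<exists>X. H_representation X E indep)"

text \<open>Pivoting on the (s,t) entry: the row operations that turn column t into the s-th unit
  vector.\<close>

definition pivot :: "nat \<Rightarrow> nat \<Rightarrow> complex mat \<Rightarrow> complex mat" where
  "pivot s t A = mat (dim_row A) (dim_col A) (\<lambda>(i, j).
     if i = s then A $$ (s, j) / A $$ (s, t)
     else A $$ (i, j) - A $$ (i, t) * A $$ (s, j) / A $$ (s, t))"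

inductive elementary_move :: "'a labelled_mat \<Rightarrow> 'a labelled_mat \<Rightarrow> bool" where
  scale_row: "i < dim_row A \<Longrightarrow> u ^ 6 = 1 \<Longrightarrow> elementary_move (A, es) (multrow i u A, es)"
| scale_col: "j < dim_col A \<Longrightarrow> u ^ 6 = 1 \<Longrightarrow> elementary_move (A, es) (multcol j u A, es)"
| swap_rows: "i < dim_row A \<Longrightarrow> k < dim_row A \<Longrightarrow> elementary_move (A, es) (swaprows i k A, es)"
| swap_cols: "j < dim_col A \<Longrightarrow> k < dim_col A \<Longrightarrow>
    elementary_move (A, es) (swapcols j k A, es[j := es ! k, k := es ! j])"
| pivoting: "s < dim_row A \<Longrightarrow> t < dim_col A \<Longrightarrow> A $$ (s, t) \<noteq> 0 \<Longrightarrow>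
    elementary_move (A, es) (pivot s t A, es)"

text \<open>A single pivot need not be undone by further moves (the columns of the identity matrix can
  only be scaled and permuted), so we take the equivalence relation on H-matrices that the moves
  generate.\<close>

definition H_equivalent :: "'a labelled_mat \<Rightarrow> 'a labelled_mat \<Rightarrow> bool" where
  "H_equivalent =
     equivclp (\<lambda>X Y. H_matrix (fst X) \<and> H_matrix (fst Y) \<and> elementary_move X Y)"

definition uniquely_H_representable :: "'a set \<Rightarrow> ('a set \<Rightarrow> bool) \<Rightarrow> bool" where
  "uniquely_H_representable E indep \<longleftrightarrow>
     (\<forall>M\<^sub>1 es\<^sub>1 M\<^sub>2 es\<^sub>2.
        M\<^sub>1 \<in> carrier_mat (matroid_rank indep) (card E) \<longrightarrow>
        M\<^sub>2 \<in> carrier_mat (matroid_rank indep) (card E) \<longrightarrow>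
        H_representation (M\<^sub>1, es\<^sub>1) E indep \<longrightarrow> H_representation (M\<^sub>2, es\<^sub>2) E indep \<longrightarrow>
        H_equivalent (M\<^sub>1, es\<^sub>1) (M\<^sub>2, es\<^sub>2) \<or>
        H_equivalent (M\<^sub>1, es\<^sub>1) (map_mat cnj M\<^sub>2, es\<^sub>2))"

end

theory Submission
  imports Defs "Jordan_Normal_Form.DL_Rank"
begin

text \<open>An H-representation M with r rows has entries in the Eisenstein integers and, since its maximal
  minors are 0 or units, a right inverse R over them. Hence multiplication by the conjugate of M maps
  the lattice of integer vectors onto \<open>\<E>\<^sup>r\<close>, has kernel \<open>\<Lambda>(M)\<close>, and sends
  \<open>\<Lambda>\<^sup>*(M)\<close> onto the image of the transpose of \<open>A = M M\<^sup>H\<close>; so Jac(M) is the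
  cokernel of that transpose, and diagonalizing A splits it into cyclic modules.
  Row moves do not change the row space and column moves are unitary over the Eisenstein integers, so
  the moves preserve the Jacobian. Conjugating M transposes A, which does not affect the cokernel
  because over a Euclidean domain A can be diagonalized.\<close>

section \<open>Modules and quotients\<close>

text \<open>The uniqueness hypothesis speaks only of matrices with r rows, whereas part (1) admits
  representations with any number of rows, and a matrix with dependent rows has no right inverse. An
  arbitrary representation is therefore cut down to a row basis: deleting the other rows keeps the
  H-matrix property, the row space and the column dependencies, and equality of row and column rank
  makes the number of remaining rows the matroid rank. The dual lattice has the image claimed above
  because an integral vector b of the row space, say b = \<open>M\<^sup>T *\<^sub>v y\<close>,
  satisfies y = \<open>R\<^sup>T *\<^sub>v b\<close>, so its coefficients are integral as well. Row
  vectors are coded as column vectors throughout: y M becomes \<open>M\<^sup>T *\<^sub>v y\<close>,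
  which is how the transpose \<open>map_mat cnj M * M\<^sup>T\<close> of A enters. The invariant
  factors are nonzero because A is the Gram matrix of independent rows, and their sixth powers are
  real because A is Hermitian.\<close>

lemma module_isomorphicI:
  assumes "\<And>x. x \<in> carrier M \<Longrightarrow> f x \<in> carrier N"
    and "\<And>x y. x \<in> carrier M \<Longrightarrow> y \<in> carrier M \<Longrightarrow> f (x \<oplus>\<^bsub>M\<^esub> y) = f x \<oplus>\<^bsub>N\<^esub> f y"
    and "\<And>c x. c \<in> carrier R \<Longrightarrow> x \<in> carrier M \<Longrightarrow> f (c \<odot>\<^bsub>M\<^esub> x) = c \<odot>\<^bsub>N\<^esub> f x"
    and "bij_betw f (carrier M) (carrier N)"
  shows "module_isomorphic R M N"
  using assms unfolding module_isomorphic_def LinearCombinations.module_hom_def by blast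

lemma module_isomorphic_refl: "module_isomorphic R M M"
  by (rule module_isomorphicI[where f = id]) (auto simp: bij_betw_id)

lemma module_isomorphic_trans:
  assumes "module_isomorphic R L M" and "module_isomorphic R M N"
  shows "module_isomorphic R L N"
proof -
  obtain f where f_hom: "f \<in> LinearCombinations.module_hom R L M"
    and f_bij: "bij_betw f (carrier L) (carrier M)"
    using assms(1) unfolding module_isomorphic_def by auto
  note f = funcset_mem[OF LinearCombinations.module_hom_closed[OF f_hom]]
    LinearCombinations.module_hom_add[OF f_hom] LinearCombinations.module_hom_smult[OF f_hom] f_bij
  obtain g where g_hom: "g \<in> LinearCombinations.module_hom R M N"
    and g_bij: "bij_betw g (carrier M) (carrier N)"
    using assms(2) unfolding module_isomorphic_def by auto
  note g = funcset_mem[OF LinearCombinations.module_hom_closed[OF g_hom]]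
    LinearCombinations.module_hom_add[OF g_hom] LinearCombinations.module_hom_smult[OF g_hom] g_bij
  show ?thesis
    by (rule module_isomorphicI[where f = "g \<circ> f"])
      (auto simp: f g intro: bij_betw_trans[OF f(4) g(4)])
qed

text \<open>M and N are bare records here, so closure of M under its operations is assumed: the
  inverse g is shown to be compatible by evaluating \<open>g (f z)\<close> at a sum or multiple z
  formed in M, which has to lie in the carrier.\<close>

lemma module_isomorphic_sym:
  assumes iso: "module_isomorphic R M N"
    and add: "\<And>x y. x \<in> carrier M \<Longrightarrow> y \<in> carrier M \<Longrightarrow> x \<oplus>\<^bsub>M\<^esub> y \<in> carrier M"
    and smult: "\<And>c x. c \<in> carrier R \<Longrightarrow> x \<in> carrier M \<Longrightarrow> c \<odot>\<^bsub>M\<^esub> x \<in> carrier M"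
  shows "module_isomorphic R N M"
proof -
  obtain f where f_hom: "f \<in> LinearCombinations.module_hom R M N"
    and f_bij: "bij_betw f (carrier M) (carrier N)"
    using iso unfolding module_isomorphic_def by auto
  note f = funcset_mem[OF LinearCombinations.module_hom_closed[OF f_hom]]
    LinearCombinations.module_hom_add[OF f_hom] LinearCombinations.module_hom_smult[OF f_hom] f_bij
  define g where "g = inv_into (carrier M) f"
  have g: "bij_betw g (carrier N) (carrier M)"
    unfolding g_def by (rule bij_betw_inv_into[OF f(4)])
  have gc: "g x \<in> carrier M" if "x \<in> carrier N" for x
    using g that by (auto simp: bij_betw_def)
  have fg: "f (g x) = x" if "x \<in> carrier N" for x
    unfolding g_def using f(4) that by (simp add: bij_betw_inv_into_right)
  have gf: "g (f x) = x" if "x \<in> carrier M" for x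
    unfolding g_def using f(4) that by (simp add: bij_betw_inv_into_left)
  show ?thesis
  proof (rule module_isomorphicI[where f = g])
    fix x y assume "x \<in> carrier N" "y \<in> carrier N"
    then show "g (x \<oplus>\<^bsub>N\<^esub> y) = g x \<oplus>\<^bsub>M\<^esub> g y"
      using f(2)[OF gc gc, of x y] gf[OF add[OF gc gc], of x y] by (simp add: fg)
  next
    fix c x assume "c \<in> carrier R" "x \<in> carrier N"
    then show "g (c \<odot>\<^bsub>N\<^esub> x) = c \<odot>\<^bsub>M\<^esub> g x"
      using f(3)[OF _ gc, of c x] gf[OF smult[OF _ gc], of c x] by (simp add: fg)
  qed (auto simp: g gc)
qed

locale quotient_by_submodule = Module.module R V + sub: Module.submodule N R V
  for R (structure) and V (structure) and N
begin

sublocale abelian_subgroup N V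
  by (intro abelian_subgroupI3 additive_subgroupI sub.is_subgroup abelian_group_axioms)

text \<open>Changing z by an element k of N changes the scaled vector by the scaled k, which is
  again in N. Hence all members of the union in the definition of \<open>quotient_module\<close> are
  the same coset.\<close>

lemma coset_smult:
  assumes "c \<in> carrier R" and "x \<in> carrier V"
  shows "(\<Union>z\<in>N +>\<^bsub>V\<^esub> x. N +>\<^bsub>V\<^esub> (c \<odot>\<^bsub>V\<^esub> z)) = N +>\<^bsub>V\<^esub> (c \<odot>\<^bsub>V\<^esub> x)"
proof -
  have "N +>\<^bsub>V\<^esub> (c \<odot>\<^bsub>V\<^esub> z) = N +>\<^bsub>V\<^esub> (c \<odot>\<^bsub>V\<^esub> x)" if z: "z \<in> N +>\<^bsub>V\<^esub> x" for z
  proof -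
    obtain k where k: "k \<in> N" "z = k \<oplus>\<^bsub>V\<^esub> x"
      using z unfolding a_r_coset_def' by auto
    have "c \<odot>\<^bsub>V\<^esub> z = c \<odot>\<^bsub>V\<^esub> k \<oplus>\<^bsub>V\<^esub> c \<odot>\<^bsub>V\<^esub> x"
      using k assms by (simp add: smult_r_distr)
    then have "c \<odot>\<^bsub>V\<^esub> z \<in> N +>\<^bsub>V\<^esub> (c \<odot>\<^bsub>V\<^esub> x)"
      using k assms sub.smult_closed unfolding a_r_coset_def' by auto
    then show ?thesis
      using a_repr_independence' assms by auto
  qed
  moreover have "x \<in> N +>\<^bsub>V\<^esub> x" using assms a_rcos_self by auto
  ultimately show ?thesis by blast
qed

lemma quotient_carrierE:
  assumes "X \<in> carrier (quotient_module V N)"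
  obtains x where "x \<in> carrier V" "X = N +>\<^bsub>V\<^esub> x"
  using assms unfolding quotient_module_def A_RCOSETS_def' by auto

lemma quotient_carrierI: "x \<in> carrier V \<Longrightarrow> N +>\<^bsub>V\<^esub> x \<in> carrier (quotient_module V N)"
  unfolding quotient_module_def A_RCOSETS_def' by auto

lemma quotient_add:
  "x \<in> carrier V \<Longrightarrow> y \<in> carrier V \<Longrightarrow>
    (N +>\<^bsub>V\<^esub> x) \<oplus>\<^bsub>quotient_module V N\<^esub> (N +>\<^bsub>V\<^esub> y) = N +>\<^bsub>V\<^esub> (x \<oplus>\<^bsub>V\<^esub> y)"
  unfolding quotient_module_def using a_rcos_sum by simp

lemma quotient_smult:
  "c \<in> carrier R \<Longrightarrow> x \<in> carrier V \<Longrightarrow>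
    c \<odot>\<^bsub>quotient_module V N\<^esub> (N +>\<^bsub>V\<^esub> x) = N +>\<^bsub>V\<^esub> (c \<odot>\<^bsub>V\<^esub> x)"
  unfolding quotient_module_def using coset_smult by simp

lemma coset_eq_iff:
  assumes "x \<in> carrier V" and "y \<in> carrier V"
  shows "N +>\<^bsub>V\<^esub> x = N +>\<^bsub>V\<^esub> y \<longleftrightarrow> x \<ominus>\<^bsub>V\<^esub> y \<in> N"
  using assms a_rcos_module[OF assms(2,1)] a_repr_independence' a_rcos_self
  unfolding a_minus_def by metis

lemma quotient_iso_sym:
  assumes "module_isomorphic R (quotient_module V N) M"
  shows "module_isomorphic R M (quotient_module V N)"
proof (rule module_isomorphic_sym[OF assms])
  fix x y assume "x \<in> carrier (quotient_module V N)" "y \<in> carrier (quotient_module V N)"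
  then show "x \<oplus>\<^bsub>quotient_module V N\<^esub> y \<in> carrier (quotient_module V N)"
    by (elim quotient_carrierE) (simp add: quotient_add quotient_carrierI)
next
  fix c x assume "c \<in> carrier R" "x \<in> carrier (quotient_module V N)"
  then show "c \<odot>\<^bsub>quotient_module V N\<^esub> x \<in> carrier (quotient_module V N)"
    by (elim quotient_carrierE) (simp add: quotient_smult quotient_carrierI)
qed

text \<open>The kernel condition compares values of f instead of asking for zero, because P is an
  arbitrary record. A direct sum of cyclic modules can then serve as P without being shown to be a
  module.\<close>

lemma first_isomorphism:
  assumes f: "\<And>x. x \<in> carrier V \<Longrightarrow> f x \<in> carrier P"
    and add: "\<And>x y. x \<in> carrier V \<Longrightarrow> y \<in> carrier V \<Longrightarrow> f (x \<oplus>\<^bsub>V\<^esub> y) = f x \<oplus>\<^bsub>P\<^esub> f y"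
    and smult: "\<And>c x. c \<in> carrier R \<Longrightarrow> x \<in> carrier V \<Longrightarrow> f (c \<odot>\<^bsub>V\<^esub> x) = c \<odot>\<^bsub>P\<^esub> f x"
    and surj: "\<And>p. p \<in> carrier P \<Longrightarrow> \<exists>x\<in>carrier V. f x = p"
    and ker: "\<And>x y. x \<in> carrier V \<Longrightarrow> y \<in> carrier V \<Longrightarrow> f x = f y \<longleftrightarrow> x \<ominus>\<^bsub>V\<^esub> y \<in> N"
  shows "module_isomorphic R (quotient_module V N) P"
proof -
  \<comment> \<open>F evaluates f at an arbitrary representative; \<open>ker\<close> makes the
    choice immaterial.\<close>
  define F where "F X = f (SOME x. x \<in> X)" for X
  have F: "F (N +>\<^bsub>V\<^esub> x) = f x" if x: "x \<in> carrier V" for x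
  proof -
    have "(SOME z. z \<in> N +>\<^bsub>V\<^esub> x) \<in> N +>\<^bsub>V\<^esub> x"
      using a_rcos_self[OF x] by (rule someI)
    moreover have "f z = f x" if "z \<in> N +>\<^bsub>V\<^esub> x" for z
    proof -
      have z: "z \<in> carrier V" using a_elemrcos_carrier[OF x that] .
      have "N +>\<^bsub>V\<^esub> z = N +>\<^bsub>V\<^esub> x" using a_repr_independence'[OF that x] by simp
      then show ?thesis using coset_eq_iff[OF z x] ker[OF z x] by simp
    qed
    ultimately show ?thesis unfolding F_def by simp
  qed
  show ?thesis
  proof (rule module_isomorphicI[where f = F])
    show "F x \<in> carrier P" if "x \<in> carrier (quotient_module V N)" for x
      using that by (elim quotient_carrierE) (simp add: F f)
    show "F (x \<oplus>\<^bsub>quotient_module V N\<^esub> y) = F x \<oplus>\<^bsub>P\<^esub> F y"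
      if "x \<in> carrier (quotient_module V N)" "y \<in> carrier (quotient_module V N)" for x y
      using that by (elim quotient_carrierE) (simp add: F quotient_add add)
    show "F (c \<odot>\<^bsub>quotient_module V N\<^esub> x) = c \<odot>\<^bsub>P\<^esub> F x"
      if "c \<in> carrier R" "x \<in> carrier (quotient_module V N)" for c x
      using that by (elim quotient_carrierE) (simp add: F quotient_smult smult)
    show "bij_betw F (carrier (quotient_module V N)) (carrier P)"
      unfolding bij_betw_def
    proof
      show "inj_on F (carrier (quotient_module V N))"
        by (rule inj_onI, elim quotient_carrierE) (simp add: F ker coset_eq_iff)
      show "F ` carrier (quotient_module V N) = carrier P"
      proof
        show "F ` carrier (quotient_module V N) \<subseteq> carrier P"
          by (auto elim!: quotient_carrierE simp: F f)
        show "carrier P \<subseteq> F ` carrier (quotient_module V N)"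
        proof
          fix p assume "p \<in> carrier P"
          then obtain x where x: "x \<in> carrier V" "f x = p" using surj by auto
          then show "p \<in> F ` carrier (quotient_module V N)"
            by (auto intro!: image_eqI[where x = "N +>\<^bsub>V\<^esub> x"] quotient_carrierI simp: F)
        qed
      qed
    qed
  qed
qed

end

text \<open>The first isomorphism theorem for g followed by the projection onto cosets of K; N is
  the preimage of K.\<close>

lemma quotient_iso_quotient:
  assumes "quotient_by_submodule R V N" and "quotient_by_submodule R W K"
    and g: "\<And>x. x \<in> carrier V \<Longrightarrow> g x \<in> carrier W"
    and add: "\<And>x y. x \<in> carrier V \<Longrightarrow> y \<in> carrier V \<Longrightarrow> g (x \<oplus>\<^bsub>V\<^esub> y) = g x \<oplus>\<^bsub>W\<^esub> g y"
    and smult: "\<And>c x. c \<in> carrier R \<Longrightarrow> x \<in> carrier V \<Longrightarrow> g (c \<odot>\<^bsub>V\<^esub> x) = c \<odot>\<^bsub>W\<^esub> g x"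
    and surj: "\<And>w. w \<in> carrier W \<Longrightarrow> \<exists>x\<in>carrier V. g x = w"
    and ker: "\<And>x. x \<in> carrier V \<Longrightarrow> g x \<in> K \<longleftrightarrow> x \<in> N"
  shows "module_isomorphic R (quotient_module V N) (quotient_module W K)"
proof -
  interpret V: quotient_by_submodule R V N by fact
  interpret W: quotient_by_submodule R W K by fact
  \<comment> \<open>Only additivity of g is given, so compatibility with subtraction comes from
    adding \<open>g y\<close> back and cancelling it in W.\<close>
  have minus: "g (x \<ominus>\<^bsub>V\<^esub> y) = g x \<ominus>\<^bsub>W\<^esub> g y" if "x \<in> carrier V" "y \<in> carrier V" for x y
  proof -
    have "g (x \<ominus>\<^bsub>V\<^esub> y) \<oplus>\<^bsub>W\<^esub> g y = g x"
      using that add[of "x \<ominus>\<^bsub>V\<^esub> y" y]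
      by (simp add: V.minus_eq V.a_assoc V.l_neg)
    then have "(g (x \<ominus>\<^bsub>V\<^esub> y) \<oplus>\<^bsub>W\<^esub> g y) \<ominus>\<^bsub>W\<^esub> g y = g x \<ominus>\<^bsub>W\<^esub> g y" by simp
    then show ?thesis
      using that g by (simp add: W.minus_eq W.a_assoc W.r_neg)
  qed
  show ?thesis
  proof (rule V.first_isomorphism[where f = "\<lambda>x. K +>\<^bsub>W\<^esub> g x"])
    show "\<exists>x\<in>carrier V. K +>\<^bsub>W\<^esub> g x = p" if "p \<in> carrier (quotient_module W K)" for p
      using that surj by (elim W.quotient_carrierE) blast
    show "K +>\<^bsub>W\<^esub> g x = K +>\<^bsub>W\<^esub> g y \<longleftrightarrow> x \<ominus>\<^bsub>V\<^esub> y \<in> N"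
      if "x \<in> carrier V" "y \<in> carrier V" for x y
      using that by (simp add: W.coset_eq_iff g minus[symmetric] ker)
  qed (simp_all add: g add smult W.quotient_carrierI W.quotient_add W.quotient_smult)
qed

section \<open>Eisenstein integers and matrices over them\<close>

lemma eis_omega_eq: "eis_omega = Complex (1/2) (sqrt 3 / 2)"
proof -
  have "eis_omega = cis (pi / 3)"
    unfolding eis_omega_def cis_conv_exp by (simp add: field_simps)
  then show ?thesis by (simp add: complex_eq_iff cos_60 sin_60)
qed

lemma eis_omega_square: "eis_omega * eis_omega = eis_omega - 1"
  by (simp add: eis_omega_eq complex_eq_iff)

lemma cnj_eis_omega: "cnj eis_omega = 1 - eis_omega"
  by (simp add: eis_omega_eq complex_eq_iff)

lemma eis_intsI: "z = of_int a + of_int b * eis_omega \<Longrightarrow> z \<in> eis_ints"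
  unfolding eis_ints_def by auto

lemma eis_intsE:
  assumes "z \<in> eis_ints"
  obtains a b where "z = of_int a + of_int b * eis_omega"
  using assms unfolding eis_ints_def by auto

lemma eis_ints_of_int [simp]: "of_int a \<in> eis_ints"
  by (rule eis_intsI[of _ a 0]) simp

lemma eis_ints_0 [simp]: "0 \<in> eis_ints" and eis_ints_1 [simp]: "1 \<in> eis_ints"
  using eis_ints_of_int[of 0] eis_ints_of_int[of 1] by simp_all

lemma eis_ints_omega [simp]: "eis_omega \<in> eis_ints"
  by (rule eis_intsI[of _ 0 1]) simp

lemma eis_ints_add [simp]: "x \<in> eis_ints \<Longrightarrow> y \<in> eis_ints \<Longrightarrow> x + y \<in> eis_ints"
proof (elim eis_intsE)
  fix a b c d assume "x = of_int a + of_int b * eis_omega" "y = of_int c + of_int d * eis_omega"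
  then show ?thesis by (intro eis_intsI[of _ "a + c" "b + d"]) (simp add: algebra_simps)
qed

lemma eis_ints_mult [simp]: "x \<in> eis_ints \<Longrightarrow> y \<in> eis_ints \<Longrightarrow> x * y \<in> eis_ints"
proof (elim eis_intsE)
  fix a b c d assume xy: "x = of_int a + of_int b * eis_omega" "y = of_int c + of_int d * eis_omega"
  have "x * y = of_int a * of_int c + (of_int a * of_int d + of_int b * of_int c) * eis_omega
      + of_int b * of_int d * (eis_omega * eis_omega)"
    unfolding xy by (simp add: algebra_simps)
  then show ?thesis unfolding eis_omega_square
    by (intro eis_intsI[of _ "a * c - b * d" "a * d + b * c + b * d"]) (simp add: algebra_simps)
qed

lemma eis_ints_uminus [simp]: "x \<in> eis_ints \<Longrightarrow> - x \<in> eis_ints"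
  using eis_ints_mult[OF eis_ints_of_int[of "-1"], of x] by simp

lemma eis_ints_diff [simp]: "x \<in> eis_ints \<Longrightarrow> y \<in> eis_ints \<Longrightarrow> x - y \<in> eis_ints"
  using eis_ints_add[of x "- y"] by simp

lemma eis_ints_power [simp]: "x \<in> eis_ints \<Longrightarrow> x ^ k \<in> eis_ints"
  by (induction k) auto

lemma eis_ints_sum [intro]: "(\<And>i. i \<in> I \<Longrightarrow> f i \<in> eis_ints) \<Longrightarrow> sum f I \<in> eis_ints"
  by (induction I rule: infinite_finite_induct) auto

lemma eis_ints_prod [intro]: "(\<And>i. i \<in> I \<Longrightarrow> f i \<in> eis_ints) \<Longrightarrow> prod f I \<in> eis_ints"
  by (induction I rule: infinite_finite_induct) auto

lemma eis_ints_cnj [simp]: "cnj x \<in> eis_ints \<longleftrightarrow> x \<in> eis_ints"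
proof -
  have "cnj x \<in> eis_ints" if "x \<in> eis_ints" for x
    using that by (elim eis_intsE) (simp add: cnj_eis_omega)
  from this[of x] this[of "cnj x"] show ?thesis by auto
qed

text \<open>The imaginary part of z is b sqrt 3 / 2, so invariance under conjugation forces b = 0.
  This is what turns a real sixth power of an invariant factor into an integer.\<close>

lemma eis_ints_real:
  assumes "z \<in> eis_ints" and "cnj z = z"
  shows "z \<in> \<int>"
proof -
  obtain a b where z: "z = of_int a + of_int b * eis_omega" by (rule eis_intsE[OF assms(1)])
  have "b = 0" using assms(2) unfolding z by (simp add: eis_omega_eq complex_eq_iff)
  then show ?thesis using z by simp
qed

lemma norm_eis:
  "(norm (of_int a + of_int b * eis_omega))\<^sup>2 = of_int (a\<^sup>2 + a * b + b\<^sup>2)"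
proof -
  have "(of_int b * sqrt 3 / 2)\<^sup>2 = (3 / 4 * (of_int b)\<^sup>2 :: real)"
    by (simp add: power_mult_distrib power_divide)
  then show ?thesis
    unfolding cmod_power2 eis_omega_eq by (simp add: power2_eq_square field_simps)
qed

text \<open>Squared norms as natural numbers allow a pivot of least norm to be chosen and units to
  be recognised by norm 1.\<close>

lemma norm_eis_nat:
  assumes "z \<in> eis_ints"
  obtains k :: nat where "(norm z)\<^sup>2 = of_nat k"
proof -
  obtain a b where z: "z = of_int a + of_int b * eis_omega" by (rule eis_intsE[OF assms(1)])
  have "(norm z)\<^sup>2 = of_int (a\<^sup>2 + a * b + b\<^sup>2)" unfolding z by (rule norm_eis)
  moreover from this have "0 \<le> a\<^sup>2 + a * b + b\<^sup>2"
    by (metis of_int_0_le_iff zero_le_power2)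
  ultimately have "(norm z)\<^sup>2 = of_nat (nat (a\<^sup>2 + a * b + b\<^sup>2))" by simp
  then show thesis by (rule that)
qed

text \<open>The identity 4 (a^2 + a b + b^2) = (2 a + b)^2 + 3 b^2 and its mirror image confine a
  and b to -1, 0, 1; the six surviving pairs are the sixth roots of unity.\<close>

lemma eis_unit_power6:
  assumes "z \<in> eis_ints" and "norm z = 1"
  shows "z ^ 6 = 1"
proof -
  obtain a b where z: "z = of_int a + of_int b * eis_omega" by (rule eis_intsE[OF assms(1)])
  have "(of_int (a\<^sup>2 + a * b + b\<^sup>2) :: real) = 1"
    using norm_eis[of a b] assms(2) unfolding z by simp
  then have e: "a\<^sup>2 + a * b + b\<^sup>2 = 1" by (simp only: of_int_eq_1_iff)
  have "(2 * a + b)\<^sup>2 + 3 * b\<^sup>2 = 4" "(2 * b + a)\<^sup>2 + 3 * a\<^sup>2 = 4"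
    using e by (auto simp: power2_eq_square algebra_simps)
  then have "b\<^sup>2 < 4" "a\<^sup>2 < 4"
    using zero_le_power2[of "2 * a + b"] zero_le_power2[of "2 * b + a"] by linarith+
  then have "\<bar>b\<bar> < 2" "\<bar>a\<bar> < 2"
    by (auto intro: power2_less_imp_less)
  then have "a \<in> {-1, 0, 1}" "b \<in> {-1, 0, 1}" by auto
  with e have cases: "(a, b) \<in> {(1, 0), (-1, 0), (0, 1), (0, -1), (1, -1), (-1, 1)}" by auto
  have o2: "eis_omega ^ 2 = eis_omega - 1" using eis_omega_square by (simp add: power2_eq_square)
  have o3: "eis_omega ^ 3 = -1"
    by (simp add: power3_eq_cube eis_omega_square left_diff_distrib)
  have o6: "eis_omega ^ 6 = 1"
    using power_mult[of eis_omega 3 2] o3 by simp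
  have w: "(eis_omega - 1) ^ 6 = 1"
    unfolding o2[symmetric] power_mult[symmetric] using power_mult[of eis_omega 6 2] o6 by simp
  then have "(1 - eis_omega) ^ 6 = 1"
    by (metis minus_diff_eq power_minus_even even_numeral)
  with cases w \<open>(1 - eis_omega) ^ 6 = 1\<close> o6 show ?thesis unfolding z by auto
qed

text \<open>Cyclotomic factorization: u^6 - 1 = (u - 1) (u + 1) (u^2 - u + 1) (u^2 + u + 1), where
  the two quadratics split over Z[omega].\<close>

lemma eis_ints_sixth_root:
  assumes "u ^ 6 = 1"
  shows "u \<in> eis_ints"
proof -
  have 1: "(u - eis_omega) * (u - (1 - eis_omega)) = u * u - u + 1"
    using eis_omega_square by (simp add: algebra_simps)
  have 2: "(u - - eis_omega) * (u - (eis_omega - 1)) = u * u + u + 1"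
    using eis_omega_square by (simp add: algebra_simps)
  have "u ^ 6 - 1 = (u - 1) * (u - - 1) * ((u - eis_omega) * (u - (1 - eis_omega))) *
      ((u - - eis_omega) * (u - (eis_omega - 1)))"
    unfolding 1 2 by (simp add: algebra_simps eval_nat_numeral)
  with assms have "u \<in> {1, - 1, eis_omega, 1 - eis_omega, - eis_omega, eis_omega - 1}"
    by (simp only: diff_self mult_eq_0_iff right_minus_eq eq_commute[of 0]) auto
  then show ?thesis by auto
qed

lemma sixth_root_norm: "(u::complex) ^ 6 = 1 \<Longrightarrow> norm u = 1"
  by (metis norm_ge_zero norm_one norm_power power_eq_imp_eq_base power_one zero_less_numeral
      zero_le_one)

lemma sixth_root_cnj: "(u::complex) ^ 6 = 1 \<Longrightarrow> u * cnj u = 1"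
  using sixth_root_norm[of u] by (simp add: complex_norm_square[symmetric])

text \<open>Rounding x / y in the basis 1, omega leaves an error of squared norm at most 1/4 + 3/16
  = 7/16 < 1.\<close>

lemma eis_ints_division:
  assumes "x \<in> eis_ints" and "y \<in> eis_ints" and "y \<noteq> 0"
  obtains q where "q \<in> eis_ints" and "norm (x - q * y) < norm y"
proof -
  define z where "z = x / y"
  \<comment> \<open>Only omega contributes to the imaginary part, namely sqrt 3 / 2, so b is rounded
    first; each omega also adds 1/2 to the real part, which is removed before rounding a.\<close>
  define b where "b = round (Im z * 2 / sqrt 3)"
  define a where "a = round (Re z - of_int b / 2)"
  define q where "q = of_int a + of_int b * eis_omega"
  have "\<bar>Im z * 2 / sqrt 3 - of_int b\<bar> \<le> 1 / 2"
    unfolding b_def using of_int_round_abs_le[of "Im z * 2 / sqrt 3"] by (simp add: abs_minus_commute)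
  then have "(Im z * 2 / sqrt 3 - of_int b)\<^sup>2 \<le> (1 / 2)\<^sup>2"
    by (rule power2_le_iff_abs_le[THEN iffD2, rotated]) simp
  moreover have "Im (z - q) = (Im z * 2 / sqrt 3 - of_int b) * (sqrt 3 / 2)"
    unfolding q_def by (simp add: eis_omega_eq field_simps)
  moreover have "(sqrt 3 / 2)\<^sup>2 = 3 / 4" by (simp add: power_divide)
  ultimately have "(Im (z - q))\<^sup>2 = (Im z * 2 / sqrt 3 - of_int b)\<^sup>2 * (3 / 4)"
    and "(Im z * 2 / sqrt 3 - of_int b)\<^sup>2 \<le> 1 / 4"
    by (simp_all only: power_mult_distrib) (simp add: power_divide)
  then have im: "(Im (z - q))\<^sup>2 \<le> 3 / 16" by linarith
  have "\<bar>Re z - of_int b / 2 - of_int a\<bar> \<le> 1 / 2"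
    unfolding a_def using of_int_round_abs_le[of "Re z - of_int b / 2"] by (simp add: abs_minus_commute)
  then have "(Re z - of_int b / 2 - of_int a)\<^sup>2 \<le> (1 / 2)\<^sup>2"
    by (rule power2_le_iff_abs_le[THEN iffD2, rotated]) simp
  moreover have re_eq: "Re (z - q) = Re z - of_int b / 2 - of_int a"
    unfolding q_def by (simp add: eis_omega_eq)
  ultimately have re: "(Re (z - q))\<^sup>2 \<le> 1 / 4" unfolding re_eq by (simp add: power_divide)
  have "(norm (z - q))\<^sup>2 < 1\<^sup>2" unfolding cmod_power2 using re im by simp
  then have "norm (z - q) < 1" by (rule power2_less_imp_less) simp
  moreover have "x - q * y = (z - q) * y" unfolding z_def using assms(3) by (simp add: field_simps)
  ultimately have "norm (x - q * y) < norm y" using assms(3) by (simp add: norm_mult)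
  moreover have "q \<in> eis_ints" unfolding q_def by simp
  ultimately show thesis using that by blast
qed

section \<open>Matrices and vectors with Eisenstein entries, and invertibility over Z[omega]\<close>

definition eis_mats :: "nat \<Rightarrow> nat \<Rightarrow> complex mat set" where
  "eis_mats m n = {A \<in> carrier_mat m n. elements_mat A \<subseteq> eis_ints}"

lemma eis_matsI:
  "A \<in> carrier_mat m n \<Longrightarrow> (\<And>i j. i < m \<Longrightarrow> j < n \<Longrightarrow> A $$ (i, j) \<in> eis_ints) \<Longrightarrow> A \<in> eis_mats m n"
  unfolding eis_mats_def by auto

lemma eis_mats_carrier: "A \<in> eis_mats m n \<Longrightarrow> A \<in> carrier_mat m n"
  unfolding eis_mats_def by auto

lemma eis_matsD: "A \<in> eis_mats m n \<Longrightarrow> i < m \<Longrightarrow> j < n \<Longrightarrow> A $$ (i, j) \<in> eis_ints"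
  unfolding eis_mats_def by blast

lemma eis_mats_one [simp]: "1\<^sub>m n \<in> eis_mats n n"
  by (rule eis_matsI) auto

lemma eis_mats_mult [intro]: "A \<in> eis_mats m n \<Longrightarrow> B \<in> eis_mats n k \<Longrightarrow> A * B \<in> eis_mats m k"
  using eis_mats_carrier[of A m n] eis_mats_carrier[of B n k]
  by (auto intro!: eis_matsI eis_ints_sum eis_ints_mult simp: scalar_prod_def eis_matsD)

lemma eis_mats_transpose [simp]: "A \<in> eis_mats m n \<Longrightarrow> A\<^sup>T \<in> eis_mats n m"
  using eis_mats_carrier[of A m n] by (auto intro!: eis_matsI simp: eis_matsD)

lemma eis_mats_cnj [simp]: "A \<in> eis_mats m n \<Longrightarrow> map_mat cnj A \<in> eis_mats m n"
  using eis_mats_carrier[of A m n] by (auto intro!: eis_matsI simp: eis_matsD)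

lemma eis_mats_swaprows_mat [simp]: "swaprows_mat n k l \<in> eis_mats n n"
  by (auto intro!: eis_matsI)

lemma eis_mats_multrow_mat [simp]: "a \<in> eis_ints \<Longrightarrow> multrow_mat n k a \<in> eis_mats n n"
  by (auto intro!: eis_matsI)

lemma eis_mats_addrow_mat [simp]: "a \<in> eis_ints \<Longrightarrow> addrow_mat n a k l \<in> eis_mats n n"
  by (auto intro!: eis_matsI)

lemma signof_eis_ints [simp]: "(signof p :: complex) \<in> eis_ints"
  using sign_def[of p] by simp

lemma eis_ints_det:
  assumes "A \<in> eis_mats n n"
  shows "det A \<in> eis_ints"
  unfolding det_def'[OF eis_mats_carrier[OF assms]]
  by (auto intro!: eis_ints_sum eis_ints_mult eis_ints_prod eis_matsD[OF assms] simp: permutes_in_image)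

lemma eis_vecsI: "v \<in> carrier_vec n \<Longrightarrow> (\<And>i. i < n \<Longrightarrow> v $ i \<in> eis_ints) \<Longrightarrow> v \<in> eis_vecs n"
  unfolding eis_vecs_def by auto

lemma eis_vecs_carrier: "v \<in> eis_vecs n \<Longrightarrow> v \<in> carrier_vec n"
  unfolding eis_vecs_def by auto

lemma eis_vecsD: "v \<in> eis_vecs n \<Longrightarrow> i < n \<Longrightarrow> v $ i \<in> eis_ints"
  unfolding eis_vecs_def by auto

lemma eis_vecs_mult_mat_vec [simp]:
  "A \<in> eis_mats m n \<Longrightarrow> v \<in> eis_vecs n \<Longrightarrow> A *\<^sub>v v \<in> eis_vecs m"
  using eis_mats_carrier[of A m n] eis_vecs_carrier[of v n]
  by (auto intro!: eis_vecsI eis_ints_sum eis_ints_mult simp: scalar_prod_def eis_matsD eis_vecsD)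

lemma eis_invertible_iff:
  "eis_invertible k S \<longleftrightarrow> S \<in> eis_mats k k \<and> (\<exists>S'\<in>eis_mats k k. S * S' = 1\<^sub>m k \<and> S' * S = 1\<^sub>m k)"
  unfolding eis_invertible_def eis_mats_def by auto

lemma eis_invertibleI:
  "S \<in> eis_mats k k \<Longrightarrow> S' \<in> eis_mats k k \<Longrightarrow> S * S' = 1\<^sub>m k \<Longrightarrow> S' * S = 1\<^sub>m k \<Longrightarrow> eis_invertible k S"
  unfolding eis_invertible_iff by auto

lemma eis_invertibleE:
  assumes "eis_invertible k S"
  obtains S' where "S \<in> eis_mats k k" "S' \<in> eis_mats k k" "S * S' = 1\<^sub>m k" "S' * S = 1\<^sub>m k"
  using assms unfolding eis_invertible_iff by auto

lemma eis_invertible_mats: "eis_invertible k S \<Longrightarrow> S \<in> eis_mats k k"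
  unfolding eis_invertible_iff by auto

lemma eis_invertible_one: "eis_invertible k (1\<^sub>m k)"
  by (rule eis_invertibleI[of _ _ "1\<^sub>m k"]) auto

lemma eis_invertible_mult:
  assumes "eis_invertible k S" and "eis_invertible k T"
  shows "eis_invertible k (S * T)"
proof -
  obtain S' where S: "S \<in> eis_mats k k" "S' \<in> eis_mats k k" "S * S' = 1\<^sub>m k" "S' * S = 1\<^sub>m k"
    by (rule eis_invertibleE[OF assms(1)])
  obtain T' where T: "T \<in> eis_mats k k" "T' \<in> eis_mats k k" "T * T' = 1\<^sub>m k" "T' * T = 1\<^sub>m k"
    by (rule eis_invertibleE[OF assms(2)])
  note c = S(1,2)[THEN eis_mats_carrier] T(1,2)[THEN eis_mats_carrier]
  show ?thesis
  proof (rule eis_invertibleI)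
    have "S * T * (T' * S') = S * (T * T') * S'"
      using c by (simp add: assoc_mult_mat[of _ k k _ k _ k])
    then show "S * T * (T' * S') = 1\<^sub>m k" using c S T by simp
    have "T' * S' * (S * T) = T' * (S' * S) * T"
      using c by (simp add: assoc_mult_mat[of _ k k _ k _ k])
    then show "T' * S' * (S * T) = 1\<^sub>m k" using c S T by simp
  qed (auto intro: eis_mats_mult S T)
qed

lemma eis_invertible_transpose:
  assumes "eis_invertible k S"
  shows "eis_invertible k S\<^sup>T"
proof -
  obtain S' where S: "S \<in> eis_mats k k" "S' \<in> eis_mats k k" "S * S' = 1\<^sub>m k" "S' * S = 1\<^sub>m k"
    by (rule eis_invertibleE[OF assms(1)])
  note c = S(1,2)[THEN eis_mats_carrier]
  show ?thesis
    by (rule eis_invertibleI[of _ _ "S'\<^sup>T"])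
      (simp_all add: S transpose_mult[symmetric, OF c(1,2)] transpose_mult[symmetric, OF c(2,1)])
qed

lemma map_mat_cnj_mult:
  "A \<in> carrier_mat m n \<Longrightarrow> B \<in> carrier_mat n k \<Longrightarrow> map_mat cnj (A * B) = map_mat cnj A * map_mat cnj B"
  by (auto intro!: eq_matI simp: scalar_prod_def)

lemma map_mat_cnj_one [simp]: "map_mat cnj (1\<^sub>m k) = 1\<^sub>m k"
  by (auto intro!: eq_matI)

lemma map_mat_cnj_cnj [simp]: "map_mat cnj (map_mat cnj A) = A"
  by (auto intro!: eq_matI)

lemma eis_invertible_cnj:
  assumes "eis_invertible k S"
  shows "eis_invertible k (map_mat cnj S)"
proof -
  obtain S' where S: "S \<in> eis_mats k k" "S' \<in> eis_mats k k" "S * S' = 1\<^sub>m k" "S' * S = 1\<^sub>m k"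
    by (rule eis_invertibleE[OF assms(1)])
  note c = S(1,2)[THEN eis_mats_carrier]
  show ?thesis
    by (rule eis_invertibleI[of _ _ "map_mat cnj S'"])
      (simp_all add: S map_mat_cnj_mult[symmetric, OF c(1,2)] map_mat_cnj_mult[symmetric, OF c(2,1)])
qed

text \<open>The squared norms of the determinants of S and of its inverse are natural numbers with
  product 1.\<close>

lemma eis_invertible_det:
  assumes "eis_invertible k S"
  shows "det S \<in> eis_ints" and "norm (det S) = 1"
proof -
  obtain S' where S: "S \<in> eis_mats k k" "S' \<in> eis_mats k k" "S * S' = 1\<^sub>m k" "S' * S = 1\<^sub>m k"
    by (rule eis_invertibleE[OF assms(1)])
  show "det S \<in> eis_ints" using eis_ints_det S by blast
  have "det S * det S' = 1"
    using det_mult[OF S(1,2)[THEN eis_mats_carrier]] S(3) by simp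
  then have n: "(norm (det S))\<^sup>2 * (norm (det S'))\<^sup>2 = 1"
    by (metis norm_mult norm_one power_mult_distrib power_one)
  obtain a where a: "(norm (det S))\<^sup>2 = of_nat a" by (rule norm_eis_nat[OF eis_ints_det[OF S(1)]])
  obtain b where b: "(norm (det S'))\<^sup>2 = of_nat b" by (rule norm_eis_nat[OF eis_ints_det[OF S(2)]])
  have "a * b = 1" using n unfolding a b by (metis of_nat_mult of_nat_eq_1_iff)
  then have "a = 1" by simp
  then show "norm (det S) = 1" using a by (simp add: power2_eq_1_iff) (metis norm_ge_zero neg_0_le_iff_le not_one_le_zero)
qed

section \<open>Smith normal form over the Eisenstein integers\<close>

text \<open>The relation behind \<open>eis_smith_diagonal\<close>, freed from the divisibility chain
  and stated for square matrices, the shape of M M^H and its transpose.\<close>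

definition eis_equivalent :: "nat \<Rightarrow> complex mat \<Rightarrow> complex mat \<Rightarrow> bool" where
  "eis_equivalent k A B \<longleftrightarrow> (\<exists>S T. eis_invertible k S \<and> eis_invertible k T \<and> S * A * T = B)"

lemma eis_equivalent_mats:
  assumes "eis_equivalent k A B" and "A \<in> eis_mats k k"
  shows "B \<in> eis_mats k k"
  using assms unfolding eis_equivalent_def by (auto dest!: eis_invertible_mats)

lemma eis_equivalent_refl:
  assumes "A \<in> eis_mats k k"
  shows "eis_equivalent k A A"
  using eis_mats_carrier[OF assms] unfolding eis_equivalent_def
  by (intro exI[of _ "1\<^sub>m k"]) (simp add: eis_invertible_one)

lemma eis_equivalent_trans:
  assumes "eis_equivalent k A B" and "eis_equivalent k B C" and A: "A \<in> eis_mats k k"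
  shows "eis_equivalent k A C"
proof -
  obtain S T where ST: "eis_invertible k S" "eis_invertible k T" "S * A * T = B"
    using assms(1) unfolding eis_equivalent_def by auto
  obtain S' T' where ST': "eis_invertible k S'" "eis_invertible k T'" "S' * B * T' = C"
    using assms(2) unfolding eis_equivalent_def by auto
  note c = ST(1,2)[THEN eis_invertible_mats, THEN eis_mats_carrier]
    ST'(1,2)[THEN eis_invertible_mats, THEN eis_mats_carrier] eis_mats_carrier[OF A]
  have "S' * S * A * (T * T') = S' * (S * A * T) * T'"
    using c by (simp add: assoc_mult_mat[of _ k k _ k _ k])
  then show ?thesis
    using ST ST' eis_invertible_mult unfolding eis_equivalent_def by metis
qed

lemma eis_equivalent_sym:
  assumes "eis_equivalent k A B" and A: "A \<in> eis_mats k k"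
  shows "eis_equivalent k B A"
proof -
  obtain S T where ST: "eis_invertible k S" "eis_invertible k T" "S * A * T = B"
    using assms(1) unfolding eis_equivalent_def by auto
  obtain S' where S: "S \<in> eis_mats k k" "S' \<in> eis_mats k k" "S * S' = 1\<^sub>m k" "S' * S = 1\<^sub>m k"
    by (rule eis_invertibleE[OF ST(1)])
  obtain T' where T: "T \<in> eis_mats k k" "T' \<in> eis_mats k k" "T * T' = 1\<^sub>m k" "T' * T = 1\<^sub>m k"
    by (rule eis_invertibleE[OF ST(2)])
  note c = S(1,2)[THEN eis_mats_carrier] T(1,2)[THEN eis_mats_carrier] eis_mats_carrier[OF A]
  have "S' * B * T' = (S' * S) * A * (T * T')"
    using c unfolding ST(3)[symmetric] by (simp add: assoc_mult_mat[of _ k k _ k _ k])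
  then have "S' * B * T' = A" using c S T by simp
  then show ?thesis
    using eis_invertibleI[OF S(2,1,4,3)] eis_invertibleI[OF T(2,1,4,3)]
    unfolding eis_equivalent_def by blast
qed

lemma eis_equivalent_transpose:
  assumes "eis_equivalent k A B" and A: "A \<in> eis_mats k k"
  shows "eis_equivalent k A\<^sup>T B\<^sup>T"
proof -
  obtain S T where ST: "eis_invertible k S" "eis_invertible k T" "S * A * T = B"
    using assms(1) unfolding eis_equivalent_def by auto
  note c = ST(1,2)[THEN eis_invertible_mats, THEN eis_mats_carrier] eis_mats_carrier[OF A]
  have "T\<^sup>T * A\<^sup>T * S\<^sup>T = B\<^sup>T"
    using c unfolding ST(3)[symmetric]
    by (simp add: transpose_mult[of _ k k _ k] assoc_mult_mat[of _ k k _ k _ k])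
  then show ?thesis
    using ST eis_invertible_transpose unfolding eis_equivalent_def by blast
qed

lemma eis_equivalent_left:
  assumes "eis_invertible k S" and "A \<in> eis_mats k k"
  shows "eis_equivalent k A (S * A)"
proof -
  note c = eis_mats_carrier[OF eis_invertible_mats[OF assms(1)]] eis_mats_carrier[OF assms(2)]
  have "S * A * 1\<^sub>m k = S * A" using c by simp
  then show ?thesis using assms eis_invertible_one unfolding eis_equivalent_def by blast
qed

lemma eis_equivalent_right:
  assumes "eis_invertible k T" and "A \<in> eis_mats k k"
  shows "eis_equivalent k A (A * T)"
proof -
  note c = eis_mats_carrier[OF eis_invertible_mats[OF assms(1)]] eis_mats_carrier[OF assms(2)]
  have "1\<^sub>m k * A * T = A * T" using c by simp
  then show ?thesis using assms eis_invertible_one unfolding eis_equivalent_def by blast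
qed

lemma eis_invertible_swaprows_mat:
  "i < k \<Longrightarrow> j < k \<Longrightarrow> eis_invertible k (swaprows_mat k i j)"
  by (rule eis_invertibleI[of _ _ "swaprows_mat k i j"]) (simp_all add: swaprows_mat_inv)

lemma eis_invertible_addrow_mat:
  "i < k \<Longrightarrow> j < k \<Longrightarrow> i \<noteq> j \<Longrightarrow> a \<in> eis_ints \<Longrightarrow> eis_invertible k (addrow_mat k a i j)"
  using addrow_mat_inv[of i k j a] addrow_mat_inv[of i k j "- a"]
  by (intro eis_invertibleI[of _ _ "addrow_mat k (- a) i j"]) simp_all

lemma eis_equivalent_swaprows:
  assumes "A \<in> eis_mats k k" and "i < k" and "j < k"
  shows "eis_equivalent k A (swaprows i j A)"
  using eis_equivalent_left[OF eis_invertible_swaprows_mat assms(1)] assms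
    swaprows_mat[OF eis_mats_carrier] by metis

lemma eis_equivalent_addrow:
  assumes "A \<in> eis_mats k k" and "i < k" and "j < k" and "i \<noteq> j" and "a \<in> eis_ints"
  shows "eis_equivalent k A (addrow a i j A)"
  using eis_equivalent_left[OF eis_invertible_addrow_mat assms(1)] assms
    addrow_mat[OF eis_mats_carrier] by metis

text \<open>A nonzero pivot of minimal norm divides the rest of its column: otherwise division with
  remainder and a row swap would produce a smaller pivot.\<close>

lemma minimal_pivot_divides_column:
  assumes A: "A \<in> eis_mats k k" and k: "0 < k" and nz: "A $$ (0, 0) \<noteq> 0"
    and min: "\<And>B. eis_equivalent k A B \<Longrightarrow> B $$ (0, 0) \<noteq> 0 \<Longrightarrow>
      norm (A $$ (0, 0)) \<le> norm (B $$ (0, 0))"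
    and i: "i < k"
  obtains q where "q \<in> eis_ints" and "A $$ (i, 0) = q * A $$ (0, 0)"
proof (cases "i = 0")
  case True
  then show ?thesis using that[of 1] by simp
next
  case False
  obtain q where q: "q \<in> eis_ints" "norm (A $$ (i, 0) - q * A $$ (0, 0)) < norm (A $$ (0, 0))"
    using eis_ints_division[OF eis_matsD[OF A i k] eis_matsD[OF A k k] nz] by blast
  define B where "B = addrow (- q) i 0 A"
  define C where "C = swaprows 0 i B"
  have AB: "eis_equivalent k A B"
    unfolding B_def using A i k False q by (intro eis_equivalent_addrow) auto
  have B: "B \<in> eis_mats k k" by (rule eis_equivalent_mats[OF AB A])
  have "eis_equivalent k A C"
    unfolding C_def by (rule eis_equivalent_trans[OF AB eis_equivalent_swaprows[OF B k i] A])
  moreover have "C $$ (0, 0) = A $$ (i, 0) - q * A $$ (0, 0)"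
    using False k i eis_mats_carrier[OF A] eis_mats_carrier[OF B] unfolding C_def B_def by auto
  ultimately have "A $$ (i, 0) - q * A $$ (0, 0) = 0"
    using min[of C] q(2) by force
  then show ?thesis using that q by auto
qed

text \<open>All row operations that subtract \<open>q i\<close> times row 0 from row i are done at
  once by one unipotent matrix that differs from the identity only in column 0.\<close>

lemma eis_equivalent_clear_column:
  assumes A: "A \<in> eis_mats k k" and k: "0 < k"
    and q: "\<And>i. 0 < i \<Longrightarrow> i < k \<Longrightarrow> q i \<in> eis_ints"
      "\<And>i. 0 < i \<Longrightarrow> i < k \<Longrightarrow> A $$ (i, 0) = q i * A $$ (0, 0)"
  defines "B \<equiv> mat k k (\<lambda>(i, j). if i = 0 then A $$ (0, j) else A $$ (i, j) - q i * A $$ (0, j))"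
  shows "eis_equivalent k A B"
proof -
  \<comment> \<open>The parameter c makes the inverse explicit: \<open>U c\<close> and
    \<open>U (- c)\<close> are mutually inverse, and \<open>U (- 1)\<close> performs the
    clearing.\<close>
  define U where "U c = mat k k (\<lambda>(i, j). if i = j then 1 else if j = 0 then c * q i else 0)" for c
  have U: "U c \<in> carrier_mat k k" for c unfolding U_def by simp
  have ent: "(U c * X) $$ (i, j) = (if i = 0 then X $$ (0, j) else X $$ (i, j) + c * q i * X $$ (0, j))"
    if "i < k" "j < k" "X \<in> carrier_mat k k" for X :: "complex mat" and c i j
  proof -
    have "(U c * X) $$ (i, j) = (\<Sum>l\<in>{0..<k}. (if i = l then 1 else if l = 0 then c * q i else 0) * X $$ (l, j))"
      using that U[of c] unfolding U_def by (simp add: scalar_prod_def)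
    also have "\<dots> = (\<Sum>l\<in>{0, i}. (if i = l then 1 else if l = 0 then c * q i else 0) * X $$ (l, j))"
      using k that by (intro sum.mono_neutral_right) auto
    also have "\<dots> = (if i = 0 then X $$ (0, j) else X $$ (i, j) + c * q i * X $$ (0, j))"
      by auto
    finally show ?thesis .
  qed
  have inv: "U c * U (- c) = 1\<^sub>m k" for c
  proof (rule eq_matI)
    fix i j assume "i < dim_row (1\<^sub>m k :: complex mat)" "j < dim_col (1\<^sub>m k :: complex mat)"
    then have ij: "i < k" "j < k" by auto
    show "(U c * U (- c)) $$ (i, j) = 1\<^sub>m k $$ (i, j)"
      unfolding ent[OF ij U] using ij k unfolding U_def by auto
  qed (use U in auto)
  have "eis_invertible k (U (- 1))"
    by (rule eis_invertibleI[of _ _ "U 1"])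
      (use inv[of 1] inv[of "- 1"] q in \<open>auto intro!: eis_matsI simp: U_def\<close>)
  moreover have "U (- 1) * A = B"
  proof (rule eq_matI)
    fix i j assume "i < dim_row B" "j < dim_col B"
    then have ij: "i < k" "j < k" unfolding B_def by auto
    show "(U (- 1) * A) $$ (i, j) = B $$ (i, j)"
      unfolding ent[OF ij eis_mats_carrier[OF A]] using ij unfolding B_def by auto
  qed (use U eis_mats_carrier[OF A] in \<open>auto simp: B_def\<close>)
  ultimately show ?thesis using eis_equivalent_left[OF _ A] by metis
qed

text \<open>Bordering by 1 is multiplicative, so transforming matrices for the smaller block extend
  to the larger size without touching the corner a. This is the induction step of the
  diagonalization.\<close>

lemma eis_equivalent_extend:
  assumes "eis_equivalent k A B" and A: "A \<in> eis_mats k k"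
  shows "eis_equivalent (Suc k) (four_block_mat (mat 1 1 (\<lambda>_. a)) (0\<^sub>m 1 k) (0\<^sub>m k 1) A)
    (four_block_mat (mat 1 1 (\<lambda>_. a)) (0\<^sub>m 1 k) (0\<^sub>m k 1) B)"
proof -
  define E where "E X = four_block_mat (1\<^sub>m 1) (0\<^sub>m 1 k) (0\<^sub>m k 1) X" for X :: "complex mat"
  have mult: "E X * E Y = E (X * Y)" if "X \<in> carrier_mat k k" "Y \<in> carrier_mat k k" for X Y
    unfolding E_def using that by (subst mult_four_block_mat[of _ 1 1 _ k _ k _ _ 1 _ k]) auto
  have one: "E (1\<^sub>m k) = 1\<^sub>m (Suc k)"
    unfolding E_def by (rule eq_matI) auto
  have mats: "E X \<in> eis_mats (Suc k) (Suc k)" if "X \<in> eis_mats k k" for X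
    using eis_mats_carrier[OF that] eis_matsD[OF that] unfolding E_def
    by (intro eis_matsI) auto
  have inv: "eis_invertible (Suc k) (E S)" if S: "eis_invertible k S" for S
  proof -
    obtain S' where S: "S \<in> eis_mats k k" "S' \<in> eis_mats k k" "S * S' = 1\<^sub>m k" "S' * S = 1\<^sub>m k"
      by (rule eis_invertibleE[OF S])
    note c = S(1,2)[THEN eis_mats_carrier]
    show ?thesis
      by (rule eis_invertibleI[of _ _ "E S'"]) (simp_all add: S mats mult[OF c] mult[OF c(2,1)] one)
  qed
  obtain S T where ST: "eis_invertible k S" "eis_invertible k T" "S * A * T = B"
    using assms(1) unfolding eis_equivalent_def by auto
  note c = ST(1,2)[THEN eis_invertible_mats, THEN eis_mats_carrier] eis_mats_carrier[OF A]
  have "E S * four_block_mat (mat 1 1 (\<lambda>_. a)) (0\<^sub>m 1 k) (0\<^sub>m k 1) A * E T =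
      four_block_mat (mat 1 1 (\<lambda>_. a)) (0\<^sub>m 1 k) (0\<^sub>m k 1) B"
    unfolding E_def ST(3)[symmetric] using c
    by (subst mult_four_block_mat[of _ 1 1 _ k _ k _ _ 1 _ k], auto)+
  then show ?thesis using inv[OF ST(1)] inv[OF ST(2)] unfolding eis_equivalent_def by blast
qed

text \<open>Among all matrices equivalent to A, one with a nonzero corner of least norm is chosen;
  its corner divides row 0 and column 0, both can be cleared, and the induction treats the remaining
  block. The claim is diagonality alone, which already makes the normal form equal to its own
  transpose.\<close>

lemma eis_diagonalization:
  assumes "A \<in> eis_mats k k"
  shows "\<exists>B. eis_equivalent k A B \<and> diagonal_mat B"
  using assms
proof (induction k arbitrary: A)
  case 0
  then show ?case
    using eis_equivalent_refl[OF 0] eis_mats_carrier[OF 0] by (auto simp: diagonal_mat_def)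
next
  case (Suc k)
  note A = Suc.prems
  show ?case
  proof (cases "A = 0\<^sub>m (Suc k) (Suc k)")
    case True
    then show ?thesis using eis_equivalent_refl[OF A] by (auto simp: diagonal_mat_def)
  next
    case False
    obtain i j where ij: "i < Suc k" "j < Suc k" "A $$ (i, j) \<noteq> 0"
      using False eis_mats_carrier[OF A] by (metis carrier_matD eq_matI index_zero_mat)
    \<comment> \<open>A row swap and a column swap carry a nonzero entry to the corner, so the set
      of candidate norms is nonempty.\<close>
    define A1 where "A1 = swaprows 0 i A"
    have AA1: "eis_equivalent (Suc k) A A1"
      unfolding A1_def using A ij by (intro eis_equivalent_swaprows) auto
    have A1: "A1 \<in> eis_mats (Suc k) (Suc k)" by (rule eis_equivalent_mats[OF AA1 A])
    define A2 where "A2 = A1 * swaprows_mat (Suc k) 0 j"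
    have A1A2: "eis_equivalent (Suc k) A1 A2"
      unfolding A2_def using A1 ij
      by (intro eis_equivalent_right eis_invertible_swaprows_mat) auto
    have AA2: "eis_equivalent (Suc k) A A2" by (rule eis_equivalent_trans[OF AA1 A1A2 A])
    have "A2 = swapcols 0 j A1"
      unfolding A2_def using swapcols_mat[OF eis_mats_carrier[OF A1]] ij by simp
    then have A2nz: "A2 $$ (0, 0) \<noteq> 0"
      using eis_mats_carrier[OF A] eis_mats_carrier[OF A1] ij unfolding A1_def by auto
    define P where "P m \<longleftrightarrow> (\<exists>B. eis_equivalent (Suc k) A B \<and> B $$ (0, 0) \<noteq> 0 \<and>
        (norm (B $$ (0, 0)))\<^sup>2 = of_nat m)" for m :: nat
    have A2: "A2 \<in> eis_mats (Suc k) (Suc k)" by (rule eis_equivalent_mats[OF AA2 A])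
    obtain m where "(norm (A2 $$ (0, 0)))\<^sup>2 = of_nat m"
      using norm_eis_nat[OF eis_matsD[OF A2, of 0 0]] by blast
    then have "P m" unfolding P_def using AA2 A2nz by blast
    then obtain m where Pm: "P m" and least: "\<And>l. P l \<Longrightarrow> m \<le> l"
      by (metis LeastI Least_le)
    obtain A3 where A3: "eis_equivalent (Suc k) A A3" "A3 $$ (0, 0) \<noteq> 0"
        "(norm (A3 $$ (0, 0)))\<^sup>2 = of_nat m"
      using Pm unfolding P_def by blast
    have A3m: "A3 \<in> eis_mats (Suc k) (Suc k)" by (rule eis_equivalent_mats[OF A3(1) A])
    have min: "norm (A3 $$ (0, 0)) \<le> norm (B $$ (0, 0))"
      if B: "eis_equivalent (Suc k) A B" "B $$ (0, 0) \<noteq> 0" for B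
    proof -
      obtain l where l: "(norm (B $$ (0, 0)))\<^sup>2 = of_nat l"
        using norm_eis_nat[OF eis_matsD[OF eis_equivalent_mats[OF B(1) A], of 0 0]] by blast
      then have "m \<le> l" using least B unfolding P_def by blast
      then have "(norm (A3 $$ (0, 0)))\<^sup>2 \<le> (norm (B $$ (0, 0)))\<^sup>2" using l A3(3) by simp
      then show ?thesis by (rule power2_le_imp_le) simp
    qed
    have col: "\<exists>q\<in>eis_ints. A3 $$ (i, 0) = q * A3 $$ (0, 0)" if "i < Suc k" for i
      using minimal_pivot_divides_column[OF A3m _ A3(2) min[OF eis_equivalent_trans[OF A3(1) _ A]] that]
      by blast
    have A3T: "A3\<^sup>T \<in> eis_mats (Suc k) (Suc k)" using A3m by simp
    have c3: "A3 \<in> carrier_mat (Suc k) (Suc k)" by (rule eis_mats_carrier[OF A3m])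
    have row: "\<exists>q\<in>eis_ints. A3 $$ (0, i) = q * A3 $$ (0, 0)" if i: "i < Suc k" for i
    proof -
      \<comment> \<open>Transposition respects equivalence and fixes the corner, so minimality
        passes to \<open>A3\<^sup>T\<close> and the column statement yields the row
        statement.\<close>
      have minT: "norm (A3\<^sup>T $$ (0, 0)) \<le> norm (B $$ (0, 0))"
        if B: "eis_equivalent (Suc k) A3\<^sup>T B" "B $$ (0, 0) \<noteq> 0" for B
      proof -
        have Bm: "B \<in> eis_mats (Suc k) (Suc k)" by (rule eis_equivalent_mats[OF B(1) A3T])
        have "eis_equivalent (Suc k) A3 B\<^sup>T"
          using eis_equivalent_transpose[OF B(1) A3T] by simp
        then show ?thesis
          using min[OF eis_equivalent_trans[OF A3(1) _ A], of "B\<^sup>T"] B(2) eis_mats_carrier[OF Bm] c3 by simp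
      qed
      have nz: "A3\<^sup>T $$ (0, 0) \<noteq> 0" using A3(2) c3 by simp
      have "\<exists>q\<in>eis_ints. A3\<^sup>T $$ (i, 0) = q * A3\<^sup>T $$ (0, 0)"
        by (rule minimal_pivot_divides_column[OF A3T zero_less_Suc nz minT i]) blast+
      then show ?thesis using c3 i by simp
    qed
    obtain q where q: "\<And>i. 0 < i \<Longrightarrow> i < Suc k \<Longrightarrow> q i \<in> eis_ints \<and> A3 $$ (i, 0) = q i * A3 $$ (0, 0)"
      using col by metis
    define B where "B = mat (Suc k) (Suc k)
        (\<lambda>(i, j). if i = 0 then A3 $$ (0, j) else A3 $$ (i, j) - q i * A3 $$ (0, j))"
    have A3B: "eis_equivalent (Suc k) A3 B"
      unfolding B_def by (rule eis_equivalent_clear_column[OF A3m]) (use q in auto)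
    have Bm: "B \<in> eis_mats (Suc k) (Suc k)" by (rule eis_equivalent_mats[OF A3B A3m])
    have BT: "B\<^sup>T \<in> eis_mats (Suc k) (Suc k)" using Bm by simp
    obtain p where p: "\<And>i. 0 < i \<Longrightarrow> i < Suc k \<Longrightarrow> p i \<in> eis_ints \<and> A3 $$ (0, i) = p i * A3 $$ (0, 0)"
      using row by metis
    define C where "C = mat (Suc k) (Suc k)
        (\<lambda>(i, j). if i = 0 then B\<^sup>T $$ (0, j) else B\<^sup>T $$ (i, j) - p i * B\<^sup>T $$ (0, j))"
    have BC: "eis_equivalent (Suc k) B\<^sup>T C"
      unfolding C_def by (rule eis_equivalent_clear_column[OF BT]) (use p in \<open>auto simp: B_def\<close>)
    define D where "D = mat k k (\<lambda>(i, j). B $$ (Suc i, Suc j))"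
    \<comment> \<open>Column 0 of B is already cleared, so row 0 of \<open>B\<^sup>T\<close>
      vanishes beyond the corner. The second clearing therefore leaves the remaining block alone,
      and D is that block of B.\<close>
    have CT: "C\<^sup>T = four_block_mat (mat 1 1 (\<lambda>_. A3 $$ (0, 0))) (0\<^sub>m 1 k) (0\<^sub>m k 1) D"
      using p q
      by (intro eq_matI) (auto simp: C_def B_def D_def less_Suc_eq_0_disj)
    have "eis_equivalent (Suc k) B C\<^sup>T" using eis_equivalent_transpose[OF BC BT] by simp
    then have AC: "eis_equivalent (Suc k) A C\<^sup>T"
      using eis_equivalent_trans[OF eis_equivalent_trans[OF A3(1) A3B A] _ A] by blast
    have Dm: "D \<in> eis_mats k k"
      unfolding D_def using eis_matsD[OF Bm] by (intro eis_matsI) auto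
    obtain D' where D': "eis_equivalent k D D'" "diagonal_mat D'" using Suc.IH[OF Dm] by blast
    have D'c: "D' \<in> carrier_mat k k" by (rule eis_mats_carrier[OF eis_equivalent_mats[OF D'(1) Dm]])
    define F where "F = four_block_mat (mat 1 1 (\<lambda>_. A3 $$ (0, 0))) (0\<^sub>m 1 k) (0\<^sub>m k 1) D'"
    have "eis_equivalent (Suc k) C\<^sup>T F"
      unfolding CT F_def by (rule eis_equivalent_extend[OF D'(1) Dm])
    then have "eis_equivalent (Suc k) A F" by (rule eis_equivalent_trans[OF AC _ A])
    moreover have "diagonal_mat F"
      using D'(2) D'c unfolding F_def diagonal_mat_def by (auto simp: less_Suc_eq_0_disj) blast
    ultimately show ?thesis by blast
  qed
qed

text \<open>With B diagonal, A is equivalent to B = \<open>B\<^sup>T\<close>, which is equivalent to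
  \<open>A\<^sup>T\<close>.\<close>

lemma eis_equivalent_own_transpose:
  assumes A: "A \<in> eis_mats k k"
  shows "eis_equivalent k A A\<^sup>T"
proof -
  obtain B where B: "eis_equivalent k A B" "diagonal_mat B" using eis_diagonalization[OF A] by blast
  have Bm: "B \<in> eis_mats k k" by (rule eis_equivalent_mats[OF B(1) A])
  have "B\<^sup>T = B"
    using B(2) eis_mats_carrier[OF Bm] unfolding diagonal_mat_def
    by (intro eq_matI) (auto, metis)
  then have "eis_equivalent k A\<^sup>T B" using eis_equivalent_transpose[OF B(1) A] by simp
  then have "eis_equivalent k B A\<^sup>T" using eis_equivalent_sym A by (metis eis_mats_transpose)
  then show ?thesis by (rule eis_equivalent_trans[OF B(1) _ A])
qed

text \<open>By the pigeonhole principle every term of the Leibniz expansion of \<open>det P\<close> contains an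
  entry of P in a column of index at most k and a row of index at least k, and such an entry times
  \<open>\<alpha> k\<close> is divisible by \<open>\<beta> k\<close>.\<close>

lemma smith_diagonal_divides:
  assumes P: "P \<in> eis_mats r r" and Q: "Q \<in> eis_mats r r"
    and eq: "\<And>i j. i < r \<Longrightarrow> j < r \<Longrightarrow> P $$ (i, j) * \<alpha> j = \<beta> i * Q $$ (i, j)"
    and \<alpha>: "\<And>j k. j \<le> k \<Longrightarrow> k < r \<Longrightarrow> \<exists>c\<in>eis_ints. \<alpha> k = \<alpha> j * c"
    and \<beta>: "\<And>j k. j \<le> k \<Longrightarrow> k < r \<Longrightarrow> \<exists>c\<in>eis_ints. \<beta> k = \<beta> j * c"
    and k: "k < r"
  shows "\<exists>c\<in>eis_ints. det P * \<alpha> k = \<beta> k * c"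
proof -
  have entry: "\<exists>c\<in>eis_ints. P $$ (i, j) * \<alpha> k = \<beta> k * c" if ij: "k \<le> i" "i < r" "j \<le> k" for i j
  proof -
    obtain c where c: "c \<in> eis_ints" "\<alpha> k = \<alpha> j * c" using \<alpha>[OF ij(3) k] by blast
    obtain d where d: "d \<in> eis_ints" "\<beta> i = \<beta> k * d" using \<beta>[OF ij(1,2)] by blast
    \<comment> \<open>Since j \<le> k, \<open>\<alpha> k\<close> is \<open>\<alpha> j\<close> times
      c; \<open>eq\<close> trades \<open>\<alpha> j\<close> for \<open>\<beta> i\<close>, and since
      k \<le> i a factor \<open>\<beta> k\<close> splits off.\<close>
    have "P $$ (i, j) * \<alpha> k = \<beta> k * (d * Q $$ (i, j) * c)"
      using eq[of i j] ij k c d by (simp add: algebra_simps)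
    then show ?thesis using c(1) d(1) eis_matsD[OF Q, of i j] ij k
      by (intro bexI[of _ "d * Q $$ (i, j) * c"]) simp_all
  qed
  have trm: "\<exists>c\<in>eis_ints. (\<Prod>i = 0..<r. P $$ (i, p i)) * \<alpha> k = \<beta> k * c" if p: "p permutes {0..<r}" for p
  proof -
    have "\<exists>i\<in>{0..<r}. k \<le> i \<and> p i \<le> k"
    proof (rule ccontr)
      assume "\<not> ?thesis"
      then have "p ` {k..<r} \<subseteq> {Suc k..<r}"
        using permutes_in_image[OF p] by force
      then have "card (p ` {k..<r}) \<le> r - Suc k" using card_mono[of "{Suc k..<r}"] by simp
      moreover have "card (p ` {k..<r}) = r - k"
        using permutes_inj[OF p] by (subst card_image) (auto intro: inj_on_subset)
      ultimately show False using k by simp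
    qed
    then obtain i where i: "i < r" "k \<le> i" "p i \<le> k" by auto
    obtain c where c: "c \<in> eis_ints" "P $$ (i, p i) * \<alpha> k = \<beta> k * c" using entry[OF i(2,1,3)] by blast
    have "(\<Prod>i = 0..<r. P $$ (i, p i)) = P $$ (i, p i) * (\<Prod>i\<in>{0..<r} - {i}. P $$ (i, p i))"
      using i by (intro prod.remove) auto
    then have "(\<Prod>i = 0..<r. P $$ (i, p i)) * \<alpha> k = \<beta> k * (c * (\<Prod>i\<in>{0..<r} - {i}. P $$ (i, p i)))"
      using c by (simp add: algebra_simps)
    moreover have "c * (\<Prod>i\<in>{0..<r} - {i}. P $$ (i, p i)) \<in> eis_ints"
      using c permutes_in_image[OF p] eis_matsD[OF P] by (intro eis_ints_mult eis_ints_prod) auto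
    ultimately show ?thesis by blast
  qed
  obtain c where c: "\<And>p. p permutes {0..<r} \<Longrightarrow>
      c p \<in> eis_ints \<and> (\<Prod>i = 0..<r. P $$ (i, p i)) * \<alpha> k = \<beta> k * c p"
    using trm by metis
  have "det P * \<alpha> k = (\<Sum>p\<in>{p. p permutes {0..<r}}. signof p * ((\<Prod>i = 0..<r. P $$ (i, p i)) * \<alpha> k))"
    unfolding det_def'[OF eis_mats_carrier[OF P]] sum_distrib_right by (simp add: mult.assoc)
  also have "\<dots> = (\<Sum>p\<in>{p. p permutes {0..<r}}. signof p * (\<beta> k * c p))"
    using c by (intro sum.cong) auto
  also have "\<dots> = \<beta> k * (\<Sum>p\<in>{p. p permutes {0..<r}}. signof p * c p)"
    unfolding sum_distrib_left by (simp add: algebra_simps)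
  finally show ?thesis using c by (intro bexI) (auto intro!: eis_ints_sum)
qed

section \<open>Cokernels\<close>

lemma eis_ring_simps [simp]:
  "carrier eis_ring = eis_ints" "mult eis_ring = (*)" "add eis_ring = (+)"
  "one eis_ring = 1" "zero eis_ring = 0"
  unfolding eis_ring_def by simp_all

lemma eis_module_simps [simp]:
  "carrier (eis_module n) = eis_vecs n" "add (eis_module n) = (+)"
  "zero (eis_module n) = 0\<^sub>v n" "Module.smult (eis_module n) = (\<cdot>\<^sub>v)"
  unfolding eis_module_def module_vec_def by simp_all

lemma eis_vecs_add [intro]: "v \<in> eis_vecs n \<Longrightarrow> w \<in> eis_vecs n \<Longrightarrow> v + w \<in> eis_vecs n"
  using eis_vecs_carrier[of v n] eis_vecs_carrier[of w n] by (auto intro!: eis_vecsI simp: eis_vecsD)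

lemma eis_vecs_minus [intro]: "v \<in> eis_vecs n \<Longrightarrow> w \<in> eis_vecs n \<Longrightarrow> v - w \<in> eis_vecs n"
  using eis_vecs_carrier[of v n] eis_vecs_carrier[of w n] by (auto intro!: eis_vecsI simp: eis_vecsD)

lemma eis_vecs_uminus [intro]: "v \<in> eis_vecs n \<Longrightarrow> - v \<in> eis_vecs n"
  using eis_vecs_carrier[of v n] by (auto intro!: eis_vecsI simp: eis_vecsD)

lemma eis_vecs_smult [intro]: "c \<in> eis_ints \<Longrightarrow> v \<in> eis_vecs n \<Longrightarrow> c \<cdot>\<^sub>v v \<in> eis_vecs n"
  using eis_vecs_carrier[of v n] by (auto intro!: eis_vecsI simp: eis_vecsD)

lemma eis_vecs_zero [simp]: "0\<^sub>v n \<in> eis_vecs n"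
  by (auto intro!: eis_vecsI)

lemma cring_eis_ring: "cring eis_ring"
proof (rule cringI)
  show "abelian_group eis_ring"
  proof (rule abelian_groupI)
    show "\<exists>y\<in>carrier eis_ring. y \<oplus>\<^bsub>eis_ring\<^esub> x = \<zero>\<^bsub>eis_ring\<^esub>" if "x \<in> carrier eis_ring" for x
      using that by (intro bexI[of _ "- x"]) auto
  qed auto
  show "comm_monoid eis_ring" by (rule comm_monoidI) auto
qed (auto simp: algebra_simps)

lemma module_eis_module: "Module.module eis_ring (eis_module n)"
proof (rule moduleI[OF cring_eis_ring])
  show "abelian_group (eis_module n)"
  proof (rule abelian_groupI)
    show "\<exists>y\<in>carrier (eis_module n). y \<oplus>\<^bsub>eis_module n\<^esub> x = \<zero>\<^bsub>eis_module n\<^esub>"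
      if "x \<in> carrier (eis_module n)" for x
      using that eis_vecs_carrier by (intro bexI[of _ "- x"]) auto
  qed (auto intro: eis_vecs_carrier eis_vecs_add assoc_add_vec comm_add_vec left_zero_vec)
qed (auto intro: eis_vecs_carrier eis_vecs_smult smult_add_distrib_vec
    simp: add_smult_distrib_vec smult_smult_assoc)

lemma eis_module_uminus:
  assumes "x \<in> eis_vecs n"
  shows "\<ominus>\<^bsub>eis_module n\<^esub> x = - x"
proof -
  interpret Module.module eis_ring "eis_module n" by (rule module_eis_module)
  show ?thesis
    by (rule minus_equality) (use assms eis_vecs_carrier in auto)
qed

lemma eis_module_minus:
  assumes "x \<in> eis_vecs n" and "y \<in> eis_vecs n"
  shows "x \<ominus>\<^bsub>eis_module n\<^esub> y = x - y"
  unfolding a_minus_def using assms eis_vecs_carrier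
  by (simp add: eis_module_uminus) (metis minus_add_uminus_vec)

lemma eis_submoduleI:
  assumes "N \<subseteq> eis_vecs n" and "0\<^sub>v n \<in> N"
    and "\<And>x y. x \<in> N \<Longrightarrow> y \<in> N \<Longrightarrow> x + y \<in> N"
    and "\<And>c x. c \<in> eis_ints \<Longrightarrow> x \<in> N \<Longrightarrow> c \<cdot>\<^sub>v x \<in> N"
  shows "quotient_by_submodule eis_ring (eis_module n) N"
proof -
  interpret Module.module eis_ring "eis_module n" by (rule module_eis_module)
  have "- x \<in> N" if "x \<in> N" for x
  proof -
    have "- x = - 1 \<cdot>\<^sub>v x" by (intro eq_vecI) auto
    then show ?thesis using assms(4)[of "- 1"] that by simp
  qed
  then have "Module.submodule N eis_ring (eis_module n)"
    using assms by (intro submoduleI) (auto simp: eis_module_uminus subsetD)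
  then show ?thesis by (intro quotient_by_submodule.intro module_axioms)
qed

definition eis_cokernel :: "nat \<Rightarrow> complex mat \<Rightarrow> (complex, complex vec set) module" where
  "eis_cokernel k A = quotient_module (eis_module k) ((*\<^sub>v) A ` eis_vecs k)"

lemma eis_image_submodule:
  assumes A: "A \<in> eis_mats m k"
  shows "quotient_by_submodule eis_ring (eis_module m) ((*\<^sub>v) A ` eis_vecs k)"
proof (rule eis_submoduleI)
  note c = eis_mats_carrier[OF A] eis_vecs_carrier
  show "(*\<^sub>v) A ` eis_vecs k \<subseteq> eis_vecs m" using A by auto
  show "0\<^sub>v m \<in> (*\<^sub>v) A ` eis_vecs k"
    using c by (intro image_eqI[of _ _ "0\<^sub>v k"]) auto
  show "x + y \<in> (*\<^sub>v) A ` eis_vecs k"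
    if "x \<in> (*\<^sub>v) A ` eis_vecs k" "y \<in> (*\<^sub>v) A ` eis_vecs k" for x y
    using that c by (auto simp: mult_add_distrib_mat_vec[symmetric])
  show "a \<cdot>\<^sub>v x \<in> (*\<^sub>v) A ` eis_vecs k"
    if "a \<in> eis_ints" "x \<in> (*\<^sub>v) A ` eis_vecs k" for a x
    using that c by (auto simp: mult_mat_vec[symmetric])
qed

text \<open>The integral right inverse H makes G surjective on lattices. G may be rectangular, as it
  is for the conjugate of M, or invertible, as for changes of basis.\<close>

lemma eis_quotient_iso:
  assumes "quotient_by_submodule eis_ring (eis_module n) N"
    and "quotient_by_submodule eis_ring (eis_module m) K"
    and G: "G \<in> eis_mats m n"
    and H: "H \<in> eis_mats n m" "G * H = 1\<^sub>m m"
    and ker: "\<And>x. x \<in> eis_vecs n \<Longrightarrow> G *\<^sub>v x \<in> K \<longleftrightarrow> x \<in> N"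
  shows "module_isomorphic eis_ring (quotient_module (eis_module n) N) (quotient_module (eis_module m) K)"
proof (rule quotient_iso_quotient[OF assms(1,2), where g = "(*\<^sub>v) G"])
  note c = eis_mats_carrier[OF G] eis_mats_carrier[OF H(1)] eis_vecs_carrier
  show "\<exists>x\<in>carrier (eis_module n). G *\<^sub>v x = w" if "w \<in> carrier (eis_module m)" for w
    using that H c by (intro bexI[of _ "H *\<^sub>v w"]) (auto simp: assoc_mult_mat_vec[symmetric])
qed (use G ker eis_mats_carrier[OF G] eis_vecs_carrier in
    \<open>auto simp: mult_add_distrib_mat_vec mult_mat_vec\<close>)

text \<open>Multiplication by S carries the image of A onto the image of S A T, because T maps the
  integral vectors onto themselves.\<close>

lemma eis_cokernel_equivalent:
  assumes "eis_equivalent k A B" and A: "A \<in> eis_mats k k"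
  shows "module_isomorphic eis_ring (eis_cokernel k A) (eis_cokernel k B)"
proof -
  obtain S T where ST: "eis_invertible k S" "eis_invertible k T" "S * A * T = B"
    using assms(1) unfolding eis_equivalent_def by auto
  have B: "B \<in> eis_mats k k" by (rule eis_equivalent_mats[OF assms])
  obtain S' where S: "S \<in> eis_mats k k" "S' \<in> eis_mats k k" "S * S' = 1\<^sub>m k" "S' * S = 1\<^sub>m k"
    by (rule eis_invertibleE[OF ST(1)])
  obtain T' where T: "T \<in> eis_mats k k" "T' \<in> eis_mats k k" "T * T' = 1\<^sub>m k" "T' * T = 1\<^sub>m k"
    by (rule eis_invertibleE[OF ST(2)])
  note c = S(1,2)[THEN eis_mats_carrier] T(1,2)[THEN eis_mats_carrier] A[THEN eis_mats_carrier]
  show ?thesis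
    unfolding eis_cokernel_def
  proof (rule eis_quotient_iso[OF eis_image_submodule[OF A] eis_image_submodule[OF B] S(1,2,3)])
    fix x assume x: "x \<in> eis_vecs k"
    note xc = eis_vecs_carrier[OF x]
    show "S *\<^sub>v x \<in> (*\<^sub>v) B ` eis_vecs k \<longleftrightarrow> x \<in> (*\<^sub>v) A ` eis_vecs k"
    proof
      assume "S *\<^sub>v x \<in> (*\<^sub>v) B ` eis_vecs k"
      then obtain y where y: "y \<in> eis_vecs k" "S *\<^sub>v x = S * A * T *\<^sub>v y" using ST by auto
      note yc = eis_vecs_carrier[OF y(1)]
      have "x = S' * S *\<^sub>v x" using S xc by simp
      also have "\<dots> = S' *\<^sub>v (S * A * T *\<^sub>v y)" using c xc y(2) by (simp add: assoc_mult_mat_vec[of _ k k _ k])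
      also have "\<dots> = S' * S *\<^sub>v (A *\<^sub>v (T *\<^sub>v y))"
        using c yc by (simp add: assoc_mult_mat_vec[of _ k k _ k])
      also have "\<dots> = A *\<^sub>v (T *\<^sub>v y)" using c yc S by simp
      finally show "x \<in> (*\<^sub>v) A ` eis_vecs k" using T y by auto
    next
      assume "x \<in> (*\<^sub>v) A ` eis_vecs k"
      then obtain y where y: "y \<in> eis_vecs k" "x = A *\<^sub>v y" by auto
      note yc = eis_vecs_carrier[OF y(1)]
      have "B *\<^sub>v (T' *\<^sub>v y) = S *\<^sub>v (A *\<^sub>v (T * T' *\<^sub>v y))"
        unfolding ST(3)[symmetric] using c yc by (simp add: assoc_mult_mat_vec[of _ k k _ k])
      also have "\<dots> = S *\<^sub>v x" using y yc T by simp
      finally show "S *\<^sub>v x \<in> (*\<^sub>v) B ` eis_vecs k" using T y by (metis eis_vecs_mult_mat_vec image_eqI)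
    qed
  qed
qed

lemma eis_cokernel_iso_transpose:
  assumes "A \<in> eis_mats k k"
  shows "module_isomorphic eis_ring (eis_cokernel k A) (eis_cokernel k A\<^sup>T)"
  by (rule eis_cokernel_equivalent[OF eis_equivalent_own_transpose]) (use assms in auto)

section \<open>Cyclic modules and cokernels of diagonal matrices\<close>

lemma regular_module_eis_ring_simps [simp]:
  "carrier (regular_module eis_ring) = eis_ints" "add (regular_module eis_ring) = (+)"
  "zero (regular_module eis_ring) = 0" "Module.smult (regular_module eis_ring) = (*)"
  unfolding regular_module_def by simp_all

lemma cyclic_submodule:
  assumes "a \<in> eis_ints"
  shows "quotient_by_submodule eis_ring (regular_module eis_ring) (PIdl\<^bsub>eis_ring\<^esub> a)"
proof -
  have ag: "abelian_group (regular_module eis_ring)"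
  proof (rule abelian_groupI)
    show "\<exists>y\<in>carrier (regular_module eis_ring). y \<oplus>\<^bsub>regular_module eis_ring\<^esub> x = \<zero>\<^bsub>regular_module eis_ring\<^esub>"
      if "x \<in> carrier (regular_module eis_ring)" for x
      using that by (intro bexI[of _ "- x"]) auto
  qed auto
  then interpret Module.module eis_ring "regular_module eis_ring"
    by (rule moduleI[OF cring_eis_ring]) (auto simp: algebra_simps)
  have uminus: "\<ominus>\<^bsub>regular_module eis_ring\<^esub> x = - x" if "x \<in> eis_ints" for x
    by (rule minus_equality) (use that in auto)
  have "Module.submodule (PIdl\<^bsub>eis_ring\<^esub> a) eis_ring (regular_module eis_ring)"
  proof (rule submoduleI)
    show "\<zero>\<^bsub>regular_module eis_ring\<^esub> \<in> PIdl\<^bsub>eis_ring\<^esub> a"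
      unfolding cgenideal_def by (auto intro!: exI[of _ 0])
    show "\<ominus>\<^bsub>regular_module eis_ring\<^esub> x \<in> PIdl\<^bsub>eis_ring\<^esub> a" if "x \<in> PIdl\<^bsub>eis_ring\<^esub> a" for x
    proof -
      obtain d where d: "d \<in> eis_ints" "x = d * a" using \<open>x \<in> _\<close> unfolding cgenideal_def by auto
      then have "\<ominus>\<^bsub>regular_module eis_ring\<^esub> x = - d * a" using assms by (simp add: uminus)
      then show ?thesis using d(1) unfolding cgenideal_def by (auto intro!: exI[of _ "- d"])
    qed
    show "x \<oplus>\<^bsub>regular_module eis_ring\<^esub> y \<in> PIdl\<^bsub>eis_ring\<^esub> a"
      if "x \<in> PIdl\<^bsub>eis_ring\<^esub> a" "y \<in> PIdl\<^bsub>eis_ring\<^esub> a" for x y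
    proof -
      obtain d e where "d \<in> eis_ints" "x = d * a" "e \<in> eis_ints" "y = e * a"
        using \<open>x \<in> _\<close> \<open>y \<in> _\<close> unfolding cgenideal_def by auto
      then show ?thesis unfolding cgenideal_def by (auto intro!: exI[of _ "d + e"] simp: distrib_right)
    qed
    show "c \<odot>\<^bsub>regular_module eis_ring\<^esub> x \<in> PIdl\<^bsub>eis_ring\<^esub> a"
      if "c \<in> carrier eis_ring" "x \<in> PIdl\<^bsub>eis_ring\<^esub> a" for c x
    proof -
      obtain d where "d \<in> eis_ints" "x = d * a" using \<open>x \<in> _\<close> unfolding cgenideal_def by auto
      then show ?thesis using \<open>c \<in> _\<close> unfolding cgenideal_def by (auto intro!: exI[of _ "c * d"])
    qed
  qed (use assms in \<open>auto simp: cgenideal_def\<close>)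
  then show ?thesis by (intro quotient_by_submodule.intro module_axioms)
qed

text \<open>The image of a diagonal matrix is the product of the ideals generated by its diagonal
  entries, so reducing each coordinate modulo its own ideal has exactly this kernel.\<close>

lemma eis_cokernel_diagonal:
  assumes len: "length \<alpha>s = r" and \<alpha>: "set \<alpha>s \<subseteq> eis_ints"
  shows "module_isomorphic eis_ring
    (eis_cokernel r (mat r r (\<lambda>(i, j). if i = j then \<alpha>s ! i else 0)))
    (finite_direct_sum {..<r} (\<lambda>i. cyclic_module eis_ring (\<alpha>s ! i)))"
proof -
  define D where "D = mat r r (\<lambda>(i, j). if i = j then \<alpha>s ! i else 0)"
  let ?Q = "\<lambda>i. cyclic_module eis_ring (\<alpha>s ! i)"
  let ?I = "\<lambda>i. PIdl\<^bsub>eis_ring\<^esub> (\<alpha>s ! i)"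
  let ?R = "regular_module eis_ring"
  have \<alpha>i: "\<alpha>s ! i \<in> eis_ints" if "i < r" for i using that len \<alpha> nth_mem by blast
  have D: "D \<in> eis_mats r r" unfolding D_def using \<alpha>i by (intro eis_matsI) auto
  have Dv: "(D *\<^sub>v v) $ i = \<alpha>s ! i * v $ i" if "v \<in> carrier_vec r" "i < r" for v i
  proof -
    have "(D *\<^sub>v v) $ i = (\<Sum>j\<in>{0..<r}. (if i = j then \<alpha>s ! i else 0) * v $ j)"
      using that unfolding D_def by (simp add: scalar_prod_def)
    also have "\<dots> = (\<Sum>j\<in>{i}. (if i = j then \<alpha>s ! i else 0) * v $ j)"
      using that by (intro sum.mono_neutral_right) auto
    finally show ?thesis by simp
  qed
  interpret D: quotient_by_submodule eis_ring "eis_module r" "(*\<^sub>v) D ` eis_vecs r"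
    by (rule eis_image_submodule[OF D])
  have Q: "quotient_by_submodule eis_ring ?R (?I i)" if "i < r" for i
    using cyclic_submodule[OF \<alpha>i[OF that]] .
  \<comment> \<open>The restriction to \<open>{..<r}\<close> is needed because elements of
    \<open>finite_direct_sum\<close> are extensional functions.\<close>
  define f where "f x = (\<lambda>i\<in>{..<r}. ?I i +>\<^bsub>?R\<^esub> (x $ i))" for x :: "complex vec"
  have mem: "x - y \<in> (*\<^sub>v) D ` eis_vecs r \<longleftrightarrow> (\<forall>i<r. x $ i - y $ i \<in> ?I i)"
    if xy: "x \<in> eis_vecs r" "y \<in> eis_vecs r" for x y
  proof
    note c = eis_vecs_carrier[OF xy(1)] eis_vecs_carrier[OF xy(2)]
    assume "x - y \<in> (*\<^sub>v) D ` eis_vecs r"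
    then obtain v where v: "v \<in> eis_vecs r" "x - y = D *\<^sub>v v" by auto
    have "x $ i - y $ i = v $ i * \<alpha>s ! i" if i: "i < r" for i
      using arg_cong[OF v(2), of "\<lambda>v. v $ i"] c i Dv[OF eis_vecs_carrier[OF v(1)] i] by simp
    then show "\<forall>i<r. x $ i - y $ i \<in> ?I i"
      unfolding cgenideal_def using eis_vecsD[OF v(1)] by auto
  next
    note c = eis_vecs_carrier[OF xy(1)] eis_vecs_carrier[OF xy(2)]
    assume "\<forall>i<r. x $ i - y $ i \<in> ?I i"
    then have "\<forall>i<r. \<exists>c\<in>eis_ints. x $ i - y $ i = c * \<alpha>s ! i" unfolding cgenideal_def by auto
    then obtain d where d: "\<And>i. i < r \<Longrightarrow> d i \<in> eis_ints \<and> x $ i - y $ i = d i * \<alpha>s ! i" by metis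
    have "x - y = D *\<^sub>v vec r d"
      using c D[THEN eis_mats_carrier] d by (intro eq_vecI) (auto simp: Dv simp del: index_mult_mat_vec)
    moreover have "vec r d \<in> eis_vecs r" using d by (intro eis_vecsI) auto
    ultimately show "x - y \<in> (*\<^sub>v) D ` eis_vecs r" by blast
  qed
  have sub: "a \<ominus>\<^bsub>?R\<^esub> b = a - b" if "a \<in> eis_ints" "b \<in> eis_ints" "i < r" for a b i
  proof -
    interpret Q: quotient_by_submodule eis_ring ?R "?I i" by (rule Q[OF that(3)])
    have "\<ominus>\<^bsub>?R\<^esub> b = - b" by (rule Q.minus_equality) (use that in auto)
    then show ?thesis unfolding a_minus_def by simp
  qed
  have "module_isomorphic eis_ring (quotient_module (eis_module r) ((*\<^sub>v) D ` eis_vecs r))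
    (finite_direct_sum {..<r} ?Q)"
  proof (rule D.first_isomorphism[where f = f])
    show "f x \<in> carrier (finite_direct_sum {..<r} ?Q)" if "x \<in> carrier (eis_module r)" for x
      using that quotient_by_submodule.quotient_carrierI[OF Q] eis_vecsD
      unfolding f_def finite_direct_sum_def cyclic_module_def by auto
    show "f (x \<oplus>\<^bsub>eis_module r\<^esub> y) = f x \<oplus>\<^bsub>finite_direct_sum {..<r} ?Q\<^esub> f y"
      if "x \<in> carrier (eis_module r)" "y \<in> carrier (eis_module r)" for x y
    proof -
      have "x \<in> eis_vecs r" "x \<in> carrier_vec r" "y \<in> eis_vecs r" "y \<in> carrier_vec r"
        using that eis_vecs_carrier by auto
      then show ?thesis
        using quotient_by_submodule.quotient_add[OF Q]
        unfolding f_def finite_direct_sum_def cyclic_module_def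
        by (intro ext) (simp add: restrict_def eis_vecsD)
    qed
    show "f (c \<odot>\<^bsub>eis_module r\<^esub> x) = c \<odot>\<^bsub>finite_direct_sum {..<r} ?Q\<^esub> f x"
      if "c \<in> carrier eis_ring" "x \<in> carrier (eis_module r)" for c x
    proof -
      have "c \<in> eis_ints" "x \<in> eis_vecs r" "x \<in> carrier_vec r" using that eis_vecs_carrier by auto
      then show ?thesis
        using quotient_by_submodule.quotient_smult[OF Q]
        unfolding f_def finite_direct_sum_def cyclic_module_def
        by (intro ext) (simp add: restrict_def eis_vecsD)
    qed
    show "\<exists>x\<in>carrier (eis_module r). f x = p" if p: "p \<in> carrier (finite_direct_sum {..<r} ?Q)" for p
    proof -
      have "\<exists>a\<in>eis_ints. p i = ?I i +>\<^bsub>?R\<^esub> a" if i: "i < r" for i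
      proof -
        have "p i \<in> carrier (quotient_module ?R (?I i))"
          using p i unfolding finite_direct_sum_def cyclic_module_def by auto
        then show ?thesis by (rule quotient_by_submodule.quotient_carrierE[OF Q[OF i]]) auto
      qed
      then obtain a where a: "\<And>i. i < r \<Longrightarrow> a i \<in> eis_ints \<and> p i = ?I i +>\<^bsub>?R\<^esub> a i" by metis
      have "p \<in> extensional {..<r}" using p unfolding finite_direct_sum_def by (auto simp: PiE_def)
      then have "f (vec r a) = p"
        using a unfolding f_def by (auto simp: fun_eq_iff restrict_def extensional_def)
      moreover have "vec r a \<in> eis_vecs r" using a by (intro eis_vecsI) auto
      ultimately show ?thesis by auto
    qed
    show "f x = f y \<longleftrightarrow> x \<ominus>\<^bsub>eis_module r\<^esub> y \<in> (*\<^sub>v) D ` eis_vecs r"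
      if xy: "x \<in> carrier (eis_module r)" "y \<in> carrier (eis_module r)" for x y
    proof -
      have "f x = f y \<longleftrightarrow> (\<forall>i<r. ?I i +>\<^bsub>?R\<^esub> (x $ i) = ?I i +>\<^bsub>?R\<^esub> (y $ i))"
        unfolding f_def by (auto simp: fun_eq_iff restrict_def)
      also have "\<dots> \<longleftrightarrow> (\<forall>i<r. x $ i - y $ i \<in> ?I i)"
        using quotient_by_submodule.coset_eq_iff[OF Q] eis_vecsD xy sub by simp
      finally show ?thesis using mem xy by (simp add: eis_module_minus)
    qed
  qed
  then show ?thesis unfolding eis_cokernel_def D_def .
qed

section \<open>Selecting rows and columns\<close>

text \<open>Padding N with zero rows gives a square matrix P whose row k vanishes, so det P = 0 and
  P has a nonzero kernel vector; that vector also kills N.\<close>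

lemma wide_matrix_kernel:
  fixes N :: "'a :: field mat"
  assumes N: "N \<in> carrier_mat k l" and kl: "k < l"
  obtains v where "v \<in> carrier_vec l" and "v \<noteq> 0\<^sub>v l" and "N *\<^sub>v v = 0\<^sub>v k"
proof -
  define P where "P = mat l l (\<lambda>(i, j). if i < k then N $$ (i, j) else 0)"
  have P: "P \<in> carrier_mat l l" unfolding P_def by simp
  have "det P\<^sup>T = 0"
  proof -
    have "P\<^sup>T *\<^sub>v unit_vec l k = 0\<^sub>v l"
      using kl P by (intro eq_vecI) (auto simp: P_def)
    moreover have "unit_vec l k \<noteq> (0\<^sub>v l :: 'a vec)"
      using kl by (metis index_unit_vec(1) index_zero_vec(1) zero_neq_one)
    ultimately show ?thesis
      using det_0_iff_vec_prod_zero_field[of "P\<^sup>T" l] P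
      by (metis transpose_carrier_mat unit_vec_carrier)
  qed
  then have "det P = 0" using det_transpose[OF P] by simp
  then obtain v where v: "v \<in> carrier_vec l" "v \<noteq> 0\<^sub>v l" "P *\<^sub>v v = 0\<^sub>v l"
    using det_0_iff_vec_prod_zero_field[OF P] by blast
  have "N *\<^sub>v v = 0\<^sub>v k"
  proof (rule eq_vecI)
    fix i assume "i < dim_vec (0\<^sub>v k :: 'a vec)"
    then have i: "i < k" by simp
    have "row N i = row P i" using i kl N unfolding P_def by (intro eq_vecI) auto
    then show "(N *\<^sub>v v) $ i = 0\<^sub>v k $ i"
      using arg_cong[OF v(3), of "\<lambda>v. v $ i"] i kl N P by simp
  qed (use N in auto)
  then show thesis using that v by blast
qed

section \<open>Submatrices through the increasing enumeration \<open>pick\<close> of index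
  sets\<close>

lemma pick_index:
  assumes "J \<subseteq> {..<n}" and "j \<in> J"
  obtains k where "k < card J" and "pick J k = j"
proof
  have fin: "finite J" using assms(1) finite_subset by blast
  show "pick J (card {a\<in>J. a < j}) = j" by (rule pick_card_in_set[OF assms(2)])
  show "card {a\<in>J. a < j} < card J" using fin assms(2) by (intro psubset_card_mono) auto
qed

lemma pick_inj: "k < card J \<Longrightarrow> l < card J \<Longrightarrow> pick J k = pick J l \<longleftrightarrow> k = l"
  using pick_mono_le by (metis less_irrefl nat_neq_iff)

lemma pick_inj_on: "A \<subseteq> {..<card I} \<Longrightarrow> inj_on (pick I) A"
  using pick_inj[of _ I] by (intro inj_onI) (metis lessThan_iff subsetD)

lemma pick_less: "J \<subseteq> {..<n} \<Longrightarrow> k < card J \<Longrightarrow> pick J k < n"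
  using pick_in_set_le by fastforce

lemma pick_lessThan: "i < m \<Longrightarrow> pick {..<m} i = i"
  using pick_reduce_set[of i m UNIV] by (simp add: pick_UNIV lessThan_def)

lemma index_submatrix:
  assumes "A \<in> carrier_mat m n" and "I \<subseteq> {..<m}" and "J \<subseteq> {..<n}"
  shows "submatrix A I J \<in> carrier_mat (card I) (card J)"
    and "i < card I \<Longrightarrow> j < card J \<Longrightarrow> submatrix A I J $$ (i, j) = A $$ (pick I i, pick J j)"
proof -
  have "{i. i < m \<and> i \<in> I} = I" "{j. j < n \<and> j \<in> J} = J" using assms by auto
  then show "submatrix A I J \<in> carrier_mat (card I) (card J)"
    "i < card I \<Longrightarrow> j < card J \<Longrightarrow> submatrix A I J $$ (i, j) = A $$ (pick I i, pick J j)"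
    using assms(1) unfolding submatrix_def by auto
qed

text \<open>\<open>pick I\<close> is increasing, so it preserves the number of smaller elements,
  which is what determines the position in the enumeration.\<close>

lemma pick_image:
  assumes "I \<subseteq> {..<m}" and A: "A \<subseteq> {..<card I}" and k: "k < card A"
  shows "pick (pick I ` A) k = pick I (pick A k)"
proof -
  have pA: "pick A k \<in> A" "pick A k < card I" using pick_in_set_le[OF k] A by auto
  have "{a \<in> pick I ` A. a < pick I (pick A k)} = pick I ` {a \<in> A. a < pick A k}"
  proof -
    have "pick I a < pick I (pick A k) \<longleftrightarrow> a < pick A k" if "a \<in> A" for a
      using pick_mono_le[of _ I] pA that A by (metis lessThan_iff linorder_neqE_nat less_asym less_irrefl subsetD)
    then show ?thesis by auto
  qed
  moreover have "inj_on (pick I) A"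
    using A by (rule pick_inj_on)
  then have "inj_on (pick I) {a \<in> A. a < pick A k}" by (rule inj_on_subset) auto
  ultimately have "card {a \<in> pick I ` A. a < pick I (pick A k)} = k"
    using card_pick_le[OF k] by (simp add: card_image)
  then show ?thesis using pick_card_in_set[of "pick I (pick A k)" "pick I ` A"] pA by simp
qed

lemma H_matrix_rows:
  assumes H: "H_matrix M" and M: "M \<in> carrier_mat m n" and I: "I \<subseteq> {..<m}"
  shows "H_matrix (submatrix M I {..<n})"
  unfolding H_matrix_def
proof (intro allI impI)
  let ?N = "submatrix M I {..<n}"
  have N: "?N \<in> carrier_mat (card I) n" using index_submatrix(1)[OF M I, of "{..<n}"] by simp
  fix A B assume "A \<subseteq> {..<dim_row ?N}" "B \<subseteq> {..<dim_col ?N}" and AB: "card A = card B"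
  then have A: "A \<subseteq> {..<card I}" and B: "B \<subseteq> {..<n}" using N by auto
  have inj: "inj_on (pick I) A"
    using A by (rule pick_inj_on)
  have IA: "pick I ` A \<subseteq> {..<m}" using A pick_less[OF I] by (meson image_subsetI lessThan_iff subsetD)
  have "submatrix ?N A B = submatrix M (pick I ` A) B"
  proof (rule eq_matI)
    note 1 = index_submatrix[OF N A B] and 2 = index_submatrix[OF M IA B]
    show "dim_row (submatrix ?N A B) = dim_row (submatrix M (pick I ` A) B)"
      "dim_col (submatrix ?N A B) = dim_col (submatrix M (pick I ` A) B)"
      using 1(1) 2(1) card_image[OF inj] by auto
    fix i j assume "i < dim_row (submatrix M (pick I ` A) B)" "j < dim_col (submatrix M (pick I ` A) B)"
    then have ij: "i < card A" "j < card B" using 2(1) card_image[OF inj] by auto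
    have "pick A i < card I" "pick B j < n" using pick_less[OF A ij(1)] pick_less[OF B ij(2)] by auto
    then show "submatrix ?N A B $$ (i, j) = submatrix M (pick I ` A) B $$ (i, j)"
      using 1(2)[OF ij] 2(2)[of i j] ij card_image[OF inj]
        index_submatrix(2)[OF M I, of "{..<n}" "pick A i" "pick B j"]
      by (simp add: pick_image[OF I A] pick_lessThan)
  qed
  moreover have "det (submatrix M (pick I ` A) B) \<in> sixth_roots_0"
  proof -
    have "pick I ` A \<subseteq> {..<dim_row M}" "B \<subseteq> {..<dim_col M}" "card (pick I ` A) = card B"
      using IA B M AB card_image[OF inj] by simp_all
    then show ?thesis using H unfolding H_matrix_def by blast
  qed
  ultimately show "det (submatrix ?N A B) \<in> sixth_roots_0" by simp
qed

text \<open>Turns the choice of a submatrix into a matrix product: multiplying by it on the left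
  selects rows, multiplying by its transpose on the right selects columns, and the transpose extends
  a vector by zeros outside J.\<close>

definition selection_mat :: "nat \<Rightarrow> nat set \<Rightarrow> 'a :: {zero,one} mat" where
  "selection_mat n J = mat (card J) n (\<lambda>(k, j). if j = pick J k then 1 else 0)"

lemma selection_mat_carrier [simp]: "selection_mat n J \<in> carrier_mat (card J) n"
  unfolding selection_mat_def by simp

lemma selection_mat_vec:
  assumes "J \<subseteq> {..<n}" and "k < card J" and "v \<in> carrier_vec n"
  shows "(selection_mat n J *\<^sub>v v) $ k = (v $ pick J k :: 'a :: comm_semiring_1)"
proof -
  have "(selection_mat n J *\<^sub>v v) $ k = (\<Sum>j\<in>{0..<n}. (if j = pick J k then 1 else 0) * v $ j)"
    using assms unfolding selection_mat_def by (simp add: scalar_prod_def)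
  also have "\<dots> = (\<Sum>j\<in>{pick J k}. (if j = pick J k then 1 else 0) * v $ j)"
    using pick_less[OF assms(1,2)] by (intro sum.mono_neutral_right) auto
  finally show ?thesis by simp
qed

lemma selection_mat_transpose_vec:
  assumes J: "J \<subseteq> {..<n}" and v: "v \<in> carrier_vec (card J)"
  shows "k < card J \<Longrightarrow> ((selection_mat n J)\<^sup>T *\<^sub>v v) $ pick J k = (v $ k :: 'a :: comm_semiring_1)"
    and "j < n \<Longrightarrow> j \<notin> J \<Longrightarrow> ((selection_mat n J)\<^sup>T *\<^sub>v v) $ j = 0"
proof -
  have e: "((selection_mat n J)\<^sup>T *\<^sub>v v) $ j = (\<Sum>l\<in>{0..<card J}. (if j = pick J l then 1 else 0) * v $ l)"
    if "j < n" for j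
    using that v unfolding selection_mat_def by (simp add: scalar_prod_def)
  show "((selection_mat n J)\<^sup>T *\<^sub>v v) $ pick J k = v $ k" if k: "k < card J"
  proof -
    have "((selection_mat n J)\<^sup>T *\<^sub>v v) $ pick J k = (\<Sum>l\<in>{k}. (if pick J k = pick J l then 1 else 0) * v $ l)"
      unfolding e[OF pick_less[OF J k]] using k pick_inj[OF k]
      by (intro sum.mono_neutral_right) auto
    then show ?thesis by simp
  qed
  show "((selection_mat n J)\<^sup>T *\<^sub>v v) $ j = 0" if "j < n" "j \<notin> J"
  proof -
    have "j \<noteq> pick J l" if "l < card J" for l
      using pick_in_set_le[OF that] \<open>j \<notin> J\<close> by blast
    then show ?thesis unfolding e[OF that(1)] by (intro sum.neutral) simp
  qed
qed

lemma selection_mat_transpose_cancel: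
  assumes J: "J \<subseteq> {..<n}" and v: "v \<in> carrier_vec n"
    and supp: "\<And>j. j < n \<Longrightarrow> j \<notin> J \<Longrightarrow> v $ j = 0"
  shows "(selection_mat n J)\<^sup>T *\<^sub>v (selection_mat n J *\<^sub>v v) = (v :: 'a :: comm_semiring_1 vec)"
proof (rule eq_vecI)
  have c: "selection_mat n J *\<^sub>v v \<in> carrier_vec (card J)"
    using selection_mat_carrier v by (rule mult_mat_vec_carrier)
  fix j assume "j < dim_vec v"
  then have j: "j < n" using v by simp
  show "((selection_mat n J)\<^sup>T *\<^sub>v (selection_mat n J *\<^sub>v v)) $ j = v $ j"
  proof (cases "j \<in> J")
    case True
    then obtain k where k: "k < card J" "pick J k = j" by (rule pick_index[OF J])
    show ?thesis
      using selection_mat_transpose_vec(1)[OF J c k(1)] selection_mat_vec[OF J k(1) v] unfolding k(2)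
      by (rule trans)
  next
    case False
    then show ?thesis using selection_mat_transpose_vec(2)[OF J c] supp j by simp
  qed
qed (use v in \<open>simp add: selection_mat_def\<close>)

lemma submatrix_rows_eq:
  fixes M :: "'a :: comm_semiring_1 mat"
  assumes M: "M \<in> carrier_mat m n" and I: "I \<subseteq> {..<m}"
  shows "submatrix M I {..<n} = selection_mat m I * M"
proof (rule eq_matI)
  note s = index_submatrix[OF M I, of "{..<n}"]
  fix i j assume "i < dim_row (selection_mat m I * M)" "j < dim_col (selection_mat m I * M)"
  then have ij: "i < card I" "j < n" using M by (auto simp: selection_mat_def)
  have "(selection_mat m I * M) $$ (i, j) = (selection_mat m I *\<^sub>v col M j) $ i"
    using ij M by (simp add: selection_mat_def)
  also have "\<dots> = M $$ (pick I i, j)"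
    using ij M pick_less[OF I ij(1)] by (subst selection_mat_vec[OF I]) auto
  finally show "submatrix M I {..<n} $$ (i, j) = (selection_mat m I * M) $$ (i, j)"
    using s(2) ij by (simp add: pick_lessThan)
qed (use index_submatrix(1)[OF M I, of "{..<n}"] M in \<open>auto simp: selection_mat_def\<close>)

lemma submatrix_cols_eq:
  fixes M :: "'a :: comm_semiring_1 mat"
  assumes M: "M \<in> carrier_mat m n" and J: "J \<subseteq> {..<n}"
  shows "submatrix M {..<m} J = M * (selection_mat n J)\<^sup>T"
proof (rule eq_matI)
  note s = index_submatrix[OF M _ J, of "{..<m}"]
  fix i j assume "i < dim_row (M * (selection_mat n J)\<^sup>T)" "j < dim_col (M * (selection_mat n J)\<^sup>T)"
  then have ij: "i < m" "j < card J" using M by (auto simp: selection_mat_def)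
  have "(M * (selection_mat n J)\<^sup>T) $$ (i, j) = row M i \<bullet> row (selection_mat n J) j"
    using ij M by (simp add: selection_mat_def)
  also have "\<dots> = (selection_mat n J *\<^sub>v row M i) $ j"
    using ij M by (subst comm_scalar_prod[of _ n]) (auto simp: selection_mat_def)
  also have "\<dots> = M $$ (i, pick J j)"
    using ij M pick_less[OF J ij(2)] by (subst selection_mat_vec[OF J]) auto
  finally show "submatrix M {..<m} J $$ (i, j) = (M * (selection_mat n J)\<^sup>T) $$ (i, j)"
    using s(2) ij by (simp add: pick_lessThan)
qed (use index_submatrix(1)[OF M _ J, of "{..<m}"] M in \<open>auto simp: selection_mat_def\<close>)

text \<open>The selection matrix and its transpose identify vectors supported on J with vectors of
  length \<open>card J\<close>.\<close>

lemma supported_kernel_iff: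
  fixes M :: "'a :: comm_ring_1 mat"
  assumes M: "M \<in> carrier_mat m n" and J: "J \<subseteq> {..<n}"
  shows "(\<forall>v\<in>carrier_vec n. (\<forall>j<n. j \<notin> J \<longrightarrow> v $ j = 0) \<longrightarrow> M *\<^sub>v v = 0\<^sub>v m \<longrightarrow> v = 0\<^sub>v n) \<longleftrightarrow>
    (\<forall>v\<in>carrier_vec (card J). M * (selection_mat n J)\<^sup>T *\<^sub>v v = 0\<^sub>v m \<longrightarrow> v = 0\<^sub>v (card J))"
    (is "?R \<longleftrightarrow> _")
proof -
  define S :: "'a mat" where "S = selection_mat n J"
  define N where "N = M * S\<^sup>T"
  have S: "S \<in> carrier_mat (card J) n" unfolding S_def by simp
  have N: "N \<in> carrier_mat m (card J)" unfolding N_def using M S by simp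
  have "?R \<longleftrightarrow> (\<forall>v\<in>carrier_vec (card J). N *\<^sub>v v = 0\<^sub>v m \<longrightarrow> v = 0\<^sub>v (card J))"
  proof safe
    fix v assume R: ?R and v: "v \<in> carrier_vec (card J)" "N *\<^sub>v v = 0\<^sub>v m"
    have w: "S\<^sup>T *\<^sub>v v \<in> carrier_vec n" using S v by auto
    have "M *\<^sub>v (S\<^sup>T *\<^sub>v v) = 0\<^sub>v m"
      using v S M unfolding N_def by (simp add: assoc_mult_mat_vec[of _ m n _ "card J"])
    moreover have "\<forall>j<n. j \<notin> J \<longrightarrow> (S\<^sup>T *\<^sub>v v) $ j = 0"
      using selection_mat_transpose_vec(2)[OF J v(1)] unfolding S_def by blast
    ultimately have z: "S\<^sup>T *\<^sub>v v = 0\<^sub>v n" using R w by blast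
    show "v = 0\<^sub>v (card J)"
    proof (rule eq_vecI)
      fix k assume "k < dim_vec (0\<^sub>v (card J) :: 'a vec)"
      then have k: "k < card J" by simp
      have "v $ k = (S\<^sup>T *\<^sub>v v) $ pick J k"
        unfolding S_def by (rule selection_mat_transpose_vec(1)[OF J v(1) k, symmetric])
      then show "v $ k = 0\<^sub>v (card J) $ k" unfolding z using pick_less[OF J k] k by simp
    qed (use v in simp)
  next
    fix v assume R: "\<forall>v\<in>carrier_vec (card J). N *\<^sub>v v = 0\<^sub>v m \<longrightarrow> v = 0\<^sub>v (card J)"
      and v: "v \<in> carrier_vec n" "\<forall>j<n. j \<notin> J \<longrightarrow> v $ j = 0" "M *\<^sub>v v = 0\<^sub>v m"
    have c: "S\<^sup>T *\<^sub>v (S *\<^sub>v v) = v"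
      unfolding S_def using selection_mat_transpose_cancel[OF J v(1)] v(2) by blast
    then have "N *\<^sub>v (S *\<^sub>v v) = 0\<^sub>v m"
      using v S M unfolding N_def by (simp add: assoc_mult_mat_vec[of _ m n _ "card J"])
    then have "S *\<^sub>v v = 0\<^sub>v (card J)" using R S v by auto
    moreover have "S\<^sup>T *\<^sub>v 0\<^sub>v (card J) = 0\<^sub>v n" using S by (intro eq_vecI) auto
    ultimately show "v = 0\<^sub>v n" using c by simp
  qed
  then show ?thesis unfolding N_def S_def .
qed

text \<open>Replaces dependence of a set of columns, together with the separate injectivity clause,
  by triviality of a kernel. In this form independence can be compared between matrices with
  different numbers of rows.\<close>

lemma columns_lin_indpt_iff:
  assumes M: "M \<in> carrier_mat m n" and J: "J \<subseteq> {..<n}"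
  shows "columns_lin_indpt M J \<longleftrightarrow>
    (\<forall>v\<in>carrier_vec n. (\<forall>j<n. j \<notin> J \<longrightarrow> v $ j = 0) \<longrightarrow> M *\<^sub>v v = 0\<^sub>v m \<longrightarrow> v = 0\<^sub>v n)"
    (is "_ \<longleftrightarrow> ?R")
proof -
  define S :: "complex mat" where "S = selection_mat n J"
  define N where "N = M * S\<^sup>T"
  have S: "S \<in> carrier_mat (card J) n" unfolding S_def by simp
  have N: "N \<in> carrier_mat m (card J)" unfolding N_def using M S by simp
  have colN: "col N k = col M (pick J k)" if "k < card J" for k
  proof (rule eq_vecI)
    fix i assume "i < dim_vec (col M (pick J k))"
    then have "i < m" using M by simp
    then have "N $$ (i, k) = M $$ (i, pick J k)"
      unfolding N_def S_def submatrix_cols_eq[OF M J, symmetric]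
      using index_submatrix(2)[OF M _ J, of "{..<m}" i k] that by (simp add: pick_lessThan)
    then show "col N k $ i = col M (pick J k) $ i"
      using \<open>i < m\<close> that N M pick_less[OF J that] by simp
  qed (use N M in auto)
  have J_pick: "pick J ` {..<card J} = J"
  proof
    show "pick J ` {..<card J} \<subseteq> J" using pick_in_set_le by auto
    show "J \<subseteq> pick J ` {..<card J}" using pick_index[OF J] by (metis image_eqI lessThan_iff subsetI)
  qed
  have "set (cols N) = col N ` {..<card J}" using N by (auto simp: cols_def)
  also have "\<dots> = col M ` pick J ` {..<card J}" unfolding image_image by (intro image_cong) (auto simp: colN)
  finally have set_cols: "set (cols N) = col M ` J" unfolding J_pick .
  have dist': "distinct (cols N) \<longleftrightarrow> inj_on (col N) {..<card J}"
    using N by (simp add: cols_def distinct_map atLeast0LessThan)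
  also have "\<dots> \<longleftrightarrow> inj_on (col M \<circ> pick J) {..<card J}"
    by (rule inj_on_cong) (simp add: colN)
  also have "\<dots> \<longleftrightarrow> inj_on (col M) (pick J ` {..<card J})"
    using comp_inj_on_iff[OF pick_inj_on[of "{..<card J}" J], of "col M"] by simp
  finally have dist: "distinct (cols N) \<longleftrightarrow> inj_on (col M) J" unfolding J_pick .
  have R_iff: "?R \<longleftrightarrow> (\<forall>v\<in>carrier_vec (card J). N *\<^sub>v v = 0\<^sub>v m \<longrightarrow> v = 0\<^sub>v (card J))"
    unfolding N_def S_def by (rule supported_kernel_iff[OF M J])
  interpret vec_space "TYPE(complex)" m .
  show ?thesis
  proof (cases "inj_on (col M) J")
    case True
    have d: "distinct (cols N)" using True dist by blast
    have "lin_dep (set (cols N)) \<longleftrightarrow> (\<exists>v\<in>carrier_vec (card J). v \<noteq> 0\<^sub>v (card J) \<and> N *\<^sub>v v = 0\<^sub>v m)"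
    proof
      assume "lin_dep (set (cols N))"
      then show "\<exists>v\<in>carrier_vec (card J). v \<noteq> 0\<^sub>v (card J) \<and> N *\<^sub>v v = 0\<^sub>v m"
        by (rule lin_depE[OF N _ d]) blast
    next
      assume "\<exists>v\<in>carrier_vec (card J). v \<noteq> 0\<^sub>v (card J) \<and> N *\<^sub>v v = 0\<^sub>v m"
      then show "lin_dep (set (cols N))" using lin_depI[OF N _ _ _ d] by blast
    qed
    moreover have "dim_row M = m" using M by simp
    ultimately show ?thesis
      unfolding columns_lin_indpt_def R_iff set_cols by (simp only: True) blast
  next
    case False
    then obtain a b where ab: "a < card J" "b < card J" "a \<noteq> b" "col N a = col N b"
      using dist dist' by (auto simp: inj_on_def)
    \<comment> \<open>Two equal columns with different indices give a kernel vector supported on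
      these two positions, matching the failure of injectivity.\<close>
    define v :: "complex vec" where "v = unit_vec (card J) a - unit_vec (card J) b"
    have "N *\<^sub>v v = N *\<^sub>v unit_vec (card J) a - N *\<^sub>v unit_vec (card J) b"
      unfolding v_def using N by (intro mult_minus_distrib_mat_vec) auto
    also have "\<dots> = col N a - col N b"
    proof -
      have "N *\<^sub>v unit_vec (card J) k = col N k" if "k < card J" for k
        using N that by (intro eq_vecI) auto
      then show ?thesis using ab by simp
    qed
    also have "\<dots> = 0\<^sub>v m" using ab N by (intro eq_vecI) auto
    finally have "N *\<^sub>v v = 0\<^sub>v m" .
    moreover have "v $ a = 1" using ab unfolding v_def by simp
    then have "v \<noteq> 0\<^sub>v (card J)" using ab by auto
    moreover have "v \<in> carrier_vec (card J)" unfolding v_def by simp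
    ultimately show ?thesis unfolding columns_lin_indpt_def R_iff using False by blast
  qed
qed

text \<open>I is a row basis: C expresses every row of M through the rows in I, and the last
  property says that these rows are independent. I is taken of least size among sets admitting such
  a C, because a dependency would allow one more row to be eliminated.\<close>

lemma row_basis_exists:
  fixes M :: "'a :: field mat"
  assumes M: "M \<in> carrier_mat m n"
  obtains I C where "I \<subseteq> {..<m}" and "C \<in> carrier_mat m m"
    and "\<And>i j. i < m \<Longrightarrow> j < m \<Longrightarrow> j \<notin> I \<Longrightarrow> C $$ (i, j) = 0"
    and "C * M = M"
    and "\<And>y. y \<in> carrier_vec m \<Longrightarrow> (\<And>i. i < m \<Longrightarrow> i \<notin> I \<Longrightarrow> y $ i = 0) \<Longrightarrow>
      M\<^sup>T *\<^sub>v y = 0\<^sub>v n \<Longrightarrow> y = 0\<^sub>v m"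
proof -
  define P where "P I \<longleftrightarrow> I \<subseteq> {..<m} \<and> (\<exists>C\<in>carrier_mat m m.
      (\<forall>i<m. \<forall>j<m. j \<notin> I \<longrightarrow> C $$ (i, j) = 0) \<and> C * M = M)" for I
  have "P {..<m}" unfolding P_def using M by (auto intro!: bexI[of _ "1\<^sub>m m"])
  then obtain I where PI: "P I" and min: "\<And>I'. P I' \<Longrightarrow> card I \<le> card I'"
    using ex_has_least_nat[of P "{..<m}" card] by auto
  obtain C where I: "I \<subseteq> {..<m}" and C: "C \<in> carrier_mat m m"
    "\<And>i j. i < m \<Longrightarrow> j < m \<Longrightarrow> j \<notin> I \<Longrightarrow> C $$ (i, j) = 0" "C * M = M"
    using PI unfolding P_def by blast
  have ind: "y = 0\<^sub>v m" if y: "y \<in> carrier_vec m" "\<And>i. i < m \<Longrightarrow> i \<notin> I \<Longrightarrow> y $ i = 0" "M\<^sup>T *\<^sub>v y = 0\<^sub>v n" for y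
  proof (rule ccontr)
    assume "y \<noteq> 0\<^sub>v m"
    then obtain k where k: "k < m" "y $ k \<noteq> 0" using y(1) by (auto simp: vec_eq_iff)
    then have kI: "k \<in> I" using y by blast
    \<comment> \<open>Adding multiples of the dependency y to rows of C does not change C M. The
      multiple is chosen so that column k of the new coefficient matrix vanishes.\<close>
    define C' where "C' = mat m m (\<lambda>(i, j). C $$ (i, j) - C $$ (i, k) / y $ k * y $ j)"
    have "C' * M = M"
    proof (rule eq_matI)
      fix i j assume "i < dim_row M" "j < dim_col M"
      then have ij: "i < m" "j < n" using M by auto
      have 1: "(\<Sum>l\<in>{0..<m}. M $$ (l, j) * y $ l) = 0"
        using arg_cong[OF y(3), of "\<lambda>v. v $ j"] ij M y(1) by (simp add: scalar_prod_def)
      have 2: "(\<Sum>l\<in>{0..<m}. C $$ (i, l) * M $$ (l, j)) = M $$ (i, j)"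
        using arg_cong[OF C(3), of "\<lambda>A. A $$ (i, j)"] ij M C(1) by (simp add: scalar_prod_def)
      have "(C' * M) $$ (i, j) = (\<Sum>l\<in>{0..<m}. (C $$ (i, l) - C $$ (i, k) / y $ k * y $ l) * M $$ (l, j))"
        using ij M unfolding C'_def by (simp add: scalar_prod_def)
      also have "\<dots> = (\<Sum>l\<in>{0..<m}. C $$ (i, l) * M $$ (l, j)) -
          C $$ (i, k) / y $ k * (\<Sum>l\<in>{0..<m}. M $$ (l, j) * y $ l)"
        unfolding sum_distrib_left sum_subtractf[symmetric] by (intro sum.cong) (auto simp: algebra_simps)
      finally show "(C' * M) $$ (i, j) = M $$ (i, j)" unfolding 1 2 by simp
    qed (use M in \<open>auto simp: C'_def\<close>)
    moreover have "C' $$ (i, j) = 0" if ij: "i < m" "j < m" "j \<notin> I - {k}" for i j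
    proof (cases "j = k")
      case True
      then show ?thesis using ij k unfolding C'_def by simp
    next
      case False
      then have "C $$ (i, j) = 0" "y $ j = 0" using ij C(2) y(2) by auto
      then show ?thesis using ij unfolding C'_def by simp
    qed
    moreover have "C' \<in> carrier_mat m m" unfolding C'_def by simp
    moreover have "I - {k} \<subseteq> {..<m}" using I by blast
    ultimately have "P (I - {k})" unfolding P_def by blast
    then have "card I \<le> card (I - {k})" by (rule min)
    moreover have "finite I" using I finite_subset by blast
    ultimately show False using kI by (metis card_Diff1_less not_le)
  qed
  show thesis
    by (rule that[OF I C(1) _ C(3)]) (use C(2) ind in blast)+
qed

section \<open>The Jacobian of a matrix\<close>

lemma row_space_iff:
  assumes "M \<in> carrier_mat m n"
  shows "v \<in> vec_space.row_space n M \<longleftrightarrow> (\<exists>y\<in>carrier_vec m. v = M\<^sup>T *\<^sub>v y)"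
  using vec_space.row_space_eq[of M m n] assms by auto

lemma lattice_dual_iff:
  assumes "M \<in> carrier_mat m n"
  shows "v \<in> lattice_dual M \<longleftrightarrow> v \<in> eis_vecs n \<and> (\<exists>y\<in>carrier_vec m. v = M\<^sup>T *\<^sub>v y)"
  unfolding lattice_dual_def carrier_matD(2)[OF assms] using row_space_iff[OF assms] by auto

lemma conjugate_mult_mat_vec:
  assumes "A \<in> carrier_mat m n" and "y \<in> carrier_vec n"
  shows "conjugate (A *\<^sub>v y) = map_mat cnj A *\<^sub>v conjugate y"
  using assms by (intro eq_vecI) (auto simp: scalar_prod_def)

lemma cscalar_prod_transpose:
  assumes M: "M \<in> carrier_mat m n" and v: "v \<in> carrier_vec n" and y: "y \<in> carrier_vec m"
  shows "v \<bullet>c (M\<^sup>T *\<^sub>v y) = (map_mat cnj M *\<^sub>v v) \<bullet>c y"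
proof -
  have Mc: "map_mat cnj M \<in> carrier_mat m n" using M by simp
  have yc: "conjugate y \<in> carrier_vec m" using y by simp
  have "conjugate (M\<^sup>T *\<^sub>v y) = (map_mat cnj M)\<^sup>T *\<^sub>v conjugate y"
    using conjugate_mult_mat_vec[of "M\<^sup>T" n m y] M y by (simp add: map_mat_transpose)
  then have "v \<bullet>c (M\<^sup>T *\<^sub>v y) = ((map_mat cnj M)\<^sup>T *\<^sub>v conjugate y) \<bullet> v"
    using M v y by (simp add: comm_scalar_prod[of _ n])
  also have "\<dots> = conjugate y \<bullet> (map_mat cnj M *\<^sub>v v)"
    by (rule transpose_vec_mult_scalar[OF Mc v yc])
  also have "\<dots> = (map_mat cnj M *\<^sub>v v) \<bullet>c y"
    using M v y by (intro comm_scalar_prod[of _ m]) auto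
  finally show ?thesis .
qed

text \<open>By adjointness, v is orthogonal to all \<open>M\<^sup>T *\<^sub>v y\<close> iff its
  image under the conjugate of M is orthogonal to all y, in particular to itself.\<close>

lemma lattice_orth_iff:
  assumes M: "M \<in> carrier_mat m n"
  shows "v \<in> lattice_orth M \<longleftrightarrow> v \<in> eis_vecs n \<and> map_mat cnj M *\<^sub>v v = 0\<^sub>v m"
proof (cases "v \<in> eis_vecs n")
  case True
  note v = eis_vecs_carrier[OF True]
  have Mv: "map_mat cnj M *\<^sub>v v \<in> carrier_vec m" using M v by auto
  have "v \<in> lattice_orth M \<longleftrightarrow> (\<forall>w\<in>vec_space.row_space n M. v \<bullet>c w = 0)"
    using True v unfolding lattice_orth_def carrier_matD(2)[OF M] by auto
  also have "vec_space.row_space n M = (*\<^sub>v) M\<^sup>T ` carrier_vec m"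
    using row_space_iff[OF M] by blast
  also have "(\<forall>w\<in>(*\<^sub>v) M\<^sup>T ` carrier_vec m. v \<bullet>c w = 0) \<longleftrightarrow>
      (\<forall>y\<in>carrier_vec m. (map_mat cnj M *\<^sub>v v) \<bullet>c y = 0)"
    unfolding ball_simps(9) by (intro ball_cong refl) (simp only: cscalar_prod_transpose[OF M v])
  also have "\<dots> \<longleftrightarrow> map_mat cnj M *\<^sub>v v = 0\<^sub>v m"
  proof
    assume "\<forall>y\<in>carrier_vec m. (map_mat cnj M *\<^sub>v v) \<bullet>c y = 0"
    from bspec[OF this Mv] show "map_mat cnj M *\<^sub>v v = 0\<^sub>v m"
      by (simp only: conjugate_square_eq_0_vec[OF Mv])
  next
    assume "map_mat cnj M *\<^sub>v v = 0\<^sub>v m"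
    then show "\<forall>y\<in>carrier_vec m. (map_mat cnj M *\<^sub>v v) \<bullet>c y = 0" by simp
  qed
  finally show ?thesis using True by simp
next
  case False
  then show ?thesis using M unfolding lattice_orth_def by auto
qed

definition lattice_sum :: "nat \<Rightarrow> complex mat \<Rightarrow> complex vec set" where
  "lattice_sum n M = {a + b | a b. a \<in> lattice_orth M \<and> b \<in> lattice_dual M}"

lemma Jac_eq:
  assumes "M \<in> carrier_mat m n"
  shows "Jac M = quotient_module (eis_module n) (lattice_sum n M)"
proof -
  have "lattice_orth M <+>\<^bsub>eis_module n\<^esub> lattice_dual M = lattice_sum n M"
    unfolding set_add_def' lattice_sum_def by auto
  then show ?thesis using assms unfolding Jac_def Let_def by simp
qed

lemma lattice_sum_submodule:
  assumes M: "M \<in> carrier_mat m n"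
  shows "quotient_by_submodule eis_ring (eis_module n) (lattice_sum n M)"
proof -
  note iff = lattice_orth_iff[OF M] lattice_dual_iff[OF M]
  have dual_add: "x + y \<in> lattice_dual M" if xy: "x \<in> lattice_dual M" "y \<in> lattice_dual M" for x y
  proof -
    obtain a b where "a \<in> carrier_vec m" "x = M\<^sup>T *\<^sub>v a" "b \<in> carrier_vec m" "y = M\<^sup>T *\<^sub>v b"
      using xy unfolding iff by auto
    then have "x + y = M\<^sup>T *\<^sub>v (a + b)" "a + b \<in> carrier_vec m"
      using M mult_add_distrib_mat_vec[of "M\<^sup>T" n m a b] by auto
    then show ?thesis using xy unfolding iff by blast
  qed
  have dual_smult: "c \<cdot>\<^sub>v x \<in> lattice_dual M" if cx: "c \<in> eis_ints" "x \<in> lattice_dual M" for c x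
  proof -
    obtain a where "a \<in> carrier_vec m" "x = M\<^sup>T *\<^sub>v a"
      using cx unfolding iff by auto
    then have "c \<cdot>\<^sub>v x = M\<^sup>T *\<^sub>v (c \<cdot>\<^sub>v a)" "c \<cdot>\<^sub>v a \<in> carrier_vec m"
      using M mult_mat_vec[of "M\<^sup>T" n m a c] by auto
    then show ?thesis using cx unfolding iff by blast
  qed
  have Mc: "map_mat cnj M \<in> carrier_mat m n" using M by simp
  have orth_add: "x + y \<in> lattice_orth M" if "x \<in> lattice_orth M" "y \<in> lattice_orth M" for x y
    using that mult_add_distrib_mat_vec[OF Mc, of x y] eis_vecs_carrier unfolding iff by auto
  have orth_smult: "c \<cdot>\<^sub>v x \<in> lattice_orth M" if "c \<in> eis_ints" "x \<in> lattice_orth M" for c x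
    using that mult_mat_vec[OF Mc, of x c] eis_vecs_carrier unfolding iff by auto
  have sub: "lattice_orth M \<subseteq> eis_vecs n" "lattice_dual M \<subseteq> eis_vecs n" by (auto simp: iff)
  have zero: "0\<^sub>v n \<in> lattice_orth M" "0\<^sub>v n \<in> lattice_dual M"
    using M unfolding iff by (auto intro!: bexI[of _ "0\<^sub>v m"])
  show ?thesis
  proof (rule eis_submoduleI)
    show "lattice_sum n M \<subseteq> eis_vecs n" unfolding lattice_sum_def using sub by auto
    show "0\<^sub>v n \<in> lattice_sum n M"
      using zero unfolding lattice_sum_def by (auto intro!: exI[of _ "0\<^sub>v n"])
    show "x + y \<in> lattice_sum n M" if xy: "x \<in> lattice_sum n M" "y \<in> lattice_sum n M" for x y
    proof -
      obtain a b c d where e: "x = a + b" "y = c + d" "a \<in> lattice_orth M" "c \<in> lattice_orth M"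
        "b \<in> lattice_dual M" "d \<in> lattice_dual M" using xy unfolding lattice_sum_def by auto
      then have "a \<in> carrier_vec n" "b \<in> carrier_vec n" "c \<in> carrier_vec n" "d \<in> carrier_vec n"
        using sub eis_vecs_carrier by auto
      then have "x + y = (a + c) + (b + d)" unfolding e by (intro eq_vecI) auto
      then show ?thesis using orth_add dual_add e unfolding lattice_sum_def by blast
    qed
    show "c \<cdot>\<^sub>v x \<in> lattice_sum n M" if cx: "c \<in> eis_ints" "x \<in> lattice_sum n M" for c x
    proof -
      obtain a b where e: "x = a + b" "a \<in> lattice_orth M" "b \<in> lattice_dual M"
        using cx unfolding lattice_sum_def by auto
      then have "a \<in> carrier_vec n" "b \<in> carrier_vec n" using sub eis_vecs_carrier by auto
      then have "c \<cdot>\<^sub>v x = c \<cdot>\<^sub>v a + c \<cdot>\<^sub>v b" unfolding e by (simp add: smult_add_distrib_vec)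
      then show ?thesis using orth_smult dual_smult cx e unfolding lattice_sum_def by blast
    qed
  qed
qed

lemma Jac_iso_sym:
  assumes "module_isomorphic eis_ring (Jac M) N"
  shows "module_isomorphic eis_ring N (Jac M)"
proof -
  have M: "M \<in> carrier_mat (dim_row M) (dim_col M)" by simp
  show ?thesis
    using quotient_by_submodule.quotient_iso_sym[OF lattice_sum_submodule[OF M]] assms
    unfolding Jac_eq[OF M] by blast
qed

text \<open>The matrix on the right is the transpose of M M^H. The right inverse serves twice:
  conjugated, it gives surjectivity onto the integral vectors of length r; transposed, it recovers
  integral coefficients from a vector of the dual lattice.\<close>

lemma Jac_iso_cokernel:
  assumes M: "M \<in> eis_mats r n" and R: "R \<in> eis_mats n r" and MR: "M * R = 1\<^sub>m r"
  shows "module_isomorphic eis_ring (Jac M) (eis_cokernel r (map_mat cnj M * M\<^sup>T))"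
proof -
  define C where "C = map_mat cnj M"
  note Mc = eis_mats_carrier[OF M] and Rc = eis_mats_carrier[OF R]
  have C: "C \<in> eis_mats r n" unfolding C_def using M by simp
  note Cc = eis_mats_carrier[OF C]
  have A: "C * M\<^sup>T \<in> eis_mats r r" using C M by auto
  have CR: "C * map_mat cnj R = 1\<^sub>m r"
    unfolding C_def map_mat_cnj_mult[OF Mc Rc, symmetric] MR by simp
  have RTMT: "R\<^sup>T * M\<^sup>T = 1\<^sub>m r" using transpose_mult[OF Mc Rc] MR by simp
  have assoc: "C * M\<^sup>T *\<^sub>v y = C *\<^sub>v (M\<^sup>T *\<^sub>v y)" if "y \<in> carrier_vec r" for y
    using Cc Mc that by (intro assoc_mult_mat_vec) auto
  show ?thesis
    unfolding Jac_eq[OF Mc] eis_cokernel_def C_def[symmetric]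
  proof (rule eis_quotient_iso[OF lattice_sum_submodule[OF Mc] eis_image_submodule[OF A] C _ CR])
    fix x assume x: "x \<in> eis_vecs n"
    note xc = eis_vecs_carrier[OF x]
    show "C *\<^sub>v x \<in> (*\<^sub>v) (C * M\<^sup>T) ` eis_vecs r \<longleftrightarrow> x \<in> lattice_sum n M"
    proof
      assume "C *\<^sub>v x \<in> (*\<^sub>v) (C * M\<^sup>T) ` eis_vecs r"
      then obtain y where y: "y \<in> eis_vecs r" "C *\<^sub>v x = C *\<^sub>v (M\<^sup>T *\<^sub>v y)"
        using assoc eis_vecs_carrier by auto
      \<comment> \<open>b is the dual-lattice part of x: it has the same image as x under C, so x -
        b lies in the kernel, which is the orthogonal lattice.\<close>
      define b where "b = M\<^sup>T *\<^sub>v y"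
      have b: "b \<in> eis_vecs n"
        unfolding b_def by (rule eis_vecs_mult_mat_vec[OF eis_mats_transpose[OF M] y(1)])
      note bc = eis_vecs_carrier[OF b]
      have "b \<in> lattice_dual M"
        unfolding lattice_dual_iff[OF Mc] using b y eis_vecs_carrier unfolding b_def by auto
      moreover have "C *\<^sub>v (x - b) = 0\<^sub>v r"
        using mult_minus_distrib_mat_vec[OF Cc xc bc] y(2) Cc bc unfolding b_def[symmetric] by auto
      then have "x - b \<in> lattice_orth M"
        unfolding lattice_orth_iff[OF Mc] C_def[symmetric] using x b by auto
      moreover have "x = (x - b) + b" using xc bc by auto
      ultimately show "x \<in> lattice_sum n M" unfolding lattice_sum_def by blast
    next
      assume "x \<in> lattice_sum n M"
      then obtain a b where ab: "x = a + b" "a \<in> lattice_orth M" "b \<in> lattice_dual M"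
        unfolding lattice_sum_def by auto
      obtain y where y: "y \<in> carrier_vec r" "b = M\<^sup>T *\<^sub>v y" and b: "b \<in> eis_vecs n"
        using ab(3) unfolding lattice_dual_iff[OF Mc] by auto
      have a: "a \<in> eis_vecs n" "C *\<^sub>v a = 0\<^sub>v r"
        using ab(2) unfolding lattice_orth_iff[OF Mc] C_def by auto
      \<comment> \<open>A priori y is only a complex vector; this formula shows that it is
        integral.\<close>
      have "y = R\<^sup>T *\<^sub>v b"
        using RTMT y Rc Mc assoc_mult_mat_vec[of "R\<^sup>T" r n "M\<^sup>T" r y] by simp
      then have "y \<in> eis_vecs r"
        using eis_vecs_mult_mat_vec[OF eis_mats_transpose[OF R] b] by simp
      moreover have "C *\<^sub>v x = C * M\<^sup>T *\<^sub>v y"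
        unfolding ab(1) assoc[OF y(1)] y(2)[symmetric]
        using mult_add_distrib_mat_vec[OF Cc eis_vecs_carrier[OF a(1)] eis_vecs_carrier[OF b]] a(2)
          Cc eis_vecs_carrier[OF b] by simp
      ultimately show "C *\<^sub>v x \<in> (*\<^sub>v) (C * M\<^sup>T) ` eis_vecs r" by blast
    qed
  qed (use R in simp)
qed

lemma Jac_iso_cnj:
  assumes M: "M \<in> eis_mats r n" and R: "R \<in> eis_mats n r" and MR: "M * R = 1\<^sub>m r"
  shows "module_isomorphic eis_ring (Jac M) (Jac (map_mat cnj M))"
proof -
  note Mc = eis_mats_carrier[OF M]
  have MR': "map_mat cnj M * map_mat cnj R = 1\<^sub>m r"
    unfolding map_mat_cnj_mult[OF Mc eis_mats_carrier[OF R], symmetric] MR by simp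
  have cM: "map_mat cnj M \<in> eis_mats r n" "map_mat cnj R \<in> eis_mats n r" using M R by auto
  have A: "map_mat cnj M * M\<^sup>T \<in> eis_mats r r"
    by (rule eis_mats_mult[OF cM(1) eis_mats_transpose[OF M]])
  have "(map_mat cnj M * M\<^sup>T)\<^sup>T = M * (map_mat cnj M)\<^sup>T"
    using Mc by (subst transpose_mult[of _ r n _ r]) auto
  moreover have "module_isomorphic eis_ring (Jac (map_mat cnj M)) (eis_cokernel r (M * (map_mat cnj M)\<^sup>T))"
    using Jac_iso_cokernel[OF cM MR'] by simp
  ultimately have "module_isomorphic eis_ring (eis_cokernel r (map_mat cnj M * M\<^sup>T)\<^sup>T) (Jac (map_mat cnj M))"
    using Jac_iso_sym by simp
  then show ?thesis
    using module_isomorphic_trans[OF Jac_iso_cokernel[OF assms] eis_cokernel_iso_transpose[OF A]]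
    by (rule module_isomorphic_trans[rotated])
qed

text \<open>The Jacobian depends only on the row space and the number of columns. The numbers of
  rows may differ, so the lemma covers both pivots and the passage to a row basis.\<close>

lemma Jac_row_operation:
  assumes M: "M \<in> carrier_mat m n" and M': "M' \<in> carrier_mat m' n"
    and P: "P \<in> carrier_mat m' m" "M' = P * M" and Q: "Q \<in> carrier_mat m m'" "M = Q * M'"
  shows "Jac M' = Jac M"
proof -
  have sub: "vec_space.row_space n (L * N) \<subseteq> vec_space.row_space n N"
    if N: "N \<in> carrier_mat k n" and L: "L \<in> carrier_mat l k" for N L :: "complex mat" and k l
  proof
    fix v assume "v \<in> vec_space.row_space n (L * N)"
    then obtain y where y: "y \<in> carrier_vec l" "v = (L * N)\<^sup>T *\<^sub>v y"
      using row_space_iff[OF mult_carrier_mat[OF L N]] by blast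
    have "(L * N)\<^sup>T *\<^sub>v y = N\<^sup>T *\<^sub>v (L\<^sup>T *\<^sub>v y)"
      unfolding transpose_mult[OF L N] using N L y(1) by (intro assoc_mult_mat_vec) auto
    moreover have "L\<^sup>T *\<^sub>v y \<in> carrier_vec k" using L y(1) by auto
    ultimately show "v \<in> vec_space.row_space n N" unfolding row_space_iff[OF N] y(2) by blast
  qed
  have "vec_space.row_space n M' = vec_space.row_space n M"
    using sub[OF M P(1)] sub[OF M' Q(1)] unfolding P(2)[symmetric] Q(2)[symmetric] by (rule equalityI)
  then show ?thesis
    unfolding Jac_def lattice_orth_def lattice_dual_def carrier_matD(2)[OF M] carrier_matD(2)[OF M'] by simp
qed

text \<open>The hypothesis \<open>unit\<close> says that Q is unitary, so the conjugate of Q is an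
  integral inverse of \<open>Q\<^sup>T\<close>. The map \<open>Q\<^sup>T *\<^sub>v v\<close>, the
  row vector v Q, then preserves integrality, row spaces and orthogonality in both
  directions.\<close>

lemma Jac_column_operation:
  assumes M: "M \<in> carrier_mat m n" and Q: "Q \<in> eis_mats n n"
    and unit: "Q * (map_mat cnj Q)\<^sup>T = 1\<^sub>m n"
  shows "module_isomorphic eis_ring (Jac M) (Jac (M * Q))"
proof -
  define C where "C = map_mat cnj Q"
  have C: "C \<in> eis_mats n n" unfolding C_def using Q by simp
  note Qc = eis_mats_carrier[OF Q] and Cc = eis_mats_carrier[OF C]
  have MQ: "M * Q \<in> carrier_mat m n" using M Qc by simp
  have CTQ: "C\<^sup>T * Q = 1\<^sub>m n"
    using mat_mult_left_right_inverse[OF Qc _ unit] Cc unfolding C_def by simp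
  have CQT: "C * Q\<^sup>T = 1\<^sub>m n" using transpose_mult[OF Qc, of "C\<^sup>T" n] Cc unit unfolding C_def by simp
  have QTC: "Q\<^sup>T * C = 1\<^sub>m n" using transpose_mult[of "C\<^sup>T" n n Q n] CTQ Cc Qc by simp
  have CQv: "C *\<^sub>v (Q\<^sup>T *\<^sub>v v) = v" if "v \<in> carrier_vec n" for v
    using CQT assoc_mult_mat_vec[of C n n "Q\<^sup>T" n v] Cc Qc that by simp
  have QCv: "Q\<^sup>T *\<^sub>v (C *\<^sub>v v) = v" if "v \<in> carrier_vec n" for v
    using QTC assoc_mult_mat_vec[of "Q\<^sup>T" n n C n v] Cc Qc that by simp
  have QT: "Q\<^sup>T \<in> eis_mats n n" using Q by simp
  have dual: "Q\<^sup>T *\<^sub>v v \<in> lattice_dual (M * Q) \<longleftrightarrow> v \<in> lattice_dual M" if v: "v \<in> eis_vecs n" for v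
  proof -
    have e: "(M * Q)\<^sup>T *\<^sub>v y = Q\<^sup>T *\<^sub>v (M\<^sup>T *\<^sub>v y)" if "y \<in> carrier_vec m" for y
      using M Qc that by (simp add: transpose_mult[of _ m n _ n] assoc_mult_mat_vec[of _ n n _ m])
    have "Q\<^sup>T *\<^sub>v v = (M * Q)\<^sup>T *\<^sub>v y \<longleftrightarrow> v = M\<^sup>T *\<^sub>v y" if y: "y \<in> carrier_vec m" for y
    proof -
      have "M\<^sup>T *\<^sub>v y \<in> carrier_vec n" using M y by auto
      from CQv[OF this] CQv[OF eis_vecs_carrier[OF v]] show ?thesis unfolding e[OF y] by metis
    qed
    moreover have "Q\<^sup>T *\<^sub>v v \<in> eis_vecs n" using v QT by (rule eis_vecs_mult_mat_vec[rotated])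
    ultimately show ?thesis
      unfolding lattice_dual_iff[OF MQ] lattice_dual_iff[OF M] using v by blast
  qed
  have orth: "Q\<^sup>T *\<^sub>v v \<in> lattice_orth (M * Q) \<longleftrightarrow> v \<in> lattice_orth M" if v: "v \<in> eis_vecs n" for v
  proof -
    have "map_mat cnj (M * Q) *\<^sub>v (Q\<^sup>T *\<^sub>v v) = map_mat cnj M *\<^sub>v (C *\<^sub>v (Q\<^sup>T *\<^sub>v v))"
      unfolding map_mat_cnj_mult[OF M Qc] C_def
      using M Qc eis_vecs_carrier[OF v] by (intro assoc_mult_mat_vec) auto
    then show ?thesis
      unfolding lattice_orth_iff[OF MQ] lattice_orth_iff[OF M]
      using v QT CQv[OF eis_vecs_carrier[OF v]] by simp
  qed
  show ?thesis
    unfolding Jac_eq[OF M] Jac_eq[OF MQ]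
  proof (rule eis_quotient_iso[OF lattice_sum_submodule[OF M] lattice_sum_submodule[OF MQ] QT C QTC])
    fix x assume x: "x \<in> eis_vecs n"
    have sub: "lattice_orth M \<subseteq> eis_vecs n" "lattice_dual M \<subseteq> eis_vecs n"
      by (auto simp: lattice_orth_iff[OF M] lattice_dual_iff[OF M])
    have sub': "lattice_orth (M * Q) \<subseteq> eis_vecs n" "lattice_dual (M * Q) \<subseteq> eis_vecs n"
      by (auto simp: lattice_orth_iff[OF MQ] lattice_dual_iff[OF MQ])
    show "Q\<^sup>T *\<^sub>v x \<in> lattice_sum n (M * Q) \<longleftrightarrow> x \<in> lattice_sum n M"
    proof
      assume "Q\<^sup>T *\<^sub>v x \<in> lattice_sum n (M * Q)"
      then obtain a b where ab: "Q\<^sup>T *\<^sub>v x = a + b" "a \<in> lattice_orth (M * Q)" "b \<in> lattice_dual (M * Q)"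
        unfolding lattice_sum_def by auto
      then have e: "a \<in> eis_vecs n" "b \<in> eis_vecs n" using sub' by auto
      note c = e[THEN eis_vecs_carrier]
      have "x = C *\<^sub>v a + C *\<^sub>v b"
        using CQv[OF eis_vecs_carrier[OF x]] mult_add_distrib_mat_vec[OF Cc c] ab(1) by simp
      moreover have "C *\<^sub>v a \<in> lattice_orth M" "C *\<^sub>v b \<in> lattice_dual M"
        using orth[of "C *\<^sub>v a"] dual[of "C *\<^sub>v b"] ab(2,3) C e QCv[OF c(1)] QCv[OF c(2)] by auto
      ultimately show "x \<in> lattice_sum n M" unfolding lattice_sum_def by blast
    next
      assume "x \<in> lattice_sum n M"
      then obtain a b where ab: "x = a + b" "a \<in> lattice_orth M" "b \<in> lattice_dual M"
        unfolding lattice_sum_def by auto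
      then have e: "a \<in> eis_vecs n" "b \<in> eis_vecs n" using sub by auto
      have "Q\<^sup>T *\<^sub>v x = Q\<^sup>T *\<^sub>v a + Q\<^sup>T *\<^sub>v b"
        unfolding ab(1) using mult_add_distrib_mat_vec[of "Q\<^sup>T" n n a b] Qc e[THEN eis_vecs_carrier] by simp
      then show "Q\<^sup>T *\<^sub>v x \<in> lattice_sum n (M * Q)"
        using orth[OF e(1)] dual[OF e(2)] ab unfolding lattice_sum_def by blast
    qed
  qed
qed

lemma Jac_elementary_move:
  assumes "elementary_move X Y"
  shows "module_isomorphic eis_ring (Jac (fst X)) (Jac (fst Y))"
  using assms
proof cases
  case (scale_row i A u es)
  have u: "u \<noteq> 0" using scale_row by auto
  define m n where "m = dim_row A" and "n = dim_col A"
  have A: "A \<in> carrier_mat m n" and i: "i < m" using scale_row unfolding m_def n_def by auto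
  note e = multrow_mat[OF A, of i]
  have inv: "A = multrow_mat m i (inverse u) * multrow i u A"
  proof -
    have "multrow_mat m i (inverse u) * multrow i u A = multrow i (inverse u) (multrow i u A)"
      by (rule multrow_mat[symmetric]) (use A in simp)
    also have "\<dots> = A"
    proof (rule eq_matI)
      have "inverse u * (u * x) = x" for x using u by simp
      then show "multrow i (inverse u) (multrow i u A) $$ (k, l) = A $$ (k, l)"
        if "k < dim_row A" "l < dim_col A" for k l using that by simp
    qed simp_all
    finally show ?thesis by (rule sym)
  qed
  have "multrow i u A \<in> carrier_mat m n" using A by simp
  then have "Jac (multrow i u A) = Jac A"
    by (rule Jac_row_operation[OF A _ multrow_mat_carrier e multrow_mat_carrier inv])
  then show ?thesis using scale_row by (simp add: module_isomorphic_refl)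
next
  case (scale_col j A u es)
  define n where "n = dim_col A"
  have A: "A \<in> carrier_mat (dim_row A) n" and j: "j < n" using scale_col unfolding n_def by auto
  let ?Q = "multrow_mat n j u"
  have Q: "?Q \<in> eis_mats n n" using eis_ints_sixth_root scale_col by simp
  \<comment> \<open>For a sixth root of unity the conjugate is the inverse, so scaling a column by
    it is unitary.\<close>
  have cT: "(map_mat cnj ?Q)\<^sup>T = multrow_mat n j (cnj u)" by (intro eq_matI) auto
  have "?Q * (map_mat cnj ?Q)\<^sup>T = 1\<^sub>m n"
  proof -
    have "?Q * multrow_mat n j (cnj u) = multrow j u (multrow_mat n j (cnj u))"
      by (rule multrow_mat[symmetric, of _ n n]) simp
    also have "\<dots> = 1\<^sub>m n" using sixth_root_cnj[OF \<open>u ^ 6 = 1\<close>] by (intro eq_matI) auto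
    finally show ?thesis unfolding cT .
  qed
  from Jac_column_operation[OF A Q this] show ?thesis
    using scale_col multcol_mat[OF A, of j u] by simp
next
  case (swap_rows i A k es)
  define m n where "m = dim_row A" and "n = dim_col A"
  have A: "A \<in> carrier_mat m n" and ik: "i < m" "k < m" using swap_rows unfolding m_def n_def by auto
  have inv: "A = swaprows_mat m i k * swaprows i k A"
  proof -
    have "swaprows_mat m i k * swaprows i k A = swaprows i k (swaprows i k A)"
      using swaprows_mat[of "swaprows i k A" m n i k] A ik by simp
    also have "\<dots> = A" using A ik by (intro eq_matI) auto
    finally show ?thesis by simp
  qed
  have "swaprows i k A \<in> carrier_mat m n" using A by simp
  then have "Jac (swaprows i k A) = Jac A"
    by (rule Jac_row_operation[OF A _ swaprows_mat_carrier swaprows_mat[OF A ik] swaprows_mat_carrier inv])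
  then show ?thesis using swap_rows by (simp add: module_isomorphic_refl)
next
  case (swap_cols j A k es)
  define n where "n = dim_col A"
  have A: "A \<in> carrier_mat (dim_row A) n" and jk: "j < n" "k < n" using swap_cols unfolding n_def by auto
  let ?Q = "swaprows_mat n j k :: complex mat"
  have "(map_mat cnj ?Q)\<^sup>T = ?Q" by (intro eq_matI) auto
  then have "?Q * (map_mat cnj ?Q)\<^sup>T = 1\<^sub>m n" using swaprows_mat_inv[OF jk] by simp
  from Jac_column_operation[OF A eis_mats_swaprows_mat this] show ?thesis
    using swap_cols swapcols_mat[OF A jk] by simp
next
  case (pivoting s A t es)
  define m n where "m = dim_row A" and "n = dim_col A"
  have A: "A \<in> carrier_mat m n" and st: "s < m" "t < n" "A $$ (s, t) \<noteq> 0"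
    using pivoting unfolding m_def n_def by auto
  have A': "pivot s t A \<in> carrier_mat m n" unfolding pivot_def using A by auto
  \<comment> \<open>P agrees with the identity outside column s and performs the pivot; its inverse
    Q restores column t of A, which the pivot turned into the s-th unit vector.\<close>
  define P where "P = mat m m (\<lambda>(i, j). if j = s then if i = s then 1 / A $$ (s, t) else - A $$ (i, t) / A $$ (s, t)
    else if i = j then 1 else 0)"
  define Q where "Q = mat m m (\<lambda>(i, j). if j = s then A $$ (i, t) else if i = j then 1 else 0)"
  \<comment> \<open>In row i of P and of Q only columns s and i can be nonzero, so the product sums
    have at most two terms.\<close>
  have split: "(\<Sum>l\<in>{0..<m}. g l) = g s + (if i = s then 0 else g i)"
    if "i < m" "\<And>l. l < m \<Longrightarrow> l \<noteq> s \<Longrightarrow> l \<noteq> i \<Longrightarrow> g l = 0" for g :: "nat \<Rightarrow> complex" and i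
  proof -
    have "(\<Sum>l\<in>{0..<m}. g l) = (\<Sum>l\<in>{s, i}. g l)"
      using that st by (intro sum.mono_neutral_right) auto
    then show ?thesis by (simp add: insert_commute)
  qed
  have P: "P \<in> carrier_mat m m" and Q: "Q \<in> carrier_mat m m" unfolding P_def Q_def by auto
  have "pivot s t A = P * A"
  proof (rule eq_matI)
    fix i j assume "i < dim_row (P * A)" "j < dim_col (P * A)"
    then have ij: "i < m" "j < n" using P A by auto
    have "(P * A) $$ (i, j) = (\<Sum>l\<in>{0..<m}. P $$ (i, l) * A $$ (l, j))"
      using ij P A by (simp add: scalar_prod_def)
    also have "\<dots> = P $$ (i, s) * A $$ (s, j) + (if i = s then 0 else P $$ (i, i) * A $$ (i, j))"
      by (rule split) (use ij in \<open>auto simp: P_def\<close>)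
    finally show "pivot s t A $$ (i, j) = (P * A) $$ (i, j)"
      using ij st A unfolding pivot_def P_def by auto
  qed (use A' P A in auto)
  moreover have "A = Q * pivot s t A"
  proof (rule eq_matI)
    fix i j assume "i < dim_row (Q * pivot s t A)" "j < dim_col (Q * pivot s t A)"
    then have ij: "i < m" "j < n" using Q A' by auto
    have "(Q * pivot s t A) $$ (i, j) = (\<Sum>l\<in>{0..<m}. Q $$ (i, l) * pivot s t A $$ (l, j))"
      using ij Q A' by (simp add: scalar_prod_def)
    also have "\<dots> = Q $$ (i, s) * pivot s t A $$ (s, j) + (if i = s then 0 else Q $$ (i, i) * pivot s t A $$ (i, j))"
      by (rule split) (use ij in \<open>auto simp: Q_def\<close>)
    finally show "A $$ (i, j) = (Q * pivot s t A) $$ (i, j)"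
      using ij st A unfolding pivot_def Q_def by auto
  qed (use A' Q A in auto)
  ultimately have "Jac (pivot s t A) = Jac A" by (rule Jac_row_operation[OF A A' P _ Q])
  then show ?thesis using pivoting by (simp add: module_isomorphic_refl)
qed

lemma Jac_H_equivalent:
  assumes "H_equivalent X Y"
  shows "module_isomorphic eis_ring (Jac (fst X)) (Jac (fst Y))"
  using assms unfolding H_equivalent_def
proof (induction rule: equivclp_induct)
  case base
  show ?case by (rule module_isomorphic_refl)
next
  case (step Y Z)
  then have "elementary_move Y Z \<or> elementary_move Z Y" by blast
  then have "module_isomorphic eis_ring (Jac (fst Y)) (Jac (fst Z))"
    using Jac_elementary_move[of Y Z] Jac_iso_sym[OF Jac_elementary_move[of Z Y]] by blast
  with step.IH show ?case by (rule module_isomorphic_trans)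
qed

section \<open>Representations of matroids\<close>

lemma sixth_roots_0_eis_ints: "x \<in> sixth_roots_0 \<Longrightarrow> x \<in> eis_ints"
  unfolding sixth_roots_0_def using eis_ints_sixth_root by auto

text \<open>Entries are the minors of size 1, and sixth roots of unity lie in Z[omega].\<close>

lemma H_matrix_eis_mats:
  assumes H: "H_matrix M" and M: "M \<in> carrier_mat m n"
  shows "M \<in> eis_mats m n"
proof (rule eis_matsI[OF M])
  fix i j assume ij: "i < m" "j < n"
  then have sub: "{i} \<subseteq> {..<m}" "{j} \<subseteq> {..<n}" by auto
  have pick: "pick {l} 0 = l" for l using pick_in_set_le[of 0 "{l}"] by simp
  have "det (submatrix M {i} {j}) = M $$ (i, j)"
    using index_submatrix(1)[OF M sub] index_submatrix(2)[OF M sub, of 0 0] by (simp add: det_single pick del: pick.simps)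
  moreover have "det (submatrix M {i} {j}) \<in> sixth_roots_0"
    using H sub M unfolding H_matrix_def by (metis carrier_matD card_1_singleton_iff is_singletonI is_singleton_altdef)
  ultimately show "M $$ (i, j) \<in> eis_ints" using sixth_roots_0_eis_ints by metis
qed

lemma eis_mats_adj_mat:
  assumes A: "A \<in> eis_mats n n"
  shows "adj_mat A \<in> eis_mats n n"
proof (rule eis_matsI)
  note c = eis_mats_carrier[OF A]
  show "adj_mat A \<in> carrier_mat n n" by (rule adj_mat(1)[OF c])
  fix i j assume ij: "i < n" "j < n"
  have "mat_delete A j i \<in> eis_mats (n - 1) (n - 1)"
  proof (rule eis_matsI)
    show "mat_delete A j i \<in> carrier_mat (n - 1) (n - 1)" by (rule mat_delete_carrier[OF c])
    fix k l assume "k < n - 1" "l < n - 1"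
    then show "mat_delete A j i $$ (k, l) \<in> eis_ints"
      using c eis_matsD[OF A] unfolding mat_delete_def by auto
  qed
  then have "det (mat_delete A j i) \<in> eis_ints" by (rule eis_ints_det)
  then show "adj_mat A $$ (i, j) \<in> eis_ints"
    using ij c unfolding adj_mat_def cofactor_def by simp
qed

lemma selection_mat_cancel_mat:
  assumes J: "J \<subseteq> {..<n}" and A: "A \<in> carrier_mat m n"
    and supp: "\<And>i j. i < m \<Longrightarrow> j < n \<Longrightarrow> j \<notin> J \<Longrightarrow> A $$ (i, j) = 0"
  shows "A * (selection_mat n J)\<^sup>T * selection_mat n J = (A :: 'a :: comm_ring_1 mat)"
proof -
  define S :: "'a mat" where "S = selection_mat n J"
  have S: "S \<in> carrier_mat (card J) n" unfolding S_def by simp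
  have "S\<^sup>T * (S * A\<^sup>T) = A\<^sup>T"
  proof (rule mat_col_eqI)
    fix i assume "i < dim_col A\<^sup>T"
    then have i: "i < m" using A by simp
    have "col (S\<^sup>T * (S * A\<^sup>T)) i = S\<^sup>T *\<^sub>v (S *\<^sub>v col A\<^sup>T i)"
    proof -
      have "S * A\<^sup>T \<in> carrier_mat (card J) m" using A S by simp
      then have "col (S\<^sup>T * (S * A\<^sup>T)) i = S\<^sup>T *\<^sub>v col (S * A\<^sup>T) i"
        using S i by (intro col_mult2) auto
      also have "col (S * A\<^sup>T) i = S *\<^sub>v col A\<^sup>T i"
        using A S i by (intro col_mult2) auto
      finally show ?thesis .
    qed
    also have "\<dots> = col A\<^sup>T i"
      unfolding S_def using i A supp by (intro selection_mat_transpose_cancel[OF J]) auto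
    finally show "col (S\<^sup>T * (S * A\<^sup>T)) i = col A\<^sup>T i" .
  qed (use A S in auto)
  from arg_cong[OF this, of transpose_mat] have "(S * A\<^sup>T)\<^sup>T * S = A"
    using A S by (simp add: transpose_mult[of _ n "card J" _ m])
  then show ?thesis
    using A S unfolding S_def[symmetric] by (simp add: transpose_mult[of _ "card J" n _ m])
qed

text \<open>The labelling is injective, so independent sets and independent sets of column indices
  have the same sizes. The rank is thus the largest size of an independent set of columns in any
  representation.\<close>

lemma matroid_rank_bound:
  assumes mat: "matroid E indep" and rep: "represents (M, es) E indep" and n: "dim_col M = n"
  shows "J \<subseteq> {..<n} \<Longrightarrow> columns_lin_indpt M J \<Longrightarrow> card J \<le> matroid_rank indep"
    and "\<exists>J\<subseteq>{..<n}. columns_lin_indpt M J \<and> card J = matroid_rank indep"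
proof -
  interpret matroid E indep by fact
  have es: "distinct es" "set es = E" "length es = n"
    and iff: "\<And>J. J \<subseteq> {..<n} \<Longrightarrow> indep ((!) es ` J) \<longleftrightarrow> columns_lin_indpt M J"
    using rep n unfolding represents_def by auto
  have "{X. indep X} \<subseteq> Pow E" using indep_subset_ground by auto
  then have fin: "finite (card ` {X. indep X})" using finite_ground finite_subset by blast
  have inj: "inj_on ((!) es) {..<n}" using es by (auto simp: inj_on_nth)
  have card: "card ((!) es ` J) = card J" if "J \<subseteq> {..<n}" for J
    by (rule card_image[OF inj_on_subset[OF inj that]])
  show "card J \<le> matroid_rank indep" if J: "J \<subseteq> {..<n}" "columns_lin_indpt M J"
    unfolding matroid_rank_def using J iff card[OF J(1)] by (intro Max_ge[OF fin]) (metis image_eqI mem_Collect_eq)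
  have "matroid_rank indep \<in> card ` {X. indep X}"
    unfolding matroid_rank_def using fin indep_empty by (intro Max_in) auto
  then obtain X where X: "indep X" "matroid_rank indep = card X" by auto
  define J where "J = {j. j < n \<and> es ! j \<in> X}"
  have J: "J \<subseteq> {..<n}" unfolding J_def by auto
  have "X \<subseteq> set es" using indep_subset_ground X(1) es(2) by simp
  then have "(!) es ` J = X" unfolding J_def using es(3) by (auto simp: in_set_conv_nth subset_iff image_iff)
  then show "\<exists>J\<subseteq>{..<n}. columns_lin_indpt M J \<and> card J = matroid_rank indep"
    using iff[OF J] X card[OF J] J by auto
qed

text \<open>With as many rows as the rank, the columns of a basis form a square submatrix N; its
  nonzero determinant is a sixth root of unity, so N is invertible over Z[omega] by the adjugate
  formula.\<close>

lemma right_inverse_exists: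
  assumes mat: "matroid E indep" and rep: "H_representation (M, es) E indep"
    and M: "M \<in> carrier_mat (matroid_rank indep) n"
  obtains R where "R \<in> eis_mats n (matroid_rank indep)" and "M * R = 1\<^sub>m (matroid_rank indep)"
proof -
  let ?r = "matroid_rank indep"
  have H: "H_matrix M" and rep': "represents (M, es) E indep"
    using rep unfolding H_representation_def by auto
  obtain J where J: "J \<subseteq> {..<n}" "columns_lin_indpt M J" "card J = ?r"
    using matroid_rank_bound(2)[OF mat rep', of n] M by auto
  define S :: "complex mat" where "S = selection_mat n J"
  have S: "S \<in> eis_mats ?r n" using J(3) unfolding S_def selection_mat_def by (intro eis_matsI) auto
  note Sc = eis_mats_carrier[OF S]
  define N where "N = M * S\<^sup>T"
  have Nc: "N \<in> carrier_mat ?r ?r" unfolding N_def using M Sc by simp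
  have N: "N \<in> eis_mats ?r ?r"
    unfolding N_def by (rule eis_mats_mult[OF H_matrix_eis_mats[OF H M] eis_mats_transpose[OF S]])
  have "\<forall>v\<in>carrier_vec ?r. N *\<^sub>v v = 0\<^sub>v ?r \<longrightarrow> v = 0\<^sub>v ?r"
    using J(2) unfolding columns_lin_indpt_iff[OF M J(1)] supported_kernel_iff[OF M J(1)] J(3) N_def S_def .
  then have nz: "det N \<noteq> 0" using det_0_iff_vec_prod_zero_field[OF Nc] by blast
  have "N = submatrix M {..<?r} J" unfolding N_def S_def by (rule submatrix_cols_eq[OF M J(1), symmetric])
  then have "det N \<in> sixth_roots_0" using H J M unfolding H_matrix_def by simp
  then have "det N ^ 6 = 1" using nz unfolding sixth_roots_0_def by simp
  then have "inverse (det N) ^ 6 = 1" by (simp add: power_inverse)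
  then have u: "inverse (det N) \<in> eis_ints" by (rule eis_ints_sixth_root)
  \<comment> \<open>The inverse of N, extended by zero rows outside the basis J.\<close>
  define R where "R = S\<^sup>T * (inverse (det N) \<cdot>\<^sub>m adj_mat N)"
  note adj = adj_mat[OF Nc]
  have "inverse (det N) \<cdot>\<^sub>m adj_mat N \<in> eis_mats ?r ?r"
    using u adj(1) eis_matsD[OF eis_mats_adj_mat[OF N]] by (intro eis_matsI) auto
  then have "R \<in> eis_mats n ?r" unfolding R_def using S by (intro eis_mats_mult eis_mats_transpose)
  moreover have "M * R = 1\<^sub>m ?r"
  proof -
    have "M * R = N * (inverse (det N) \<cdot>\<^sub>m adj_mat N)"
      unfolding R_def N_def
      using M Sc adj(1) by (intro assoc_mult_mat[symmetric, of _ ?r n _ ?r _ ?r]) (auto simp: N_def)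
    also have "\<dots> = inverse (det N) \<cdot>\<^sub>m (det N \<cdot>\<^sub>m 1\<^sub>m ?r)"
      unfolding adj(2)[symmetric] by (rule mult_smult_distrib[OF Nc adj(1)])
    also have "\<dots> = 1\<^sub>m ?r" using nz by (intro eq_matI) auto
    finally show ?thesis .
  qed
  ultimately show thesis by (rule that)
qed

lemma mult_mat_vec_zero:
  fixes A :: "'a :: semiring_0 mat"
  shows "A \<in> carrier_mat m n \<Longrightarrow> A *\<^sub>v 0\<^sub>v n = 0\<^sub>v m"
  by (intro eq_vecI) auto

text \<open>Brings a representation with any number of rows to the size covered by
  \<open>uniquely_H_representable\<close>. The selected rows span the same row space and impose the
  same linear conditions on coefficient vectors, so Jacobian and matroid are unchanged.\<close>

lemma row_reduction:
  assumes mat: "matroid E indep" and rep: "H_representation (M, es) E indep" and n: "dim_col M = n"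
  obtains M' where "H_representation (M', es) E indep"
    and "M' \<in> carrier_mat (matroid_rank indep) n" and "Jac M' = Jac M"
proof -
  let ?r = "matroid_rank indep"
  define m where "m = dim_row M"
  have M: "M \<in> carrier_mat m n" using n unfolding m_def by auto
  have H: "H_matrix M" and rep': "represents (M, es) E indep"
    using rep unfolding H_representation_def by auto
  obtain I C where I: "I \<subseteq> {..<m}" and C: "C \<in> carrier_mat m m"
    "\<And>i j. i < m \<Longrightarrow> j < m \<Longrightarrow> j \<notin> I \<Longrightarrow> C $$ (i, j) = 0" "C * M = M"
    and I_indep: "\<And>y. y \<in> carrier_vec m \<Longrightarrow> (\<And>i. i < m \<Longrightarrow> i \<notin> I \<Longrightarrow> y $ i = 0) \<Longrightarrow>
      M\<^sup>T *\<^sub>v y = 0\<^sub>v n \<Longrightarrow> y = 0\<^sub>v m"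
    using row_basis_exists[OF M] by blast
  define S :: "complex mat" where "S = selection_mat m I"
  define k where "k = card I"
  define M' where "M' = S * M"
  have S: "S \<in> carrier_mat k m" unfolding S_def k_def by simp
  have M': "M' \<in> carrier_mat k n" unfolding M'_def using S M by simp
  have CS: "C * S\<^sup>T \<in> carrier_mat m k" using C S by simp
  have "C * S\<^sup>T * M' = C * S\<^sup>T * S * M"
    unfolding M'_def using S M CS by (simp add: assoc_mult_mat[of _ m k _ m _ n])
  also have "C * S\<^sup>T * S = C"
    unfolding S_def by (rule selection_mat_cancel_mat[OF I C(1)]) (rule C(2))
  also have "C * M = M" by (rule C(3))
  finally have lift_back: "M = C * S\<^sup>T * M'" by (rule sym)
  have "Jac M' = Jac M" by (rule Jac_row_operation[OF M M' S M'_def CS lift_back])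
  have ker: "M' *\<^sub>v v = 0\<^sub>v k \<longleftrightarrow> M *\<^sub>v v = 0\<^sub>v m" if v: "v \<in> carrier_vec n" for v
  proof
    assume "M' *\<^sub>v v = 0\<^sub>v k"
    then have "C * S\<^sup>T *\<^sub>v (M' *\<^sub>v v) = 0\<^sub>v m" using mult_mat_vec_zero[OF CS] by simp
    then show "M *\<^sub>v v = 0\<^sub>v m" using lift_back assoc_mult_mat_vec[OF CS M' v] by metis
  next
    assume "M *\<^sub>v v = 0\<^sub>v m"
    then have "S *\<^sub>v (M *\<^sub>v v) = 0\<^sub>v k" using mult_mat_vec_zero[OF S] by simp
    then show "M' *\<^sub>v v = 0\<^sub>v k" unfolding M'_def using assoc_mult_mat_vec[OF S M v] by metis
  qed
  have cols: "columns_lin_indpt M' J \<longleftrightarrow> columns_lin_indpt M J" if "J \<subseteq> {..<n}" for J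
    unfolding columns_lin_indpt_iff[OF M that] columns_lin_indpt_iff[OF M' that] using ker by blast
  have rep'': "represents (M', es) E indep"
    using rep' cols M M' unfolding represents_def by auto
  \<comment> \<open>Otherwise rank-many independent columns would live in a space of smaller
    dimension k.\<close>
  have "?r \<le> k"
  proof (rule ccontr)
    assume "\<not> ?r \<le> k"
    obtain J where J: "J \<subseteq> {..<n}" "columns_lin_indpt M' J" "card J = ?r"
      using matroid_rank_bound(2)[OF mat rep'', of n] M' by auto
    have "M' * (selection_mat n J)\<^sup>T \<in> carrier_mat k ?r"
      unfolding J(3)[symmetric] by (rule mult_carrier_mat[OF M']) simp
    then obtain v where "v \<in> carrier_vec ?r" "v \<noteq> 0\<^sub>v ?r" "M' * (selection_mat n J)\<^sup>T *\<^sub>v v = 0\<^sub>v k"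
      using wide_matrix_kernel[of _ k ?r] \<open>\<not> ?r \<le> k\<close> by (metis not_le)
    then show False
      using J(2) unfolding columns_lin_indpt_iff[OF M' J(1)] supported_kernel_iff[OF M' J(1)] J(3) by blast
  qed
  \<comment> \<open>Row rank is at most column rank: with fewer than k columns in a column basis J,
    some nontrivial combination w of the selected rows vanishes on J, hence everywhere,
    contradicting their independence.\<close>
  moreover have "k \<le> ?r"
  proof (rule ccontr)
    assume kr: "\<not> k \<le> ?r"
    have MT: "M\<^sup>T \<in> carrier_mat n m" using M by simp
    \<comment> \<open>A row basis of the transpose is a column basis of M; D recovers every column
      from those in J.\<close>
    obtain J D where J: "J \<subseteq> {..<n}" and D: "D \<in> carrier_mat n n"
      "\<And>i j. i < n \<Longrightarrow> j < n \<Longrightarrow> j \<notin> J \<Longrightarrow> D $$ (i, j) = 0" "D * M\<^sup>T = M\<^sup>T"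
      and J_indep: "\<And>y. y \<in> carrier_vec n \<Longrightarrow> (\<And>i. i < n \<Longrightarrow> i \<notin> J \<Longrightarrow> y $ i = 0) \<Longrightarrow>
        M *\<^sub>v y = 0\<^sub>v m \<Longrightarrow> y = 0\<^sub>v n"
      using row_basis_exists[OF MT] unfolding transpose_transpose by blast
    have "columns_lin_indpt M J" unfolding columns_lin_indpt_iff[OF M J] using J_indep by blast
    then have Jr: "card J \<le> ?r" using matroid_rank_bound(1)[OF mat rep' n J] by blast
    define T :: "complex mat" where "T = selection_mat n J"
    have T: "T \<in> carrier_mat (card J) n" unfolding T_def by simp
    have M'T: "M'\<^sup>T = M\<^sup>T * S\<^sup>T" unfolding M'_def by (rule transpose_mult[OF S M])
    have TM': "T * M'\<^sup>T \<in> carrier_mat (card J) k" using T M' by simp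
    obtain y where y: "y \<in> carrier_vec k" "y \<noteq> 0\<^sub>v k" "T * M'\<^sup>T *\<^sub>v y = 0\<^sub>v (card J)"
      using wide_matrix_kernel[OF TM'] kr Jr by (metis le_less_trans not_le)
    define w where "w = M'\<^sup>T *\<^sub>v y"
    have w: "w \<in> carrier_vec n" unfolding w_def using M' y by auto
    have Tw: "T *\<^sub>v w = 0\<^sub>v (card J)"
      using y(3) assoc_mult_mat_vec[OF T, of "M'\<^sup>T" k y] M' y(1) unfolding w_def by simp
    have DM': "D * M'\<^sup>T = M'\<^sup>T"
      unfolding M'T using assoc_mult_mat[OF D(1) MT, of "S\<^sup>T" k] S D(3) by simp
    have DTT: "D * T\<^sup>T * T = D"
      unfolding T_def by (rule selection_mat_cancel_mat[OF J D(1)]) (rule D(2))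
    \<comment> \<open>All coordinates of w are determined through D by those in J, and these are
      zero.\<close>
    have "w = D *\<^sub>v w"
      unfolding w_def using assoc_mult_mat_vec[OF D(1), of "M'\<^sup>T" k y] M' y(1) DM' by simp
    also have "\<dots> = D * T\<^sup>T * T *\<^sub>v w" unfolding DTT ..
    also have "\<dots> = D * T\<^sup>T *\<^sub>v (T *\<^sub>v w)" using D T w by (intro assoc_mult_mat_vec) auto
    also have "\<dots> = 0\<^sub>v n" unfolding Tw using D T by (intro mult_mat_vec_zero) auto
    finally have "w = 0\<^sub>v n" .
    moreover have "w = M\<^sup>T *\<^sub>v (S\<^sup>T *\<^sub>v y)"
      unfolding w_def M'T using MT S y(1) by (intro assoc_mult_mat_vec) auto
    moreover have yI: "y \<in> carrier_vec (card I)" using y(1) unfolding k_def .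
    moreover have "S\<^sup>T *\<^sub>v y \<in> carrier_vec m" using S y(1) by auto
    ultimately have z: "S\<^sup>T *\<^sub>v y = 0\<^sub>v m"
      using I_indep[of "S\<^sup>T *\<^sub>v y"] selection_mat_transpose_vec(2)[OF I yI] unfolding S_def by metis
    have "y = 0\<^sub>v k"
    proof (rule eq_vecI)
      fix l assume "l < dim_vec (0\<^sub>v k :: complex vec)"
      then have l: "l < card I" unfolding k_def by simp
      have "y $ l = (S\<^sup>T *\<^sub>v y) $ pick I l"
        unfolding S_def by (rule selection_mat_transpose_vec(1)[OF I yI l, symmetric])
      then show "y $ l = 0\<^sub>v k $ l" unfolding z using pick_less[OF I l] l k_def by simp
    qed (use y in simp)
    then show False using y(2) by simp
  qed
  ultimately have "k = ?r" by simp
  moreover have "H_matrix M'"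
    using H_matrix_rows[OF H M I] unfolding submatrix_rows_eq[OF M I] M'_def S_def .
  ultimately show thesis
    using that[of M'] rep'' M' \<open>Jac M' = Jac M\<close> unfolding H_representation_def by simp
qed

section \<open>Invariant factors of the Hermitian matrix M M^H\<close>

lemma mat_adjoint_eq: "mat_adjoint (M :: complex mat) = (map_mat cnj M)\<^sup>T"
  unfolding mat_adjoint_def mat_of_rows_def by (intro eq_matI) auto

lemma eis_divides_chain:
  assumes step: "\<And>i. Suc i < r \<Longrightarrow> \<alpha>s ! i divides\<^bsub>eis_ring\<^esub> \<alpha>s ! Suc i"
    and jk: "j \<le> k" "k < r"
  shows "\<exists>c\<in>eis_ints. \<alpha>s ! k = \<alpha>s ! j * c"
  using jk
proof (induction k rule: dec_induct)
  case base
  show ?case by (intro bexI[of _ 1]) auto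
next
  case (step i)
  then obtain c where "c \<in> eis_ints" "\<alpha>s ! i = \<alpha>s ! j * c" by auto
  moreover obtain d where "d \<in> eis_ints" "\<alpha>s ! Suc i = \<alpha>s ! i * d"
    using assms(1)[of i] step.prems unfolding factor_def by auto
  ultimately show ?case by (intro bexI[of _ "c * d"]) (auto simp: mult.assoc)
qed

text \<open>A Hermitian matrix equals its conjugate transpose, so by uniqueness each invariant factor is
  associated to its conjugate; the units of the Eisenstein integers have sixth power 1, so the sixth
  power of an invariant factor is real.\<close>

lemma hermitian_smith_diagonal_power6:
  assumes A: "A \<in> eis_mats r r" and herm: "(map_mat cnj A)\<^sup>T = A" and det: "det A \<noteq> 0"
    and smith: "eis_smith_diagonal A \<alpha>s" and k: "k < r"
  shows "(\<alpha>s ! k) ^ 6 \<in> \<int> - {0}"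
proof -
  note Ac = eis_mats_carrier[OF A]
  define D where "D = mat r r (\<lambda>(i, j). if i = j then \<alpha>s ! i else 0)"
  obtain S T where len: "length \<alpha>s = r" and \<alpha>: "set \<alpha>s \<subseteq> eis_ints"
    and dvd: "\<And>i. Suc i < r \<Longrightarrow> \<alpha>s ! i divides\<^bsub>eis_ring\<^esub> \<alpha>s ! Suc i"
    and S: "eis_invertible r S" and T: "eis_invertible r T" and SAT: "S * A * T = D"
    using smith Ac unfolding eis_smith_diagonal_def D_def by auto
  obtain S' where S': "S' \<in> eis_mats r r" "S * S' = 1\<^sub>m r" "S' * S = 1\<^sub>m r"
    using eis_invertibleE[OF S] by blast
  have S'inv: "eis_invertible r S'" using S' eis_invertible_mats[OF S] by (intro eis_invertibleI)
  obtain T' where T': "T' \<in> eis_mats r r" "T * T' = 1\<^sub>m r" "T' * T = 1\<^sub>m r"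
    using eis_invertibleE[OF T] by blast
  have T'inv: "eis_invertible r T'" using T' eis_invertible_mats[OF T] by (intro eis_invertibleI)
  define Sh where "Sh = (map_mat cnj S)\<^sup>T"
  define Th where "Th = (map_mat cnj T)\<^sup>T"
  define Sh' where "Sh' = (map_mat cnj S')\<^sup>T"
  have Sh: "eis_invertible r Sh" unfolding Sh_def by (intro eis_invertible_transpose eis_invertible_cnj S)
  have Th: "eis_invertible r Th" unfolding Th_def by (intro eis_invertible_transpose eis_invertible_cnj T)
  have Sh': "eis_invertible r Sh'" unfolding Sh'_def by (intro eis_invertible_transpose eis_invertible_cnj S'inv)
  note c = Ac eis_mats_carrier[OF S'(1)] eis_mats_carrier[OF T'(1)]
    eis_invertible_mats[OF S, THEN eis_mats_carrier] eis_invertible_mats[OF T, THEN eis_mats_carrier]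
    eis_invertible_mats[OF Sh, THEN eis_mats_carrier] eis_invertible_mats[OF Th, THEN eis_mats_carrier]
    eis_invertible_mats[OF Sh', THEN eis_mats_carrier]
  have D: "D \<in> carrier_mat r r" unfolding D_def by simp
  have cnjD: "(map_mat cnj D)\<^sup>T = Th * A * Sh"
  proof -
    have "(map_mat cnj D)\<^sup>T = (map_mat cnj S * map_mat cnj A * map_mat cnj T)\<^sup>T"
      unfolding SAT[symmetric] using c by (simp add: map_mat_cnj_mult[of _ r r _ r])
    also have "\<dots> = Th * ((map_mat cnj A)\<^sup>T * Sh)"
      unfolding Sh_def Th_def using c by (simp add: transpose_mult[of _ r r _ r])
    also have "\<dots> = Th * A * Sh" unfolding herm using c by (simp add: assoc_mult_mat[of _ r r _ r _ r])
    finally show ?thesis .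
  qed
  have ShSh': "Sh * Sh' = 1\<^sub>m r"
  proof -
    have "Sh * Sh' = (map_mat cnj (S' * S))\<^sup>T"
      unfolding Sh_def Sh'_def using c by (simp add: map_mat_cnj_mult[of _ r r _ r] transpose_mult[of _ r r _ r])
    then show ?thesis unfolding S' by simp
  qed
  define P where "P = Th * S'"
  define Q where "Q = Sh' * T"
  have P: "eis_invertible r P" unfolding P_def by (rule eis_invertible_mult[OF Th S'inv])
  have Q: "Q \<in> eis_mats r r"
    unfolding Q_def by (rule eis_mats_mult[OF eis_invertible_mats[OF Sh'] eis_invertible_mats[OF T]])
  \<comment> \<open>Both sides are T^H A T: on the left S^-1 S cancels, on the right S^H and its
    inverse. This compares the diagonal forms of A and of A^H = A.\<close>
  have PD: "P * D = (map_mat cnj D)\<^sup>T * Q"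
  proof -
    have "P * D = Th * (S' * S) * A * T"
      unfolding P_def SAT[symmetric] using c by (simp add: assoc_mult_mat[of _ r r _ r _ r])
    also have "\<dots> = Th * A * (Sh * Sh') * T" unfolding S' ShSh' using c by simp
    also have "\<dots> = (map_mat cnj D)\<^sup>T * Q"
      unfolding cnjD Q_def using c by (simp add: assoc_mult_mat[of _ r r _ r _ r])
    finally show ?thesis .
  qed
  have Pc: "P \<in> carrier_mat r r" by (rule eis_mats_carrier[OF eis_invertible_mats[OF P]])
  note Qc = eis_mats_carrier[OF Q]
  have entry: "P $$ (i, j) * \<alpha>s ! j = cnj (\<alpha>s ! i) * Q $$ (i, j)" if ij: "i < r" "j < r" for i j
  proof -
    have "(P * D) $$ (i, j) = (\<Sum>l\<in>{0..<r}. P $$ (i, l) * (if l = j then \<alpha>s ! l else 0))"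
      using ij Pc unfolding D_def by (simp add: scalar_prod_def)
    also have "\<dots> = (\<Sum>l\<in>{j}. P $$ (i, l) * (if l = j then \<alpha>s ! l else 0))"
      using ij by (intro sum.mono_neutral_right) auto
    finally have 1: "(P * D) $$ (i, j) = P $$ (i, j) * \<alpha>s ! j" by simp
    have "((map_mat cnj D)\<^sup>T * Q) $$ (i, j) = (\<Sum>l\<in>{0..<r}. (if l = i then cnj (\<alpha>s ! l) else 0) * Q $$ (l, j))"
      using ij Qc unfolding D_def by (auto simp: scalar_prod_def intro!: sum.cong)
    also have "\<dots> = (\<Sum>l\<in>{i}. (if l = i then cnj (\<alpha>s ! l) else 0) * Q $$ (l, j))"
      using ij by (intro sum.mono_neutral_right) auto
    finally show ?thesis using 1 PD by simp
  qed
  have chain: "\<exists>c\<in>eis_ints. \<alpha>s ! l = \<alpha>s ! j * c" if "j \<le> l" "l < r" for j l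
    using eis_divides_chain[OF dvd that] .
  have chain': "\<exists>c\<in>eis_ints. cnj (\<alpha>s ! l) = cnj (\<alpha>s ! j) * c" if jl: "j \<le> l" "l < r" for j l
  proof -
    obtain c where "c \<in> eis_ints" "\<alpha>s ! l = \<alpha>s ! j * c" using chain[OF jl] by blast
    then show ?thesis by (intro bexI[of _ "cnj c"]) auto
  qed
  \<comment> \<open>One divisibility is enough: a number and its conjugate have equal norm and det P
    has norm 1, so the quotient q is a unit.\<close>
  obtain q where q: "q \<in> eis_ints" "det P * \<alpha>s ! k = cnj (\<alpha>s ! k) * q"
    using smith_diagonal_divides[OF eis_invertible_mats[OF P] Q entry chain chain' k] by blast
  have \<alpha>k: "\<alpha>s ! k \<in> eis_ints" using \<alpha> len k nth_mem by blast
  have nz: "\<alpha>s ! k \<noteq> 0"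
  proof
    assume 0: "\<alpha>s ! k = 0"
    have "det D = det S * det A * det T"
      unfolding SAT[symmetric] using c by (simp add: det_mult[of _ r])
    moreover have "det S \<noteq> 0" "det T \<noteq> 0" using eis_invertible_det(2)[OF S] eis_invertible_det(2)[OF T] by auto
    ultimately have "det D \<noteq> 0" using det by simp
    moreover have "D *\<^sub>v unit_vec r k = 0\<^sub>v r"
      using k 0 unfolding D_def by (intro eq_vecI) auto
    moreover have "unit_vec r k \<noteq> (0\<^sub>v r :: complex vec)"
      using k by (metis index_unit_vec(1) index_zero_vec(1) zero_neq_one)
    ultimately show False using det_0_iff_vec_prod_zero_field[OF D] by (metis unit_vec_carrier)
  qed
  have "norm (det P) * norm (\<alpha>s ! k) = norm (\<alpha>s ! k) * norm q"
    using arg_cong[OF q(2), of norm] by (simp add: norm_mult)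
  then have "norm q = 1" using eis_invertible_det(2)[OF P] nz by simp
  then have q6: "q ^ 6 = 1" by (rule eis_unit_power6[OF q(1)])
  have p6: "det P ^ 6 = 1" by (rule eis_unit_power6[OF eis_invertible_det[OF P]])
  \<comment> \<open>Both units disappear in the sixth power, leaving a number fixed by
    conjugation.\<close>
  have "(det P * \<alpha>s ! k) ^ 6 = (cnj (\<alpha>s ! k) * q) ^ 6" using q(2) by simp
  then have "cnj ((\<alpha>s ! k) ^ 6) = (\<alpha>s ! k) ^ 6" by (simp add: power_mult_distrib q6 p6)
  then show ?thesis using eis_ints_real[of "(\<alpha>s ! k) ^ 6"] \<alpha>k nz by simp
qed

text \<open>If M M^H v = 0, then w = M^H v satisfies M w = 0, so its squared length is the product
  of M w with v, namely 0, and w = 0. The conjugate transpose of R is a left inverse of M^H and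
  gives v = 0.\<close>

lemma det_gram_nonzero:
  assumes M: "M \<in> carrier_mat r n" and R: "R \<in> carrier_mat n r" and MR: "M * R = 1\<^sub>m r"
  shows "det (M * (map_mat cnj M)\<^sup>T) \<noteq> 0"
proof
  define C where "C = map_mat cnj M"
  have C: "C \<in> carrier_mat r n" unfolding C_def using M by simp
  assume "det (M * (map_mat cnj M)\<^sup>T) = 0"
  then obtain v where v: "v \<in> carrier_vec r" "v \<noteq> 0\<^sub>v r" "M * C\<^sup>T *\<^sub>v v = 0\<^sub>v r"
    using det_0_iff_vec_prod_zero_field[of "M * C\<^sup>T" r] M C unfolding C_def by auto
  define w where "w = C\<^sup>T *\<^sub>v v"
  have w: "w \<in> carrier_vec n" unfolding w_def using C v by auto
  have Mw: "M *\<^sub>v w = 0\<^sub>v r"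
    using v assoc_mult_mat_vec[OF M, of "C\<^sup>T" r v] C unfolding w_def by simp
  have "w \<bullet>c w = (map_mat cnj C *\<^sub>v w) \<bullet>c v"
    using cscalar_prod_transpose[OF C w v(1)] unfolding w_def by simp
  also have "\<dots> = 0" using Mw v(1) unfolding C_def by simp
  finally have w0: "w = 0\<^sub>v n" using conjugate_square_eq_0_vec[OF w] by blast
  define K where "K = map_mat cnj R"
  have K: "K \<in> carrier_mat n r" unfolding K_def using R by simp
  have "C * K = 1\<^sub>m r" unfolding C_def K_def map_mat_cnj_mult[OF M R, symmetric] MR by simp
  then have "K\<^sup>T * C\<^sup>T = 1\<^sub>m r" using transpose_mult[OF C K] by simp
  then have "v = K\<^sup>T *\<^sub>v w"
    unfolding w_def using assoc_mult_mat_vec[of "K\<^sup>T" r n "C\<^sup>T" r v] C K v(1) by simp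
  then have "v = 0\<^sub>v r" using w0 mult_mat_vec_zero[of "K\<^sup>T" r n] K by simp
  then show False using v(2) by simp
qed

theorem theorem3p12:
  fixes E :: "'a set" and indep :: "'a set \<Rightarrow> bool" and r n :: nat
  assumes "sixth_root_matroid E indep"
    and "matroid_rank indep = r"
    and "card E = n"
    and "uniquely_H_representable E indep"
  shows "(\<forall>M\<^sub>1 es\<^sub>1 M\<^sub>2 es\<^sub>2.
            H_representation (M\<^sub>1, es\<^sub>1) E indep \<longrightarrow> H_representation (M\<^sub>2, es\<^sub>2) E indep \<longrightarrow>
            module_isomorphic eis_ring (Jac M\<^sub>1) (Jac M\<^sub>2)) \<and>
         (\<forall>M es \<alpha>s.
            H_representation (M, es) E indep \<longrightarrow> M \<in> carrier_mat r n \<longrightarrow>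
            eis_smith_diagonal (M * mat_adjoint M) \<alpha>s \<longrightarrow>
              (\<forall>M' es'. H_representation (M', es') E indep \<longrightarrow>
                 module_isomorphic eis_ring (Jac M')
                   (finite_direct_sum {..<r} (\<lambda>i. cyclic_module eis_ring (\<alpha>s ! i)))) \<and>
              (\<forall>i<r. (\<alpha>s ! i) ^ 6 \<in> \<int> - {0}))"
proof -
  have mat: "matroid E indep" using assms(1) unfolding sixth_root_matroid_def by simp
  have well_defined: "module_isomorphic eis_ring (Jac M1) (Jac M2)"
    if rep1: "H_representation (M1, es1) E indep" and rep2: "H_representation (M2, es2) E indep"
    for M1 es1 M2 es2
  proof -
    have dim: "dim_col M = n" if "H_representation (M, es) E indep" for M es
      using that assms(3) distinct_card[of es] unfolding H_representation_def represents_def by auto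
    obtain N1 where N1: "H_representation (N1, es1) E indep" "N1 \<in> carrier_mat r n" "Jac N1 = Jac M1"
      using row_reduction[OF mat rep1 dim[OF rep1]] assms(2) by metis
    obtain N2 where N2: "H_representation (N2, es2) E indep" "N2 \<in> carrier_mat r n" "Jac N2 = Jac M2"
      using row_reduction[OF mat rep2 dim[OF rep2]] assms(2) by metis
    have H: "N2 \<in> eis_mats r n"
      using H_matrix_eis_mats[OF _ N2(2)] N2(1) unfolding H_representation_def by simp
    obtain R where "R \<in> eis_mats n r" "N2 * R = 1\<^sub>m r"
      using right_inverse_exists[OF mat N2(1)] N2(2) assms(2) by metis
    \<comment> \<open>Absorbs the second alternative in the definition of unique representability,
      where equivalence holds only after conjugation.\<close>
    then have cnj: "module_isomorphic eis_ring (Jac (map_mat cnj N2)) (Jac N2)"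
      using Jac_iso_sym[OF Jac_iso_cnj[OF H]] by blast
    have "H_equivalent (N1, es1) (N2, es2) \<or> H_equivalent (N1, es1) (map_mat cnj N2, es2)"
      using assms(2-4) N1(1,2) N2(1,2) unfolding uniquely_H_representable_def by blast
    then have "module_isomorphic eis_ring (Jac N1) (Jac N2)"
      using Jac_H_equivalent[of "(N1, es1)" "(N2, es2)"]
        Jac_H_equivalent[of "(N1, es1)" "(map_mat cnj N2, es2)"] module_isomorphic_trans[OF _ cnj]
      by auto
    then show ?thesis using N1(3) N2(3) by simp
  qed
  have structure_thm: "module_isomorphic eis_ring (Jac M)
        (finite_direct_sum {..<r} (\<lambda>i. cyclic_module eis_ring (\<alpha>s ! i))) \<and>
      (\<forall>i<r. (\<alpha>s ! i) ^ 6 \<in> \<int> - {0})"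
    if rep: "H_representation (M, es) E indep" and Mc: "M \<in> carrier_mat r n"
      and smith: "eis_smith_diagonal (M * mat_adjoint M) \<alpha>s" for M es \<alpha>s
  proof -
    have M: "M \<in> eis_mats r n"
      using H_matrix_eis_mats[OF _ Mc] rep unfolding H_representation_def by simp
    obtain R where R: "R \<in> eis_mats n r" "M * R = 1\<^sub>m r"
      using right_inverse_exists[OF mat rep] Mc assms(2) by metis
    define A where "A = M * (map_mat cnj M)\<^sup>T"
    have A: "A \<in> eis_mats r r"
      unfolding A_def by (rule eis_mats_mult[OF M eis_mats_transpose[OF eis_mats_cnj[OF M]]])
    have AT: "A\<^sup>T = map_mat cnj M * M\<^sup>T"
      unfolding A_def using Mc by (simp add: transpose_mult[of _ r n _ r])
    have "map_mat cnj A = map_mat cnj M * M\<^sup>T"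
      unfolding A_def using Mc by (simp add: map_mat_cnj_mult[of _ r n _ r] map_mat_transpose)
    then have herm: "(map_mat cnj A)\<^sup>T = A" using AT by (metis transpose_transpose)
    have smith': "eis_smith_diagonal A \<alpha>s" using smith unfolding A_def mat_adjoint_eq .
    have det: "det A \<noteq> 0" unfolding A_def by (rule det_gram_nonzero[OF Mc eis_mats_carrier[OF R(1)] R(2)])
    define D where "D = mat r r (\<lambda>(i, j). if i = j then \<alpha>s ! i else 0)"
    have len: "length \<alpha>s = r" and \<alpha>: "set \<alpha>s \<subseteq> eis_ints" and AD: "eis_equivalent r A D"
      using smith' eis_mats_carrier[OF A] unfolding eis_smith_diagonal_def eis_equivalent_def D_def by auto
    \<comment> \<open>The Jacobian is the cokernel of \<open>A\<^sup>T\<close> while the Smith form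
      is given for A; a symmetric diagonal form serves both.\<close>
    have "D\<^sup>T = D" unfolding D_def by (intro eq_matI) auto
    then have "eis_equivalent r A\<^sup>T D" using eis_equivalent_transpose[OF AD A] by simp
    then have "module_isomorphic eis_ring (eis_cokernel r A\<^sup>T) (eis_cokernel r D)"
      by (rule eis_cokernel_equivalent[OF _ eis_mats_transpose[OF A]])
    moreover have "module_isomorphic eis_ring (Jac M) (eis_cokernel r A\<^sup>T)"
      unfolding AT by (rule Jac_iso_cokernel[OF M R])
    ultimately have "module_isomorphic eis_ring (Jac M) (eis_cokernel r D)"
      by (metis module_isomorphic_trans)
    then have "module_isomorphic eis_ring (Jac M)
        (finite_direct_sum {..<r} (\<lambda>i. cyclic_module eis_ring (\<alpha>s ! i)))"
      using eis_cokernel_diagonal[OF len \<alpha>] unfolding D_def by (rule module_isomorphic_trans)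
    then show ?thesis using hermitian_smith_diagonal_power6[OF A herm det smith'] by blast
  qed
  show ?thesis
  proof (intro conjI allI impI)
    show "module_isomorphic eis_ring (Jac M1) (Jac M2)"
      if "H_representation (M1, es1) E indep" "H_representation (M2, es2) E indep" for M1 es1 M2 es2
      using that by (rule well_defined)
    show "module_isomorphic eis_ring (Jac M')
        (finite_direct_sum {..<r} (\<lambda>i. cyclic_module eis_ring (\<alpha>s ! i)))"
      if "H_representation (M, es) E indep" "M \<in> carrier_mat r n"
        "eis_smith_diagonal (M * mat_adjoint M) \<alpha>s" "H_representation (M', es') E indep"
      for M es \<alpha>s M' es'
      using module_isomorphic_trans[OF well_defined[OF that(4,1)]] structure_thm[OF that(1-3)] by blast
    show "(\<alpha>s ! i) ^ 6 \<in> \<int> - {0}"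
      if "H_representation (M, es) E indep" "M \<in> carrier_mat r n"
        "eis_smith_diagonal (M * mat_adjoint M) \<alpha>s" "i < r" for M es \<alpha>s i
      using structure_thm[OF that(1-3)] that(4) by blast
  qed
qed

end
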